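(* Let $p\ge1$ be an integer and $Q>0$. Let $\{\lambda(k)\}_{k\ge1}$ be a probability distribution on $\{1,2,\dots\}$ with $\lambda(k)\ge a\,e^{-\gamma k}$ for all $k\ge1$, for some constants $a,\gamma>0$. Let $\pi$ be the restriction to $E_p(Q)$ of the sieve prior $\mu=\sum_{k=1}^\infty\lambda(k)\mu_k$, i.e. $\pi(\cdot)=\mu(\cdot\cap E_p(Q))/\mu(E_p(Q))$, where $\mu_k$ is the Gaussian product measure defined in the context, and let $\hat f_n$ be the Bayes' estimator (posterior expected density) arising from $\pi$. Then for any $0<Q'<Q$, $$\sup_{\boldsymbol\theta_0\in E_p(Q')}\mathbb E^n_{\boldsymbol\theta_0}\big[d_{\mathrm H}^2(f_{\boldsymbol\theta_0},\hat f_n)\big]\asymp n^{-2p/(2p+1)}.$$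
   Context: Trigonometric system on $[0,1]$: $\phi_0\equiv1$ and, for $k\ge1$, $\phi_{2k-1}(x)=\sqrt2\sin(2\pi kx)$, $\phi_{2k}(x)=\sqrt2\cos(2\pi kx)$. Put $v_0=0$ and, for $j\ge1$, $v_j=j+1$ if $j$ is odd, $v_j=j$ if $j$ is even. For $R>0$ the Sobolev ellipsoid is $E_p(R)=\{\boldsymbol\theta\in\ell_2:\sum_{j=0}^\infty v_j^{2p}\theta_j^2<R\}$. For $\boldsymbol\theta\in E_p(Q)$, $P_{\boldsymbol\theta}$ is the probability measure on $[0,1]$ with Lebesgue density $$f_{\boldsymbol\theta}(x)=\frac{\exp\{\sum_{j=1}^\infty\theta_j\phi_j(x)\}}{\int_0^1\exp\{\sum_{j=1}^\infty\theta_j\phi_j(t)\}\,dt},\qquad x\in[0,1].$$ The Hellinger distance between densities is $d_{\mathrm H}(f,g)=\{\int_0^1(\sqrt f-\sqrt g)^2\,dx\}^{1/2}$. For $k\ge1$, $\mu_k$ is the probability measure on sequences $(\theta_0,\theta_1,\dots)$ under which the coordinates are independent, $\theta_0\equiv0$, $\theta_j\sim N(0,v_j^{-(2p+1)})$ for $j=1,\dots,k$, and $\theta_j\equiv0$ for all $j>k$. The Bayes' estimator based on observations $X_1,\dots,X_n$ is $$\hat f_n(x)=\frac{\int f_{\boldsymbol\theta}(x)\prod_{i=1}^nf_{\boldsymbol\theta}(X_i)\,\pi(d\boldsymbol\theta)}{\int\prod_{i=1}^nf_{\boldsymbol\theta}(X_i)\,\pi(d\boldsymbol\theta)},\qquad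 x\in[0,1].$$ $\mathbb E^n_{\boldsymbol\theta_0}$ denotes expectation when $X_1,\dots,X_n$ are i.i.d. from $P_{\boldsymbol\theta_0}$. $a_n\asymp b_n$ means that there are constants $0<c\le C<\infty$ with $c\,b_n\le a_n\le C\,b_n$ for all large $n$. *)

theory Defs
  imports "HOL-Probability.Probability"
begin

definition trig :: "nat \<Rightarrow> real \<Rightarrow> real" where
  "trig j x =
     (if j = 0 then 1
      else if odd j then sqrt 2 * sin (2 * pi * real ((j + 1) div 2) * x)
      else sqrt 2 * cos (2 * pi * real (j div 2) * x))"

lemma trig_0: "trig 0 x = 1"
  by (simp add: trig_def)

lemma trig_odd: "k \<ge> 1 \<Longrightarrow> trig (2 * k - 1) x = sqrt 2 * sin (2 * pi * real k * x)"
  by (auto simp: trig_def)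

lemma trig_even: "k \<ge> 1 \<Longrightarrow> trig (2 * k) x = sqrt 2 * cos (2 * pi * real k * x)"
  by (auto simp: trig_def)

definition vseq :: "nat \<Rightarrow> real" where
  "vseq j = (if odd j then real j + 1 else real j)"

definition ellipsoid :: "nat \<Rightarrow> real \<Rightarrow> (nat \<Rightarrow> real) set" where
  "ellipsoid p R =
     {\<theta>. summable (\<lambda>j. (\<theta> j)\<^sup>2) \<and> summable (\<lambda>j. vseq j ^ (2 * p) * (\<theta> j)\<^sup>2) \<and>
          (\<Sum>j. vseq j ^ (2 * p) * (\<theta> j)\<^sup>2) < R}"

abbreviation lebesgue01 :: "real measure" where
  "lebesgue01 \<equiv> restrict_space lborel {0..1}"

definition log_series :: "(nat \<Rightarrow> real) \<Rightarrow> real \<Rightarrow> real" where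
  "log_series \<theta> x = (\<Sum>j. \<theta> (Suc j) * trig (Suc j) x)"

definition dens :: "(nat \<Rightarrow> real) \<Rightarrow> real \<Rightarrow> real" where
  "dens \<theta> x = exp (log_series \<theta> x) / (\<integral>t. exp (log_series \<theta> t) \<partial>lebesgue01)"

definition dens_measure :: "(nat \<Rightarrow> real) \<Rightarrow> real measure" where
  "dens_measure \<theta> = density lebesgue01 (\<lambda>x. ennreal (dens \<theta> x))"

definition hellinger :: "(real \<Rightarrow> real) \<Rightarrow> (real \<Rightarrow> real) \<Rightarrow> real" where
  "hellinger f g = sqrt (\<integral>x. (sqrt (f x) - sqrt (g x))\<^sup>2 \<partial>lebesgue01)"

text \<open>\<^const>\<open>normal_density\<close> takes the standard deviation, not the variance.\<close>

definition coord_prior :: "nat \<Rightarrow> nat \<Rightarrow> nat \<Rightarrow> real measure" where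
  "coord_prior p k j =
     (if 1 \<le> j \<and> j \<le> k
      then density lborel (\<lambda>t. ennreal (normal_density 0 (sqrt (1 / vseq j ^ (2 * p + 1))) t))
      else return borel 0)"

definition gauss_prior :: "nat \<Rightarrow> nat \<Rightarrow> (nat \<Rightarrow> real) measure" where
  "gauss_prior p k = (\<Pi>\<^sub>M j\<in>UNIV. coord_prior p k j)"

definition sieve_prior :: "nat \<Rightarrow> nat pmf \<Rightarrow> (nat \<Rightarrow> real) measure" where
  "sieve_prior p lam = measure_pmf lam \<bind> gauss_prior p"

definition restricted_prior :: "nat \<Rightarrow> nat pmf \<Rightarrow> real \<Rightarrow> (nat \<Rightarrow> real) measure" where
  "restricted_prior p lam Q = uniform_measure (sieve_prior p lam) (ellipsoid p Q)"

definition bayes_estimator ::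
    "(nat \<Rightarrow> real) measure \<Rightarrow> nat \<Rightarrow> (nat \<Rightarrow> real) \<Rightarrow> real \<Rightarrow> real" where
  "bayes_estimator prior n X x =
     (\<integral>\<theta>. dens \<theta> x * (\<Prod>i\<in>{1..n}. dens \<theta> (X i)) \<partial>prior) /
     (\<integral>\<theta>. (\<Prod>i\<in>{1..n}. dens \<theta> (X i)) \<partial>prior)"

text \<open>The loss is nonnegative, so its expectation is taken in \<^typ>\<open>ennreal\<close>; suprema of
  risks then carry no integrability or boundedness side conditions.\<close>

definition risk :: "(nat \<Rightarrow> real) measure \<Rightarrow> nat \<Rightarrow> (nat \<Rightarrow> real) \<Rightarrow> ennreal" where
  "risk prior n \<theta>\<^sub>0 =
     (\<integral>\<^sup>+X. ennreal ((hellinger (dens \<theta>\<^sub>0) (bayes_estimator prior n X))\<^sup>2)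
        \<partial>(\<Pi>\<^sub>M i\<in>{1..n}. dens_measure \<theta>\<^sub>0))"

lemma vseq_pos: "j \<ge> 1 \<Longrightarrow> vseq j > 0"
  by (simp add: vseq_def)

lemma sets_coord_prior: "sets (coord_prior p k j) = sets borel"
  by (simp add: coord_prior_def)

lemma prob_space_coord_prior: "prob_space (coord_prior p k j)"
  unfolding coord_prior_def
  by (auto intro!: prob_space_normal_density prob_space_return simp: vseq_pos)

lemma sets_gauss_prior: "sets (gauss_prior p k) = sets (\<Pi>\<^sub>M j\<in>UNIV. borel)"
  unfolding gauss_prior_def by (intro sets_PiM_cong refl sets_coord_prior)

lemma prob_space_gauss_prior: "prob_space (gauss_prior p k)"
  unfolding gauss_prior_def by (intro prob_space_PiM prob_space_coord_prior)

lemma gauss_prior_measurable: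
  "gauss_prior p \<in> measurable (measure_pmf lam) (prob_algebra (\<Pi>\<^sub>M j\<in>UNIV. borel))"
  by (auto simp: space_prob_algebra sets_gauss_prior prob_space_gauss_prior)

lemma sets_sieve_prior: "sets (sieve_prior p lam) = sets (\<Pi>\<^sub>M j\<in>UNIV. borel)"
  unfolding sieve_prior_def by (rule sets_bind) (simp_all add: sets_gauss_prior)

lemma prob_space_sieve_prior: "prob_space (sieve_prior p lam)"
  unfolding sieve_prior_def
  by (rule prob_space_bind'[OF _ gauss_prior_measurable])
     (simp add: space_prob_algebra measure_pmf.prob_space_axioms)

lemma emeasure_sieve_prior:
  assumes "A \<in> sets (\<Pi>\<^sub>M j\<in>UNIV. borel)"
  shows "emeasure (sieve_prior p lam) A = (\<Sum>k. ennreal (pmf lam k) * emeasure (gauss_prior p k) A)"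
proof -
  have "emeasure (sieve_prior p lam) A = (\<integral>\<^sup>+k. emeasure (gauss_prior p k) A \<partial>measure_pmf lam)"
    unfolding sieve_prior_def
    by (rule emeasure_bind[OF _ measurable_prob_algebraD[OF gauss_prior_measurable] assms]) simp
  also have "\<dots> = (\<Sum>k. ennreal (pmf lam k) * emeasure (gauss_prior p k) A)"
    by (simp add: nn_integral_measure_pmf nn_integral_count_space_nat)
  finally show ?thesis .
qed

lemma summable_iff_ennreal:
  fixes f :: "nat \<Rightarrow> real"
  assumes "\<And>j. 0 \<le> f j"
  shows "summable f \<longleftrightarrow> (\<Sum>j. ennreal (f j)) \<noteq> top"
  using assms summable_suminf_not_top[of f] ennreal_suminf_neq_top[of f] by blast

lemma ellipsoid_measurable: "ellipsoid p R \<in> sets (\<Pi>\<^sub>M j\<in>UNIV. borel)"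
proof -
  have summable_eq:
    "summable (\<lambda>j. w j * (\<theta> j)\<^sup>2) \<longleftrightarrow> \<not> (\<Sum>j. ennreal (w j * (\<theta> j)\<^sup>2)) = top"
    if "\<And>j. 0 \<le> w j" for w \<theta> :: "nat \<Rightarrow> real"
    using that by (intro summable_iff_ennreal) simp
  have summable_set:
    "{\<theta>. summable (\<lambda>j. w j * (\<theta> j)\<^sup>2)} \<in> sets (\<Pi>\<^sub>M j\<in>UNIV. borel)"
    if "\<And>j. 0 \<le> w j" for w :: "nat \<Rightarrow> real"
  proof -
    have "(\<lambda>\<theta>. \<Sum>j. ennreal (w j * (\<theta> j)\<^sup>2)) \<in> borel_measurable (\<Pi>\<^sub>M j\<in>UNIV. borel)"
      by measurable
    then have "(\<lambda>\<theta>. \<Sum>j. ennreal (w j * (\<theta> j)\<^sup>2)) -` (- {top}) \<inter> space (\<Pi>\<^sub>M j\<in>UNIV. borel)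
        \<in> sets (\<Pi>\<^sub>M j\<in>UNIV. borel)"
      by (rule measurable_sets) simp
    then show ?thesis
      unfolding summable_eq[OF that] by (simp add: space_PiM vimage_def)
  qed
  have "(\<lambda>\<theta>. \<Sum>j. vseq j ^ (2 * p) * (\<theta> j)\<^sup>2) \<in> borel_measurable (\<Pi>\<^sub>M j\<in>UNIV. borel)"
    by measurable
  then have "(\<lambda>\<theta>. \<Sum>j. vseq j ^ (2 * p) * (\<theta> j)\<^sup>2) -` {..<R} \<inter> space (\<Pi>\<^sub>M j\<in>UNIV. borel)
      \<in> sets (\<Pi>\<^sub>M j\<in>UNIV. borel)"
    by (rule measurable_sets) simp
  then have less_set: "{\<theta>. (\<Sum>j. vseq j ^ (2 * p) * (\<theta> j)\<^sup>2) < R} \<in> sets (\<Pi>\<^sub>M j\<in>UNIV. borel)"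
    by (simp add: space_PiM vimage_def)
  have "ellipsoid p R = {\<theta>. summable (\<lambda>j. 1 * (\<theta> j)\<^sup>2)} \<inter>
      {\<theta>. summable (\<lambda>j. vseq j ^ (2 * p) * (\<theta> j)\<^sup>2)} \<inter>
      {\<theta>. (\<Sum>j. vseq j ^ (2 * p) * (\<theta> j)\<^sup>2) < R}"
    unfolding ellipsoid_def mult_1 by blast
  also have "\<dots> \<in> sets (\<Pi>\<^sub>M j\<in>UNIV. borel)"
    by (intro sets.Int summable_set less_set) (simp_all add: vseq_def)
  finally show ?thesis .
qed

lemma emeasure_restricted_prior:
  assumes "A \<in> sets (\<Pi>\<^sub>M j\<in>UNIV. borel)"
  shows "emeasure (restricted_prior p lam Q) A =
    emeasure (sieve_prior p lam) (A \<inter> ellipsoid p Q) / emeasure (sieve_prior p lam) (ellipsoid p Q)"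
  using assms ellipsoid_measurable[of p Q]
  by (simp add: restricted_prior_def emeasure_uniform_measure sets_sieve_prior Int_commute)

end

theory Submission
  imports Defs
begin

text \<open>
  On the ellipsoid \<open>ellipsoid p Q\<close> the series \<open>log_series \<theta>\<close> is bounded by a constant that depends
  on \<open>Q\<close> only. All densities \<open>dens \<theta>\<close>, and every posterior mean of them, therefore take values in
  one interval \<open>[m, M]\<close> with \<open>m > 0\<close>. This makes squared Hellinger distance, squared \<open>L\<^sup>2\<close>
  distance, and chi-square divergence equivalent up to constants, and Parseval's identity compares them
  with the squared \<open>\<ell>\<^sup>2\<close> distance of the coefficients \<open>\<theta> 1, \<theta> 2, \<dots>\<close>. At the resolution
  \<open>k = n powr (1 / (2 * p + 1))\<close>, rounded up, the target rate is \<open>1 / k ^ (2 * p)\<close> up to constants and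
  \<open>n / k ^ (2 * p)\<close> is of the order of \<open>k\<close>. Quantities of size \<open>exp (constant * k)\<close> can thus be
  traded against \<open>exp (- constant * n * r)\<close> with \<open>r\<close> a multiple of the rate.

  For the upper bound three such quantities have to be compared. The prior puts mass at least
  \<open>exp (- A * k)\<close> on a ball of squared radius \<open>O(1 / k ^ (2 * p))\<close> around every truth in the smaller
  ellipsoid (\<open>gauss_prior_mass\<close>): the single component \<open>k\<close> of the mixture, of weight at least
  \<open>a * exp (- \<gamma> * k)\<close>, already does so. The whole ellipsoid is covered by \<open>exp (A' * k)\<close> balls of the
  same size (\<open>ellipsoid_covering\<close>). Finally, the statistic \<open>T = (\<Prod>i\<in>I. sqrt (q (X i) / g (X i)))\<close>
  separates the truth \<open>g\<close> from all densities in a small ball around a distant centre \<open>q\<close>, with errors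
  exponentially small in \<open>n\<close> times the squared distance. Multiplying by the number of balls and dividing by
  the prior mass leaves \<open>exp (- k)\<close>, so outside a ball of squared radius of the order of the rate the
  posterior has exponentially small expected mass (\<open>expected_posterior_tail_le\<close>). An exponential bound is
  essential, because the risk and not just a probability has to be of the order of the rate: the probability
  that the normalising integral of the posterior is small is controlled through the mean of reciprocal likelihood
  ratios and not through a variance. Convexity of the squared distance passes from the posterior to its mean
  (\<open>posterior_mean_risk_le\<close>).

  The lower bound is Assouad's argument on the cube of sequences with coordinates in \<open>{0, h}\<close> for
  \<open>1 \<le> j \<le> k\<close> and \<open>h\<^sup>2 = \<kappa> / k ^ (2 * p + 1)\<close>. The cube lies in the ellipsoid, and
  flipping one coordinate changes the law of the sample by a bounded chi-square divergence since \<open>n * h\<^sup>2\<close>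
  is bounded. The loss of the posterior mean dominates the sum of squared errors of the Fourier coefficients of its
  logarithm by Bessel's inequality (\<open>loss_lower_bound\<close>), and each of those errors is on average over the two
  values of the coordinate of order \<open>h\<^sup>2\<close> (\<open>two_point_lower_bound\<close>). Summing \<open>k\<close> coordinates gives
  \<open>k * h\<^sup>2 = \<kappa> / k ^ (2 * p)\<close>.
\<close>

section \<open>Samples from densities in a fixed interval\<close>

definition sqdist :: "'a measure \<Rightarrow> ('a \<Rightarrow> real) \<Rightarrow> ('a \<Rightarrow> real) \<Rightarrow> real" where
  "sqdist N g h = (\<integral>x. (g x - h x)\<^sup>2 \<partial>N)"

definition iid :: "'i set \<Rightarrow> 'a measure \<Rightarrow> ('a \<Rightarrow> real) \<Rightarrow> ('i \<Rightarrow> 'a) measure" where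
  "iid I N g = (\<Pi>\<^sub>M i\<in>I. density N (\<lambda>x. ennreal (g x)))"

lemma sets_iid: "sets (iid I N g) = sets (\<Pi>\<^sub>M i\<in>I. N)"
  unfolding iid_def by (intro sets_PiM_cong) auto

lemma space_iid: "space (iid I N g) = (\<Pi>\<^sub>E i\<in>I. space N)"
  unfolding iid_def by (simp add: space_PiM)

text \<open>
  A common lower bound \<open>m > 0\<close> and a common upper bound \<open>M\<close> turn the estimates for likelihood ratios
  below into estimates in the squared \<open>L\<^sup>2\<close> distance \<open>sqdist\<close>, which is quadratic in the difference
  of the densities and thereby compares directly with coefficients in an orthonormal system.
\<close>

locale density_bounds = prob_space N for N :: "'a measure" +
  fixes m M :: real
  assumes m_pos: "0 < m" and m_le_M: "m \<le> M"
begin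

definition bdens :: "('a \<Rightarrow> real) \<Rightarrow> bool" where
  "bdens g \<longleftrightarrow> g \<in> borel_measurable N \<and> (\<forall>x\<in>space N. m \<le> g x \<and> g x \<le> M) \<and> (\<integral>x. g x \<partial>N) = 1"

lemma M_pos: "0 < M" using m_pos m_le_M by simp

lemma bdensD:
  assumes "bdens g"
  shows "g \<in> borel_measurable N" "x \<in> space N \<Longrightarrow> m \<le> g x" "x \<in> space N \<Longrightarrow> g x \<le> M"
    "x \<in> space N \<Longrightarrow> 0 < g x" "(\<integral>x. g x \<partial>N) = 1" "integrable N g"
proof -
  show "g \<in> borel_measurable N" "(\<integral>x. g x \<partial>N) = 1"
    and "x \<in> space N \<Longrightarrow> m \<le> g x" "x \<in> space N \<Longrightarrow> g x \<le> M"
    using assms by (auto simp: bdens_def)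
  show "x \<in> space N \<Longrightarrow> 0 < g x" using assms m_pos by (force simp: bdens_def)
  show "integrable N g"
    using assms m_pos by (intro integrable_const_bound[where B = M]) (force simp: bdens_def)+
qed

lemma integrable_sqdist:
  assumes "bdens g" "bdens h"
  shows "integrable N (\<lambda>x. (g x - h x)\<^sup>2)"
proof (rule integrable_const_bound[where B = "M\<^sup>2"])
  show "AE x in N. norm ((g x - h x)\<^sup>2) \<le> M\<^sup>2"
  proof (rule AE_I2)
    fix x assume x: "x \<in> space N"
    have "\<bar>g x - h x\<bar> \<le> M" using bdensD[OF assms(1)] bdensD[OF assms(2)] x m_pos by force
    then have "\<bar>g x - h x\<bar>\<^sup>2 \<le> M\<^sup>2" by (intro power_mono) auto
    then show "norm ((g x - h x)\<^sup>2) \<le> M\<^sup>2" by simp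
  qed
  show "(\<lambda>x. (g x - h x)\<^sup>2) \<in> borel_measurable N"
    using bdensD(1)[OF assms(1)] bdensD(1)[OF assms(2)] by measurable
qed

lemma sqdist_nonneg: "0 \<le> sqdist N g h"
  by (simp add: sqdist_def)

lemma sqdist_le: assumes "bdens g" "bdens h" shows "sqdist N g h \<le> M\<^sup>2"
proof -
  have "sqdist N g h \<le> (\<integral>x. M\<^sup>2 \<partial>N)" unfolding sqdist_def
  proof (rule integral_mono)
    fix x assume x: "x \<in> space N"
    have "\<bar>g x - h x\<bar> \<le> M" using bdensD[OF assms(1)] bdensD[OF assms(2)] x m_pos by force
    then have "\<bar>g x - h x\<bar>\<^sup>2 \<le> M\<^sup>2" by (intro power_mono) auto
    then show "(g x - h x)\<^sup>2 \<le> M\<^sup>2" by simp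
  qed (use integrable_sqdist[OF assms] in simp_all)
  then show ?thesis by (simp add: prob_space)
qed

lemma sqdist_triangle:
  assumes "bdens f" "bdens g" "bdens h"
  shows "sqdist N f h \<le> 2 * sqdist N f g + 2 * sqdist N g h"
proof -
  have "sqdist N f h \<le> (\<integral>x. 2 * (f x - g x)\<^sup>2 + 2 * (g x - h x)\<^sup>2 \<partial>N)"
    unfolding sqdist_def
  proof (rule integral_mono)
    fix x
    have "0 \<le> ((f x - g x) - (g x - h x))\<^sup>2" by simp
    then show "(f x - h x)\<^sup>2 \<le> 2 * (f x - g x)\<^sup>2 + 2 * (g x - h x)\<^sup>2"
      by (simp add: power2_eq_square algebra_simps)
  qed (use assms integrable_sqdist in auto)
  also have "\<dots> = 2 * sqdist N f g + 2 * sqdist N g h"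
    using integrable_sqdist assms by (simp add: sqdist_def)
  finally show ?thesis .
qed

lemma sqdist_commute: "sqdist N g h = sqdist N h g"
  by (simp add: sqdist_def power2_commute)

lemma sqrt_diff_sq_ge:
  fixes a b :: real
  assumes "0 < a" "0 < b" "a \<le> M" "b \<le> M"
  shows "(a - b)\<^sup>2 / (4 * M) \<le> (sqrt a - sqrt b)\<^sup>2"
proof -
  have "(sqrt a + sqrt b)\<^sup>2 \<le> (2 * sqrt M)\<^sup>2"
    using assms real_sqrt_le_mono[of a M] real_sqrt_le_mono[of b M]
    by (intro power_mono) (simp_all del: real_sqrt_le_iff)
  also have "\<dots> = 4 * M" using M_pos by (simp add: power_mult_distrib)
  finally have s: "(sqrt a + sqrt b)\<^sup>2 \<le> 4 * M" .
  have "a - b = (sqrt a - sqrt b) * (sqrt a + sqrt b)"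
    using assms by (simp add: algebra_simps flip: power2_eq_square)
  then have "(a - b)\<^sup>2 = (sqrt a - sqrt b)\<^sup>2 * (sqrt a + sqrt b)\<^sup>2"
    by (simp add: power_mult_distrib)
  also have "\<dots> \<le> (sqrt a - sqrt b)\<^sup>2 * (4 * M)"
    by (intro mult_left_mono s) simp
  finally show ?thesis using M_pos by (simp add: divide_le_eq)
qed

lemma sqrt_diff_sq_le:
  fixes a b :: real
  assumes "m \<le> a" "m \<le> b"
  shows "(sqrt a - sqrt b)\<^sup>2 \<le> (a - b)\<^sup>2 / (4 * m)"
proof -
  have "(2 * sqrt m)\<^sup>2 \<le> (sqrt a + sqrt b)\<^sup>2"
    using m_pos real_sqrt_le_mono[OF assms(1)] real_sqrt_le_mono[OF assms(2)]
    by (intro power_mono) (simp_all del: real_sqrt_le_iff)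
  then have s: "4 * m \<le> (sqrt a + sqrt b)\<^sup>2" using m_pos by (simp add: power_mult_distrib)
  have "a - b = (sqrt a - sqrt b) * (sqrt a + sqrt b)"
    using assms m_pos by (simp add: algebra_simps flip: power2_eq_square)
  then have "(a - b)\<^sup>2 = (sqrt a - sqrt b)\<^sup>2 * (sqrt a + sqrt b)\<^sup>2"
    by (simp add: power_mult_distrib)
  also have "\<dots> \<ge> (sqrt a - sqrt b)\<^sup>2 * (4 * m)"
    by (intro mult_left_mono s) simp
  finally show ?thesis using m_pos by (simp add: le_divide_eq)
qed

lemma affinity_pointwise:
  fixes q g :: real
  assumes "0 < g" "0 < q" "g \<le> M" "q \<le> M"
  shows "sqrt (q / g) * g \<le> (q + g) / 2 - (g - q)\<^sup>2 / (8 * M)"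
proof -
  have "sqrt (q / g) * g = sqrt q * sqrt g"
    using assms by (simp add: real_sqrt_divide field_simps flip: power2_eq_square)
  moreover have "(sqrt g - sqrt q)\<^sup>2 = g + q - 2 * (sqrt q * sqrt g)"
    using assms by (simp add: power2_diff)
  moreover have "(g - q)\<^sup>2 / (4 * M) \<le> (sqrt g - sqrt q)\<^sup>2"
    using assms by (intro sqrt_diff_sq_ge)
  ultimately show ?thesis by (simp add: field_simps)
qed

text \<open>
  Under \<open>f\<close> the reciprocal of the test statistic \<open>sqrt (q / g)\<close> has mean \<open>\<integral> f * sqrt (g / q)\<close>. For
  \<open>f = q\<close> this is the affinity of \<open>q\<close> and \<open>g\<close>. Replacing \<open>q\<close> by \<open>f\<close> costs
  \<open>(f - q) * (sqrt (g / q) - 1)\<close>, which is split by the inequality between arithmetic and geometric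
  mean so that half of the gain \<open>(g - q)\<^sup>2 / (8 * M)\<close> survives.
\<close>

lemma tilt_pointwise:
  fixes f q g :: real
  assumes "m \<le> g" "m \<le> q" "g \<le> M" "q \<le> M"
  shows "f / g / sqrt (q / g) * g
      \<le> (g - q) / 2 + f - (g - q)\<^sup>2 / (16 * M) + M / m\<^sup>2 * (f - q)\<^sup>2"
proof -
  have pos: "0 < g" "0 < q" using assms m_pos by auto
  define s where "s = sqrt (g / q)"
  have s: "f / g / sqrt (q / g) * g = f * s"
    using pos by (simp add: s_def real_sqrt_divide field_simps)
  have qs: "q * s = sqrt (q / g) * g"
    using pos by (simp add: s_def real_sqrt_divide field_simps flip: power2_eq_square)
  have qs_le: "q * s \<le> (q + g) / 2 - (g - q)\<^sup>2 / (8 * M)"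
    unfolding qs using pos assms by (intro affinity_pointwise)
  have s2: "s\<^sup>2 = g / q" using pos by (simp add: s_def)
  have s_ge: "0 < s" using pos by (simp add: s_def)
  have sg: "(s - 1)\<^sup>2 \<le> (g - q)\<^sup>2 / (4 * m\<^sup>2)"
  proof -
    have "(sqrt g - sqrt q)\<^sup>2 = q * (s - 1)\<^sup>2"
      using pos by (simp add: s_def real_sqrt_divide power2_diff field_simps)
    then have "m * (s - 1)\<^sup>2 \<le> (sqrt g - sqrt q)\<^sup>2"
      using assms by (simp add: mult_right_mono)
    also have "\<dots> \<le> (g - q)\<^sup>2 / (4 * m)" using assms by (intro sqrt_diff_sq_le)
    finally show ?thesis using m_pos by (simp add: field_simps power2_eq_square)
  qed
  have "(f - q) * (s - 1) \<le> M / m\<^sup>2 * (f - q)\<^sup>2 + m\<^sup>2 / (4 * M) * (s - 1)\<^sup>2"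
  proof -
    define u where "u = sqrt M / m * (f - q)"
    define v where "v = m / (2 * sqrt M) * (s - 1)"
    have "0 \<le> (u - v)\<^sup>2" by simp
    moreover have "u\<^sup>2 = M / m\<^sup>2 * (f - q)\<^sup>2" "v\<^sup>2 = m\<^sup>2 / (4 * M) * (s - 1)\<^sup>2"
      using M_pos by (simp_all add: u_def v_def power_mult_distrib power_divide)
    moreover have "2 * u * v = (f - q) * (s - 1)"
      using M_pos m_pos by (simp add: u_def v_def)
    ultimately show ?thesis by (simp add: power2_diff)
  qed
  also have "m\<^sup>2 / (4 * M) * (s - 1)\<^sup>2 \<le> m\<^sup>2 / (4 * M) * ((g - q)\<^sup>2 / (4 * m\<^sup>2))"
    using M_pos by (intro mult_left_mono sg) auto
  also have "\<dots> = (g - q)\<^sup>2 / (16 * M)" using m_pos by simp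
  finally have c: "(f - q) * (s - 1) \<le> M / m\<^sup>2 * (f - q)\<^sup>2 + (g - q)\<^sup>2 / (16 * M)" by simp
  have "f * s = q * s + (f - q) + (f - q) * (s - 1)" by (simp add: algebra_simps)
  also have "\<dots> \<le> ((q + g) / 2 - (g - q)\<^sup>2 / (8 * M)) + (f - q)
      + (M / m\<^sup>2 * (f - q)\<^sup>2 + (g - q)\<^sup>2 / (16 * M))"
    using qs_le c by simp
  also have "\<dots> = (g - q) / 2 + f - (g - q)\<^sup>2 / (16 * M) + M / m\<^sup>2 * (f - q)\<^sup>2"
    by (simp add: field_simps)
  finally show ?thesis unfolding s .
qed

lemma chi_pointwise:
  fixes f g :: real
  assumes "m \<le> f"
  shows "g / f * g \<le> 2 * g - f + (g - f)\<^sup>2 / m"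
proof -
  have f: "0 < f" using assms m_pos by simp
  have "g / f * g = 2 * g - f + (g - f)\<^sup>2 / f"
    using f by (simp add: field_simps power2_eq_square)
  also have "(g - f)\<^sup>2 / f \<le> (g - f)\<^sup>2 / m"
    using assms m_pos by (intro divide_left_mono) auto
  finally show ?thesis by simp
qed

lemma prob_space_bdens:
  assumes "bdens g" shows "prob_space (density N (\<lambda>x. ennreal (g x)))"
proof (rule prob_spaceI)
  have [measurable]: "g \<in> borel_measurable N" using bdensD(1)[OF assms] .
  have "emeasure (density N (\<lambda>x. ennreal (g x))) (space N) = (\<integral>\<^sup>+x. ennreal (g x) \<partial>N)"
    by (simp add: emeasure_density cong: nn_integral_cong)
  also have "\<dots> = 1"
    using bdensD[OF assms] by (subst nn_integral_eq_integral) (auto intro!: AE_I2 simp: less_imp_le)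
  finally show "emeasure (density N (\<lambda>x. ennreal (g x))) (space (density N (\<lambda>x. ennreal (g x)))) = 1"
    by simp
qed

lemma product_prob_space_bdens:
  assumes "bdens g" shows "product_prob_space (\<lambda>_. density N (\<lambda>x. ennreal (g x)))"
  using prob_space_bdens[OF assms]
  by (simp add: product_prob_space_def product_prob_space_axioms_def product_sigma_finite_def
      prob_space_imp_sigma_finite)

lemma prob_space_iid: "bdens g \<Longrightarrow> prob_space (iid I N g)"
  unfolding iid_def by (intro prob_space_PiM prob_space_bdens)

text \<open>
  Independence turns the mean of a product into a power. The majorant \<open>u\<close> lets the pointwise inequalities
  above be used although the integral of \<open>h * g\<close> itself has no closed form.
\<close>

lemma nn_integral_iid_prod:
  assumes g: "bdens g" and h: "h \<in> borel_measurable N" "\<And>x. x \<in> space N \<Longrightarrow> 0 \<le> h x"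
    and u: "integrable N u" "\<And>x. x \<in> space N \<Longrightarrow> h x * g x \<le> u x" "(\<integral>x. u x \<partial>N) \<le> c"
    and "finite I" "0 \<le> c"
  shows "(\<integral>\<^sup>+X. ennreal (\<Prod>i\<in>I. h (X i)) \<partial>iid I N g) \<le> ennreal (c ^ card I)"
proof -
  let ?D = "density N (\<lambda>x. ennreal (g x))"
  have [measurable]: "g \<in> borel_measurable N" "h \<in> borel_measurable N"
    using bdensD(1)[OF g] h(1) by auto
  interpret D: product_prob_space "\<lambda>_. ?D" I by (rule product_prob_space_bdens[OF g])
  have "(\<integral>\<^sup>+X. ennreal (\<Prod>i\<in>I. h (X i)) \<partial>iid I N g)
      = (\<integral>\<^sup>+X. (\<Prod>i\<in>I. ennreal (h (X i))) \<partial>iid I N g)"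
    unfolding iid_def
    by (intro nn_integral_cong prod_ennreal[symmetric]) (auto simp: space_PiM intro!: h(2))
  also have "\<dots> = (\<Prod>i\<in>I. \<integral>\<^sup>+x. ennreal (h x) \<partial>?D)"
    unfolding iid_def by (rule D.product_nn_integral_prod) (use \<open>finite I\<close> in auto)
  also have "\<dots> = (\<integral>\<^sup>+x. ennreal (h x) \<partial>?D) ^ card I" by simp
  also have "(\<integral>\<^sup>+x. ennreal (h x) \<partial>?D) = (\<integral>\<^sup>+x. ennreal (g x) * ennreal (h x) \<partial>N)"
    by (subst nn_integral_density) auto
  also have "\<dots> = (\<integral>\<^sup>+x. ennreal (h x * g x) \<partial>N)"
    using h(2) bdensD(4)[OF g]
    by (intro nn_integral_cong) (simp add: ennreal_mult'' less_imp_le mult.commute)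
  also have "\<dots> \<le> (\<integral>\<^sup>+x. ennreal (u x) \<partial>N)"
    using u(2) by (intro nn_integral_mono ennreal_leI)
  also have "\<dots> = ennreal (\<integral>x. u x \<partial>N)"
    using u(1) order_trans[OF mult_nonneg_nonneg[OF h(2) less_imp_le[OF bdensD(4)[OF g]]] u(2)]
    by (intro nn_integral_eq_integral AE_I2) auto
  also have "\<dots> \<le> ennreal c" using u by (intro ennreal_leI)
  finally have "(\<integral>\<^sup>+X. ennreal (\<Prod>i\<in>I. h (X i)) \<partial>iid I N g) \<le> ennreal c ^ card I"
    by (simp add: power_mono)
  then show ?thesis using \<open>0 \<le> c\<close> by (simp add: ennreal_power)
qed

text \<open>
  The statistic \<open>\<Prod>i\<in>I. sqrt (q (X i) / g (X i))\<close> is small when the sample comes from \<open>g\<close> and \<open>q\<close>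
  is far away: it plays the role of a test of \<open>g\<close> against the neighbourhood of \<open>q\<close>.
\<close>

lemma affinity_iid:
  assumes "bdens g" "bdens q" "finite I"
  shows "(\<integral>\<^sup>+X. ennreal (\<Prod>i\<in>I. sqrt (q (X i) / g (X i))) \<partial>iid I N g)
     \<le> ennreal (exp (- (real (card I) * sqdist N g q / (8 * M))))"
proof -
  note gq = bdensD[OF assms(1)] bdensD[OF assms(2)]
  note [measurable] = gq(1) gq(7)
  let ?u = "\<lambda>x. (q x + g x) / 2 - (g x - q x)\<^sup>2 / (8 * M)"
  have i: "(\<integral>x. ?u x \<partial>N) = 1 - sqdist N g q / (8 * M)" "integrable N ?u"
    using gq integrable_sqdist[OF assms(1,2)] by (simp_all add: sqdist_def)
  have "(\<integral>\<^sup>+X. ennreal (\<Prod>i\<in>I. sqrt (q (X i) / g (X i))) \<partial>iid I N g)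
      \<le> ennreal (exp (- (sqdist N g q / (8 * M))) ^ card I)"
  proof (rule nn_integral_iid_prod[OF assms(1), where u = ?u])
    show "(\<lambda>x. sqrt (q x / g x)) \<in> borel_measurable N" by measurable
    show "x \<in> space N \<Longrightarrow> sqrt (q x / g x) * g x \<le> ?u x" for x
      using gq by (intro affinity_pointwise) auto
    show "(\<integral>x. ?u x \<partial>N) \<le> exp (- (sqdist N g q / (8 * M)))"
      unfolding i using exp_ge_add_one_self[of "- (sqdist N g q / (8 * M))"] by simp
  qed (use i gq assms in \<open>auto simp: less_imp_le\<close>)
  then show ?thesis by (simp flip: exp_of_nat_mult)
qed

text \<open>
  The corresponding error of the second kind, uniformly for \<open>f\<close> near \<open>q\<close>. It is written as a mean
  under \<open>g\<close> because the posterior is analysed with samples from \<open>g\<close>.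
\<close>

lemma tilt_iid:
  assumes "bdens g" "bdens q" "bdens f" "finite I"
  shows "(\<integral>\<^sup>+X. ennreal (\<Prod>i\<in>I. f (X i) / g (X i) / sqrt (q (X i) / g (X i))) \<partial>iid I N g)
     \<le> ennreal (exp (- (real (card I) * (sqdist N g q / (16 * M) - M / m\<^sup>2 * sqdist N f q))))"
proof -
  note gq = bdensD[OF assms(1)] bdensD[OF assms(2)] bdensD[OF assms(3)]
  note [measurable] = gq(1) gq(7) gq(13)
  let ?u = "\<lambda>x. (g x - q x) / 2 + f x - (g x - q x)\<^sup>2 / (16 * M) + M / m\<^sup>2 * (f x - q x)\<^sup>2"
  let ?e = "sqdist N g q / (16 * M) - M / m\<^sup>2 * sqdist N f q"
  have i: "(\<integral>x. ?u x \<partial>N) = 1 - ?e" "integrable N ?u"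
    using gq integrable_sqdist[OF assms(1,2)] integrable_sqdist[OF assms(3,2)]
    by (simp_all add: sqdist_def)
  have "(\<integral>\<^sup>+X. ennreal (\<Prod>i\<in>I. f (X i) / g (X i) / sqrt (q (X i) / g (X i))) \<partial>iid I N g)
      \<le> ennreal (exp (- ?e) ^ card I)"
  proof (rule nn_integral_iid_prod[OF assms(1), where u = ?u])
    show "(\<lambda>x. f x / g x / sqrt (q x / g x)) \<in> borel_measurable N" by measurable
    show "x \<in> space N \<Longrightarrow> f x / g x / sqrt (q x / g x) * g x \<le> ?u x" for x
      using gq by (intro tilt_pointwise) auto
    show "(\<integral>x. ?u x \<partial>N) \<le> exp (- ?e)"
      unfolding i by (rule order_trans[OF _ exp_ge_add_one_self]) simp
  qed (use i gq assms in \<open>auto simp: less_imp_le\<close>)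
  moreover have "exp (- ?e) ^ card I = exp (- (real (card I) * ?e))"
    by (simp only: exp_of_nat_mult[symmetric] mult_minus_right)
  ultimately show ?thesis by (simp only:)
qed

text \<open>
  The mean of the reciprocal likelihood ratio is a power of one plus a chi-square divergence.
\<close>

lemma chi_iid:
  assumes "bdens g" "bdens f" "finite I"
  shows "(\<integral>\<^sup>+X. ennreal (\<Prod>i\<in>I. g (X i) / f (X i)) \<partial>iid I N g)
     \<le> ennreal (exp (real (card I) * sqdist N g f / m))"
proof -
  note gq = bdensD[OF assms(1)] bdensD[OF assms(2)]
  note [measurable] = gq(1) gq(7)
  let ?u = "\<lambda>x. 2 * g x - f x + (g x - f x)\<^sup>2 / m"
  have i: "(\<integral>x. ?u x \<partial>N) = 1 + sqdist N g f / m" "integrable N ?u"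
    using gq integrable_sqdist[OF assms(1,2)] by (simp_all add: sqdist_def)
  have "(\<integral>\<^sup>+X. ennreal (\<Prod>i\<in>I. g (X i) / f (X i)) \<partial>iid I N g)
      \<le> ennreal (exp (sqdist N g f / m) ^ card I)"
  proof (rule nn_integral_iid_prod[OF assms(1), where u = ?u])
    show "(\<lambda>x. g x / f x) \<in> borel_measurable N" by measurable
    show "x \<in> space N \<Longrightarrow> g x / f x * g x \<le> ?u x" for x
      using gq by (intro chi_pointwise) auto
    show "(\<integral>x. ?u x \<partial>N) \<le> exp (sqdist N g f / m)"
      unfolding i by (rule exp_ge_add_one_self)
  qed (use i gq assms in \<open>auto simp: less_imp_le\<close>)
  then show ?thesis by (simp flip: exp_of_nat_mult)
qed

end

section \<open>Contraction of the posterior and risk of the posterior mean\<close>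

text \<open>
  With \<open>w\<close> the likelihood ratio, the left side is the posterior probability of \<open>A\<close>. If the normalising
  integral is below \<open>d0\<close>, the first term on the right is at least one: this is Jensen's inequality for the
  convex function \<open>1 / x\<close> on \<open>B\<close>, and its mean only involves reciprocal likelihood ratios. Otherwise
  \<open>A\<close> is split into cells, and a ratio \<open>y\<close> in \<open>[0, 1]\<close> is at most \<open>T + y / T\<close> for every
  \<open>T > 0\<close>: there is no need to decide whether the test rejects.
\<close>

lemma (in prob_space) posterior_tail_le:
  fixes w :: "'a \<Rightarrow> real" and T :: "'c \<Rightarrow> real"
  assumes w[measurable]: "w \<in> borel_measurable M"
    and bd: "0 < lo" "\<And>t. t \<in> space M \<Longrightarrow> lo \<le> w t" "\<And>t. t \<in> space M \<Longrightarrow> w t \<le> hi"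
    and sets[measurable]: "A \<in> sets M" "B \<in> sets M" "\<And>c. c \<in> C \<Longrightarrow> Ac c \<in> sets M"
    and B: "0 < prob B" and d0: "0 < d0"
    and C: "finite C" "A \<subseteq> (\<Union>c\<in>C. Ac c)" "\<And>c. c \<in> C \<Longrightarrow> 0 < T c"
  shows "(\<integral>t. indicat_real A t * w t \<partial>M) / (\<integral>t. w t \<partial>M)
    \<le> d0 / (prob B)\<^sup>2 * (\<integral>t. indicat_real B t * (1 / w t) \<partial>M)
      + (\<Sum>c\<in>C. T c + (\<integral>t. indicat_real (Ac c) t * w t \<partial>M) / (d0 * T c))"
    (is "?N A / ?D \<le> ?R1 + ?R2")
proof -
  have wpos: "0 < w t" if "t \<in> space M" for t using bd(1) bd(2)[OF that] by linarith
  obtain t0 where "t0 \<in> space M" using not_empty by auto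
  then have hi: "0 \<le> hi" using bd(3)[of t0] wpos[of t0] by linarith
  have iw: "integrable M w"
    by (rule integrable_const_bound[where B = hi])
      (use bd wpos in \<open>auto intro!: AE_I2 simp: less_imp_le\<close>)
  have iS: "integrable M (\<lambda>t. indicat_real S t * w t)" if [measurable]: "S \<in> sets M" for S
    by (rule integrable_const_bound[where B = hi])
      (use bd wpos hi in \<open>auto intro!: AE_I2 split: split_indicator simp: less_imp_le\<close>)
  have iB: "integrable M (\<lambda>t. indicat_real B t * (1 / w t))"
  proof (rule integrable_const_bound[where B = "1 / lo"])
    show "AE t in M. norm (indicat_real B t * (1 / w t)) \<le> 1 / lo"
      using bd wpos by (auto intro!: AE_I2 split: split_indicator simp: frac_le less_imp_le)
  qed measurable
  have "(\<integral>t. lo \<partial>M) \<le> ?D" using bd iw by (intro integral_mono) auto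
  then have D: "0 < ?D" using bd(1) by (simp add: prob_space)
  have N0: "0 \<le> ?N S" for S
    by (rule Bochner_Integration.integral_nonneg) (auto split: split_indicator simp: wpos less_imp_le)
  have NS: "?N S \<le> ?D" if "S \<in> sets M" for S
    using iS[OF that] iw wpos by (intro integral_mono) (auto split: split_indicator simp: less_imp_le)
  have R1: "0 \<le> ?R1"
    using d0 by (intro mult_nonneg_nonneg Bochner_Integration.integral_nonneg)
      (auto split: split_indicator simp: wpos less_imp_le)
  have R2: "0 \<le> ?R2"
    using d0 C(3) N0 by (intro sum_nonneg add_nonneg_nonneg divide_nonneg_nonneg) (auto simp: less_imp_le)
  show ?thesis
  proof (cases "?D < d0")
    case True
    define s where "s = d0 / prob B"
    have s: "0 < s" using B d0 by (simp add: s_def)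
    \<comment> \<open>The tangent of \<open>1 / x\<close> at \<open>s\<close> replaces Jensen; \<open>s\<close> bounds the mean of \<open>w\<close> over \<open>B\<close> when the normalising integral is below \<open>d0\<close>.\<close>
    have key: "2 / s - w t / s\<^sup>2 \<le> 1 / w t" if "t \<in> space M" for t
    proof -
      have "0 \<le> (1 - w t / s)\<^sup>2 / w t" using wpos[OF that] by simp
      also have "\<dots> = 1 / w t - (2 / s - w t / s\<^sup>2)"
        using wpos[OF that] s by (simp add: field_simps power2_eq_square)
      finally show ?thesis by simp
    qed
    have iI: "integrable M (\<lambda>t. indicat_real B t * (2 / s))"
      by (intro integrable_mult_left) (simp add: emeasure_eq_measure)
    have iN: "integrable M (\<lambda>t. indicat_real B t * w t / s\<^sup>2)"
      using iS[of B] by simp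
    have "(\<integral>t. indicat_real B t * (2 / s) - indicat_real B t * w t / s\<^sup>2 \<partial>M)
        \<le> (\<integral>t. indicat_real B t * (1 / w t) \<partial>M)"
      using key by (intro integral_mono Bochner_Integration.integrable_diff iI iN iB)
        (auto split: split_indicator)
    moreover have "(\<integral>t. indicat_real B t * (2 / s) - indicat_real B t * w t / s\<^sup>2 \<partial>M)
        = prob B * (2 / s) - ?N B / s\<^sup>2"
      by (subst Bochner_Integration.integral_diff[OF iI iN]) simp
    moreover have "?N B / s\<^sup>2 \<le> d0 / s\<^sup>2"
      using NS[of B] True by (intro divide_right_mono) auto
    ultimately have "prob B * (2 / s) - d0 / s\<^sup>2 \<le> (\<integral>t. indicat_real B t * (1 / w t) \<partial>M)"
      by linarith
    moreover have "prob B * (2 / s) - d0 / s\<^sup>2 = (prob B)\<^sup>2 / d0"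
      using B d0 by (simp add: s_def field_simps power2_eq_square)
    ultimately have "d0 / (prob B)\<^sup>2 * ((prob B)\<^sup>2 / d0) \<le> ?R1"
      using B d0 by (intro mult_left_mono) auto
    then have "1 \<le> ?R1" using B d0 by simp
    moreover have "?N A / ?D \<le> 1" using NS[of A] D by simp
    ultimately show ?thesis using R2 by linarith
  next
    case False
    have "?N A \<le> (\<integral>t. (\<Sum>c\<in>C. indicat_real (Ac c) t * w t) \<partial>M)"
    proof (rule integral_mono)
      fix t assume t: "t \<in> space M"
      show "indicat_real A t * w t \<le> (\<Sum>c\<in>C. indicat_real (Ac c) t * w t)"
      proof (cases "t \<in> A")
        case True
        then obtain c where c: "c \<in> C" "t \<in> Ac c" using C(2) by auto
        then have "indicat_real A t * w t \<le> indicat_real (Ac c) t * w t" using True by simp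
        also have "\<dots> \<le> (\<Sum>c\<in>C. indicat_real (Ac c) t * w t)"
          using c C(1) wpos[OF t] by (intro member_le_sum) (auto split: split_indicator simp: less_imp_le)
        finally show ?thesis .
      qed (use wpos[OF t] in \<open>auto intro!: sum_nonneg split: split_indicator simp: less_imp_le\<close>)
    qed (use iS in auto)
    also have "\<dots> = (\<Sum>c\<in>C. ?N (Ac c))" using iS by (intro Bochner_Integration.integral_sum) auto
    finally have "?N A / ?D \<le> (\<Sum>c\<in>C. ?N (Ac c)) / ?D" using D by (simp add: divide_right_mono)
    also have "\<dots> = (\<Sum>c\<in>C. ?N (Ac c) / ?D)" by (rule sum_divide_distrib)
    also have "\<dots> \<le> ?R2"
    proof (rule sum_mono)
      fix c assume c: "c \<in> C"
      show "?N (Ac c) / ?D \<le> T c + ?N (Ac c) / (d0 * T c)"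
      proof (cases "1 \<le> T c")
        case True
        have "?N (Ac c) / ?D \<le> 1" using NS[of "Ac c"] c D by simp
        moreover have "0 \<le> ?N (Ac c) / (d0 * T c)"
          using N0 d0 C(3)[OF c] by simp
        ultimately show ?thesis using True by linarith
      next
        case F: False
        have "d0 * T c \<le> ?D"
          using False F d0 C(3)[OF c] mult_left_le[of "T c" d0] by linarith
        then have "?N (Ac c) / ?D \<le> ?N (Ac c) / (d0 * T c)"
          using N0 d0 D C(3)[OF c] by (intro divide_left_mono) auto
        then show ?thesis using C(3)[OF c] by simp
      qed
    qed
    finally show ?thesis using R1 by linarith
  qed
qed

text \<open>
  Jensen's inequality for the square, with an unnormalised weight because the posterior density is known only up to
  its normalising integral.
\<close>

lemma (in prob_space) weighted_mean_sq_le: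
  fixes w h :: "'a \<Rightarrow> real"
  assumes i: "integrable M w" "integrable M (\<lambda>t. h t * w t)" "integrable M (\<lambda>t. (h t)\<^sup>2 * w t)"
    and w: "\<And>t. t \<in> space M \<Longrightarrow> 0 \<le> w t" and D: "0 < (\<integral>t. w t \<partial>M)"
  shows "((\<integral>t. h t * w t \<partial>M) / (\<integral>t. w t \<partial>M))\<^sup>2 \<le> (\<integral>t. (h t)\<^sup>2 * w t \<partial>M) / (\<integral>t. w t \<partial>M)"
proof -
  let ?D = "\<integral>t. w t \<partial>M"
  define r where "r = (\<integral>t. h t * w t \<partial>M) / ?D"
  have "0 \<le> (\<integral>t. (h t - r)\<^sup>2 * w t \<partial>M)"
    using w by (intro Bochner_Integration.integral_nonneg) auto
  also have "\<dots> = (\<integral>t. (h t)\<^sup>2 * w t - (2 * r) * (h t * w t) + r\<^sup>2 * w t \<partial>M)"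
    by (intro Bochner_Integration.integral_cong) (auto simp: power2_diff algebra_simps)
  also have "\<dots> = (\<integral>t. (h t)\<^sup>2 * w t \<partial>M) - 2 * r * (\<integral>t. h t * w t \<partial>M) + r\<^sup>2 * ?D"
    using i by simp
  also have "(\<integral>t. h t * w t \<partial>M) = r * ?D" using D by (simp add: r_def)
  finally have "r\<^sup>2 * ?D \<le> (\<integral>t. (h t)\<^sup>2 * w t \<partial>M)" by (simp add: power2_eq_square algebra_simps)
  then show ?thesis using D unfolding r_def[symmetric] by (simp add: le_divide_eq)
qed

locale bayes_model = density_bounds N m M + prior: prob_space \<pi>
  for N :: "'a measure" and m M and \<pi> :: "'b measure" +
  fixes f :: "'b \<Rightarrow> 'a \<Rightarrow> real"
  assumes f_measurable: "(\<lambda>(t, x). f t x) \<in> borel_measurable (\<pi> \<Otimes>\<^sub>M N)"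
    and f_bdens: "t \<in> space \<pi> \<Longrightarrow> bdens (f t)"
begin

sublocale pair: pair_prob_space \<pi> N ..

text \<open>
  Dividing the likelihood by that of a reference density \<open>g\<close> does not change the posterior, and under samples
  from \<open>g\<close> all means of interest become powers of one-dimensional integrals.
\<close>

definition lratio :: "'i set \<Rightarrow> ('a \<Rightarrow> real) \<Rightarrow> ('i \<Rightarrow> 'a) \<Rightarrow> 'b \<Rightarrow> real" where
  "lratio I g X t = (\<Prod>i\<in>I. f t (X i) / g (X i))"

definition posterior_mean :: "'i set \<Rightarrow> ('i \<Rightarrow> 'a) \<Rightarrow> 'a \<Rightarrow> real" where
  "posterior_mean I X x =
     (\<integral>t. f t x * (\<Prod>i\<in>I. f t (X i)) \<partial>\<pi>) / (\<integral>t. (\<Prod>i\<in>I. f t (X i)) \<partial>\<pi>)"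

abbreviation sample_space :: "'i set \<Rightarrow> ('i \<Rightarrow> 'a) measure" where
  "sample_space I \<equiv> \<Pi>\<^sub>M i\<in>I. N"

lemma f_measurable_comp:
  assumes "a \<in> measurable L \<pi>" "b \<in> measurable L N"
  shows "(\<lambda>z. f (a z) (b z)) \<in> borel_measurable L"
  using measurable_compose[OF measurable_Pair[OF assms] f_measurable] by simp

lemma lratio_measurable:
  assumes "bdens g" "a \<in> measurable L (sample_space I)" "b \<in> measurable L \<pi>" "finite I"
  shows "(\<lambda>z. lratio I g (a z) (b z)) \<in> borel_measurable L"
  unfolding lratio_def
proof (rule borel_measurable_prod)
  fix i assume i: "i \<in> I"
  have c: "(\<lambda>z. a z i) \<in> measurable L N"
    using measurable_compose[OF assms(2) measurable_component_singleton[OF i]] .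
  show "(\<lambda>z. f (b z) (a z i) / g (a z i)) \<in> borel_measurable L"
    using f_measurable_comp[OF assms(3) c] measurable_compose[OF c bdensD(1)[OF assms(1)]]
    by (rule borel_measurable_divide)
qed

lemma lratio_bounds:
  assumes "bdens g" "X \<in> (\<Pi>\<^sub>E i\<in>I. space N)" "t \<in> space \<pi>"
  shows "(m / M) ^ card I \<le> lratio I g X t" "lratio I g X t \<le> (M / m) ^ card I" "0 < lratio I g X t"
proof -
  have b: "m / M \<le> f t (X i) / g (X i)" "f t (X i) / g (X i) \<le> M / m" if "i \<in> I" for i
  proof -
    have x: "X i \<in> space N" using assms(2) that by auto
    note d = bdensD(2,3)[OF f_bdens[OF assms(3)] x] bdensD(2,3)[OF assms(1) x]
    show "m / M \<le> f t (X i) / g (X i)" "f t (X i) / g (X i) \<le> M / m"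
      using d m_pos by (auto intro!: frac_le)
  qed
  have "(\<Prod>i\<in>I. m / M) \<le> lratio I g X t"
    unfolding lratio_def using b m_pos M_pos by (intro prod_mono) auto
  then show lo: "(m / M) ^ card I \<le> lratio I g X t" by simp
  show "0 < lratio I g X t"
    using lo m_pos M_pos by (auto intro: less_le_trans[rotated])
  have "lratio I g X t \<le> (\<Prod>i\<in>I. M / m)"
    unfolding lratio_def using m_pos M_pos
    by (intro prod_mono conjI order_trans[OF _ b(1)] b(2)) auto
  then show "lratio I g X t \<le> (M / m) ^ card I" by simp
qed

lemma sqdist_f_measurable:
  assumes "bdens q"
  shows "(\<lambda>t. sqdist N (f t) q) \<in> borel_measurable \<pi>"
  unfolding sqdist_def
proof (rule borel_measurable_lebesgue_integral)
  have [measurable]: "q \<in> borel_measurable N" using bdensD(1)[OF assms] .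
  note [measurable] = f_measurable
  show "(\<lambda>(t, x). (f t x - q x)\<^sup>2) \<in> borel_measurable (\<pi> \<Otimes>\<^sub>M N)"
    by measurable
qed

text \<open>
  Tonelli's theorem for a mean over samples of a Bochner integral over parameters; the bound \<open>K X\<close> makes the
  inner integral meaningful.
\<close>

lemma nn_integral_swap_le:
  assumes g: "bdens g" and [measurable]: "S \<in> sets \<pi>"
    and h: "(\<lambda>(X, t). h X t) \<in> borel_measurable (sample_space I \<Otimes>\<^sub>M \<pi>)"
    and h0: "\<And>X t. X \<in> (\<Pi>\<^sub>E i\<in>I. space N) \<Longrightarrow> t \<in> space \<pi> \<Longrightarrow> 0 \<le> h X t"
    and hb: "\<And>X t. X \<in> (\<Pi>\<^sub>E i\<in>I. space N) \<Longrightarrow> t \<in> space \<pi> \<Longrightarrow> h X t \<le> K X"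
    and c: "\<And>t. t \<in> S \<Longrightarrow> (\<integral>\<^sup>+X. ennreal (h X t) \<partial>iid I N g) \<le> ennreal c" "0 \<le> c"
  shows "(\<integral>\<^sup>+X. ennreal (\<integral>t. indicat_real S t * h X t \<partial>\<pi>) \<partial>iid I N g)
    \<le> ennreal (c * prior.prob S)"
proof -
  interpret P: prob_space "iid I N g" by (rule prob_space_iid[OF g])
  interpret PP: pair_prob_space \<pi> "iid I N g" ..
  have hm[measurable]: "(\<lambda>(X, t). h X t) \<in> borel_measurable (iid I N g \<Otimes>\<^sub>M \<pi>)"
    using h by (simp cong: measurable_cong_sets add: sets_pair_measure_cong[OF sets_iid refl])
  have hX[measurable]: "h X \<in> borel_measurable \<pi>" if "X \<in> space (iid I N g)" for X
    using measurable_compose_Pair1[OF that hm] by simp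
  have "(\<integral>\<^sup>+X. ennreal (\<integral>t. indicat_real S t * h X t \<partial>\<pi>) \<partial>iid I N g)
     = (\<integral>\<^sup>+X. (\<integral>\<^sup>+t. ennreal (indicat_real S t * h X t) \<partial>\<pi>) \<partial>iid I N g)"
  proof (rule nn_integral_cong)
    fix X assume X: "X \<in> space (iid I N g)"
    then have X': "X \<in> (\<Pi>\<^sub>E i\<in>I. space N)" by (simp add: space_iid)
    note [measurable] = hX[OF X]
    have b: "norm (indicat_real S t * h X t) \<le> K X" if "t \<in> space \<pi>" for t
      using h0[OF X' that] hb[OF X' that] by (auto split: split_indicator)
    have "integrable \<pi> (\<lambda>t. indicat_real S t * h X t)"
      using b by (intro prior.integrable_const_bound[where B = "K X"]) (auto intro!: AE_I2)
    then show "ennreal (\<integral>t. indicat_real S t * h X t \<partial>\<pi>)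
        = (\<integral>\<^sup>+t. ennreal (indicat_real S t * h X t) \<partial>\<pi>)"
      using h0[OF X'] by (intro nn_integral_eq_integral[symmetric]) (auto intro!: AE_I2)
  qed
  also have "\<dots> = (\<integral>\<^sup>+t. (\<integral>\<^sup>+X. ennreal (indicat_real S t * h X t) \<partial>iid I N g) \<partial>\<pi>)"
    by (rule PP.Fubini') measurable
  also have "\<dots> \<le> (\<integral>\<^sup>+t. ennreal c * indicator S t \<partial>\<pi>)"
    using c(1) by (intro nn_integral_mono) (auto split: split_indicator)
  also have "\<dots> = ennreal (c * prior.prob S)"
    using c(2) by (simp add: nn_integral_cmult_indicator prior.emeasure_eq_measure ennreal_mult')
  finally show ?thesis .
qed

text \<open>
  The posterior seen from the truth \<open>g\<close>. Here \<open>\<epsilon>\<close> is the squared radius of a ball of prior mass at least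
  \<open>b\<close>, \<open>\<delta>\<close> the squared radius of the covering balls with centres in \<open>C\<close>, and \<open>d0\<close> a free
  threshold for the normalising integral. A covering ball that meets \<open>{t. \<tau> < sqdist N (f t) g}\<close> has its
  centre at squared distance at least \<open>\<tau> / 2 - \<delta>\<close> from \<open>g\<close>; these centres form the set \<open>G\<close> of the
  proof, and \<open>posterior_tail_le\<close> is applied with one test statistic for each of them.
\<close>

theorem expected_posterior_tail_le:
  fixes C :: "('a \<Rightarrow> real) set" and I :: "'i set"
  assumes g: "bdens g" and I: "finite I"
    and mass: "b \<le> prior.prob {t \<in> space \<pi>. sqdist N (f t) g \<le> \<epsilon>}" "0 < b"
    and C: "finite C" "\<And>q. q \<in> C \<Longrightarrow> bdens q"
      "\<And>t. t \<in> space \<pi> \<Longrightarrow> \<exists>q\<in>C. sqdist N (f t) q \<le> \<delta>"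
    and d0: "0 < d0"
  shows "(\<integral>\<^sup>+X. ennreal ((\<integral>t. indicat_real {t \<in> space \<pi>. \<tau> < sqdist N (f t) g} t
            * lratio I g X t \<partial>\<pi>) / (\<integral>t. lratio I g X t \<partial>\<pi>)) \<partial>iid I N g)
    \<le> ennreal (d0 / b * exp (real (card I) * \<epsilon> / m)
         + real (card C) * (exp (- (real (card I) * (\<tau> / 2 - \<delta>) / (8 * M)))
         + exp (- (real (card I) * ((\<tau> / 2 - \<delta>) / (16 * M) - M / m\<^sup>2 * \<delta>))) / d0))"
proof -
  define A where "A = {t \<in> space \<pi>. \<tau> < sqdist N (f t) g}"
  define B where "B = {t \<in> space \<pi>. sqdist N (f t) g \<le> \<epsilon>}"
  define G where "G = {q \<in> C. \<tau> / 2 - \<delta> \<le> sqdist N g q}"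
  define S where "S q = {t \<in> space \<pi>. sqdist N (f t) q \<le> \<delta>}" for q
  define T where "T q X = (\<Prod>i\<in>I. sqrt (q (X i) / g (X i)))" for q and X :: "'i \<Rightarrow> 'a"
  let ?P = "iid I N g" and ?n = "real (card I)"
  let ?e1 = "exp (- (?n * (\<tau> / 2 - \<delta>) / (8 * M)))"
  let ?e2 = "exp (- (?n * ((\<tau> / 2 - \<delta>) / (16 * M) - M / m\<^sup>2 * \<delta>)))"
  let ?e0 = "exp (?n * \<epsilon> / m)"
  interpret P: prob_space ?P by (rule prob_space_iid[OF g])
  have lb: "(m / M) ^ card I \<le> lratio I g X t" "lratio I g X t \<le> (M / m) ^ card I" "0 < lratio I g X t"
    if "X \<in> (\<Pi>\<^sub>E i\<in>I. space N)" "t \<in> space \<pi>" for X t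
    using lratio_bounds[OF g that] by auto
  have [measurable]: "A \<in> sets \<pi>" "B \<in> sets \<pi>"
    using sqdist_f_measurable[OF g] unfolding A_def B_def by measurable
  have Sm[measurable]: "S q \<in> sets \<pi>" if "q \<in> G" for q
  proof -
    have [measurable]: "(\<lambda>t. sqdist N (f t) q) \<in> borel_measurable \<pi>"
      using that by (intro sqdist_f_measurable C) (simp add: G_def)
    show ?thesis unfolding S_def by measurable
  qed
  have G: "finite G" "G \<subseteq> C" using C(1) by (auto simp: G_def)
  have Gd: "bdens q" if "q \<in> G" for q using that G C by auto
  have cov: "A \<subseteq> (\<Union>q\<in>G. S q)"
  proof
    fix t assume "t \<in> A"
    then have t: "t \<in> space \<pi>" "\<tau> < sqdist N (f t) g" by (auto simp: A_def)
    obtain q where q: "q \<in> C" "sqdist N (f t) q \<le> \<delta>" using C(3)[OF t(1)] by auto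
    have "sqdist N (f t) g \<le> 2 * sqdist N (f t) q + 2 * sqdist N q g"
      using f_bdens[OF t(1)] C(2)[OF q(1)] g by (rule sqdist_triangle)
    then have "q \<in> G" using t q by (simp add: G_def sqdist_commute)
    then show "t \<in> (\<Union>q\<in>G. S q)" using q t by (auto simp: S_def)
  qed
  have Tpos: "0 < T q X" if "q \<in> G" "X \<in> (\<Pi>\<^sub>E i\<in>I. space N)" for q X
    unfolding T_def using PiE_mem[OF that(2)] bdensD(4)[OF g] bdensD(4)[OF Gd[OF that(1)]]
    by (intro prod_pos) auto
  have Tm: "(\<lambda>X. T q X) \<in> borel_measurable (sample_space I)" if "q \<in> G" for q
  proof -
    have [measurable]: "q \<in> borel_measurable N" "g \<in> borel_measurable N"
      using bdensD(1)[OF g] bdensD(1)[OF Gd[OF that]] by auto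
    show ?thesis unfolding T_def using I by measurable
  qed
  have lm: "(\<lambda>(X, t). lratio I g X t) \<in> borel_measurable (sample_space I \<Otimes>\<^sub>M \<pi>)"
    using lratio_measurable[OF g measurable_fst measurable_snd I] by (simp add: split_beta')
  have pB: "b \<le> prior.prob B" "0 < prior.prob B" using mass by (auto simp: B_def)
  let ?R1 = "\<lambda>X. d0 / (prior.prob B)\<^sup>2 * (\<integral>t. indicat_real B t * (1 / lratio I g X t) \<partial>\<pi>)"
  let ?J = "\<lambda>q X. \<integral>t. indicat_real (S q) t * (lratio I g X t / T q X) \<partial>\<pi>"
  let ?post = "\<lambda>X. (\<integral>t. indicat_real A t * lratio I g X t \<partial>\<pi>) / (\<integral>t. lratio I g X t \<partial>\<pi>)"
  have point: "?post X \<le> ?R1 X + (\<Sum>q\<in>G. T q X + ?J q X / d0)" if X: "X \<in> space ?P" for X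
  proof -
    have X': "X \<in> (\<Pi>\<^sub>E i\<in>I. space N)" using X by (simp add: space_iid)
    have "?post X \<le> ?R1 X + (\<Sum>q\<in>G. T q X + (\<integral>t. indicat_real (S q) t * lratio I g X t \<partial>\<pi>) / (d0 * T q X))"
    proof (rule prior.posterior_tail_le[where lo = "(m / M) ^ card I" and hi = "(M / m) ^ card I"])
      show "lratio I g X \<in> borel_measurable \<pi>"
        using X' by (intro lratio_measurable[OF g _ _ I]) (auto simp: space_PiM)
    qed (use lb[OF X'] m_pos M_pos pB d0 G cov Tpos X' in auto)
    also have "(\<Sum>q\<in>G. T q X + (\<integral>t. indicat_real (S q) t * lratio I g X t \<partial>\<pi>) / (d0 * T q X))
        = (\<Sum>q\<in>G. T q X + ?J q X / d0)"
      by (intro sum.cong refl) (simp add: mult.commute[of d0])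
    finally show ?thesis .
  qed
  have b1: "(\<integral>\<^sup>+X. ennreal (\<integral>t. indicat_real B t * (1 / lratio I g X t) \<partial>\<pi>) \<partial>?P)
      \<le> ennreal (?e0 * prior.prob B)"
  proof (rule nn_integral_swap_le[OF g, where K = "\<lambda>X. 1 / (m / M) ^ card I"])
    show "(\<lambda>(X, t). 1 / lratio I g X t) \<in> borel_measurable (sample_space I \<Otimes>\<^sub>M \<pi>)"
      using borel_measurable_divide[OF borel_measurable_const[of 1] lm] by (simp add: split_beta')
    fix t assume t: "t \<in> B"
    then have t': "t \<in> space \<pi>" by (simp add: B_def)
    have "(\<integral>\<^sup>+X. ennreal (1 / lratio I g X t) \<partial>?P) = (\<integral>\<^sup>+X. ennreal (\<Prod>i\<in>I. g (X i) / f t (X i)) \<partial>?P)"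
      by (simp add: lratio_def prod_dividef)
    also have "\<dots> \<le> ennreal (exp (?n * sqdist N g (f t) / m))"
      by (rule chi_iid[OF g f_bdens[OF t'] I])
    also have "\<dots> \<le> ennreal ?e0"
      using t m_pos by (intro ennreal_leI)
        (auto simp: B_def sqdist_commute[of g] intro!: divide_right_mono mult_left_mono)
    finally show "(\<integral>\<^sup>+X. ennreal (1 / lratio I g X t) \<partial>?P) \<le> ennreal ?e0" .
  qed (use lb m_pos M_pos in \<open>auto intro!: divide_left_mono simp: less_imp_le\<close>)
  have b2: "(\<integral>\<^sup>+X. ennreal (T q X) \<partial>?P) \<le> ennreal ?e1" if q: "q \<in> G" for q
  proof -
    have "(\<integral>\<^sup>+X. ennreal (T q X) \<partial>?P) \<le> ennreal (exp (- (?n * sqdist N g q / (8 * M))))"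
      unfolding T_def by (rule affinity_iid[OF g Gd[OF q] I])
    also have "\<dots> \<le> ennreal ?e1"
      using q M_pos by (intro ennreal_leI) (auto simp: G_def intro!: divide_right_mono mult_left_mono)
    finally show ?thesis .
  qed
  have b3: "(\<integral>\<^sup>+X. ennreal (?J q X) \<partial>?P) \<le> ennreal (?e2 * prior.prob (S q))" if q: "q \<in> G" for q
  proof (rule nn_integral_swap_le[OF g, where K = "\<lambda>X. (M / m) ^ card I / T q X"])
    have "(\<lambda>z. T q (fst z)) \<in> borel_measurable (sample_space I \<Otimes>\<^sub>M \<pi>)"
      using measurable_compose[OF measurable_fst Tm[OF q]] .
    from borel_measurable_divide[OF lm this]
    show "(\<lambda>(X, t). lratio I g X t / T q X) \<in> borel_measurable (sample_space I \<Otimes>\<^sub>M \<pi>)"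
      by (simp add: split_beta')
    fix t assume t: "t \<in> S q"
    then have t': "t \<in> space \<pi>" by (simp add: S_def)
    have "(\<integral>\<^sup>+X. ennreal (lratio I g X t / T q X) \<partial>?P)
        = (\<integral>\<^sup>+X. ennreal (\<Prod>i\<in>I. f t (X i) / g (X i) / sqrt (q (X i) / g (X i))) \<partial>?P)"
      by (simp add: lratio_def T_def prod_dividef prod.distrib)
    also have "\<dots> \<le> ennreal (exp (- (?n * (sqdist N g q / (16 * M) - M / m\<^sup>2 * sqdist N (f t) q))))"
      by (rule tilt_iid[OF g Gd[OF q] f_bdens[OF t'] I])
    also have "\<dots> \<le> ennreal ?e2"
    proof -
      have "(\<tau> / 2 - \<delta>) / (16 * M) \<le> sqdist N g q / (16 * M)"
        using q M_pos by (intro divide_right_mono) (auto simp: G_def)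
      moreover have "M / m\<^sup>2 * sqdist N (f t) q \<le> M / m\<^sup>2 * \<delta>"
        using t M_pos by (intro mult_left_mono) (auto simp: S_def)
      ultimately have "?n * ((\<tau> / 2 - \<delta>) / (16 * M) - M / m\<^sup>2 * \<delta>)
          \<le> ?n * (sqdist N g q / (16 * M) - M / m\<^sup>2 * sqdist N (f t) q)"
        by (intro mult_left_mono) auto
      then show ?thesis by (intro ennreal_leI) simp
    qed
    finally show "(\<integral>\<^sup>+X. ennreal (lratio I g X t / T q X) \<partial>?P) \<le> ennreal ?e2" .
  qed (use lb Tpos[OF q] Sm[OF q] in \<open>auto intro!: divide_right_mono simp: less_imp_le\<close>)
  have m1: "(\<lambda>X. ennreal (\<integral>t. indicat_real B t * (1 / lratio I g X t) \<partial>\<pi>)) \<in> borel_measurable ?P"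
  proof -
    have "(\<lambda>(X, t). indicat_real B t * (1 / lratio I g X t)) \<in> borel_measurable (sample_space I \<Otimes>\<^sub>M \<pi>)"
    proof -
      note [measurable] = lm
      show ?thesis by measurable
    qed
    from prior.borel_measurable_lebesgue_integral[OF this]
    have "(\<lambda>X. \<integral>t. indicat_real B t * (1 / lratio I g X t) \<partial>\<pi>) \<in> borel_measurable ?P"
      by (simp cong: measurable_cong_sets add: sets_iid)
    then show ?thesis by measurable
  qed
  have m2: "(\<lambda>X. ennreal (T q X)) \<in> borel_measurable ?P" if "q \<in> G" for q
    using Tm[OF that] by (simp cong: measurable_cong_sets add: sets_iid)
  have m3: "(\<lambda>X. ennreal (?J q X)) \<in> borel_measurable ?P" if "q \<in> G" for q
  proof -
    have "(\<lambda>(X, t). indicat_real (S q) t * (lratio I g X t / T q X))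
        \<in> borel_measurable (sample_space I \<Otimes>\<^sub>M \<pi>)"
    proof -
      note [measurable] = lm Tm[OF that] Sm[OF that]
      show ?thesis by measurable
    qed
    from prior.borel_measurable_lebesgue_integral[OF this]
    have "(\<lambda>X. ?J q X) \<in> borel_measurable ?P"
      by (simp cong: measurable_cong_sets add: sets_iid)
    then show ?thesis by measurable
  qed
  have nn1: "0 \<le> (\<integral>t. indicat_real B t * (1 / lratio I g X t) \<partial>\<pi>)" if "X \<in> space ?P" for X
    using lb(3) that
    by (intro Bochner_Integration.integral_nonneg) (auto simp: space_iid less_imp_le)
  have nn3: "0 \<le> ?J q X" if "X \<in> space ?P" "q \<in> G" for q X
    using lb(3) Tpos[OF that(2)] that
    by (intro Bochner_Integration.integral_nonneg) (auto simp: space_iid less_imp_le)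
  have "(\<integral>\<^sup>+X. ennreal (?post X) \<partial>?P)
      \<le> (\<integral>\<^sup>+X. ennreal (d0 / (prior.prob B)\<^sup>2) * ennreal (\<integral>t. indicat_real B t * (1 / lratio I g X t) \<partial>\<pi>)
          + (\<Sum>q\<in>G. ennreal (T q X) + ennreal (1 / d0) * ennreal (?J q X)) \<partial>?P)"
  proof (rule nn_integral_mono)
    fix X assume X: "X \<in> space ?P"
    have T0: "q \<in> G \<Longrightarrow> 0 \<le> T q X" for q using Tpos X by (simp add: space_iid less_imp_le)
    have "ennreal (?post X) \<le> ennreal (?R1 X + (\<Sum>q\<in>G. T q X + ?J q X / d0))"
      by (intro ennreal_leI point X)
    also have "\<dots> = ennreal (?R1 X) + ennreal (\<Sum>q\<in>G. T q X + ?J q X / d0)"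
      using nn1[OF X] nn3[OF X] T0 d0 pB
      by (intro ennreal_plus mult_nonneg_nonneg sum_nonneg add_nonneg_nonneg divide_nonneg_pos) auto
    also have "ennreal (\<Sum>q\<in>G. T q X + ?J q X / d0) = (\<Sum>q\<in>G. ennreal (T q X + ?J q X / d0))"
      using nn3[OF X] T0 d0
      by (intro sum_ennreal[symmetric] add_nonneg_nonneg divide_nonneg_pos) auto
    also have "\<dots> = (\<Sum>q\<in>G. ennreal (T q X) + ennreal (1 / d0) * ennreal (?J q X))"
    proof (intro sum.cong refl)
      fix q assume q: "q \<in> G"
      have "ennreal (T q X + ?J q X / d0) = ennreal (T q X) + ennreal (?J q X / d0)"
        by (rule ennreal_plus[OF T0[OF q] divide_nonneg_pos[OF nn3[OF X q] d0]])
      also have "ennreal (?J q X / d0) = ennreal (1 / d0 * ?J q X)" by (simp add: mult.commute)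
      also have "ennreal (1 / d0 * ?J q X) = ennreal (1 / d0) * ennreal (?J q X)"
        using nn3[OF X q] d0 by (intro ennreal_mult) auto
      finally show "ennreal (T q X + ?J q X / d0) = ennreal (T q X) + ennreal (1 / d0) * ennreal (?J q X)" .
    qed
    also have "ennreal (?R1 X) = ennreal (d0 / (prior.prob B)\<^sup>2)
        * ennreal (\<integral>t. indicat_real B t * (1 / lratio I g X t) \<partial>\<pi>)"
      using nn1[OF X] d0 by (intro ennreal_mult) auto
    finally show "ennreal (?post X) \<le> ennreal (d0 / (prior.prob B)\<^sup>2)
          * ennreal (\<integral>t. indicat_real B t * (1 / lratio I g X t) \<partial>\<pi>)
          + (\<Sum>q\<in>G. ennreal (T q X) + ennreal (1 / d0) * ennreal (?J q X))" .
  qed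
  also have "\<dots> = ennreal (d0 / (prior.prob B)\<^sup>2)
        * (\<integral>\<^sup>+X. ennreal (\<integral>t. indicat_real B t * (1 / lratio I g X t) \<partial>\<pi>) \<partial>?P)
      + (\<Sum>q\<in>G. (\<integral>\<^sup>+X. ennreal (T q X) \<partial>?P) + ennreal (1 / d0) * (\<integral>\<^sup>+X. ennreal (?J q X) \<partial>?P))"
    using m1 m2 m3 by (simp add: nn_integral_add nn_integral_sum nn_integral_cmult)
  also have "\<dots> \<le> ennreal (d0 / (prior.prob B)\<^sup>2) * ennreal (?e0 * prior.prob B)
      + (\<Sum>q\<in>G. ennreal ?e1 + ennreal (1 / d0) * ennreal (?e2 * prior.prob (S q)))"
    by (intro add_mono mult_left_mono sum_mono b1 b2 b3) auto
  also have "\<dots> \<le> ennreal (d0 / b * ?e0) + (\<Sum>q\<in>G. ennreal (?e1 + ?e2 / d0))"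
  proof (intro add_mono sum_mono)
    have "d0 / (prior.prob B)\<^sup>2 * (?e0 * prior.prob B) = d0 / prior.prob B * ?e0"
      using pB by (simp add: power2_eq_square)
    also have "\<dots> \<le> d0 / b * ?e0"
      using pB mass(2) d0 by (intro mult_right_mono divide_left_mono) auto
    finally show "ennreal (d0 / (prior.prob B)\<^sup>2) * ennreal (?e0 * prior.prob B) \<le> ennreal (d0 / b * ?e0)"
      using d0 by (subst ennreal_mult[symmetric]) (auto intro: ennreal_leI)
    fix q assume "q \<in> G"
    have "?e2 * prior.prob (S q) \<le> ?e2" by (intro mult_left_le prior.prob_le_1) auto
    then have "1 / d0 * (?e2 * prior.prob (S q)) \<le> ?e2 / d0" using d0 by (simp add: divide_right_mono)
    then show "ennreal ?e1 + ennreal (1 / d0) * ennreal (?e2 * prior.prob (S q)) \<le> ennreal (?e1 + ?e2 / d0)"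
      using d0 by (subst ennreal_mult[symmetric]) (auto simp: ennreal_plus[symmetric] intro!: ennreal_leI simp del: ennreal_plus)
  qed
  also have "\<dots> = ennreal (d0 / b * ?e0 + real (card G) * (?e1 + ?e2 / d0))"
    using d0 mass(2) by (subst sum_ennreal) (auto simp: ennreal_plus[symmetric] simp del: ennreal_plus)
  also have "\<dots> \<le> ennreal (d0 / b * ?e0 + real (card C) * (?e1 + ?e2 / d0))"
    using d0 card_mono[OF C(1) G(2)] by (intro ennreal_leI add_left_mono mult_right_mono) auto
  finally show ?thesis unfolding A_def .
qed

lemma posterior_mean_lratio:
  assumes "bdens g" "X \<in> (\<Pi>\<^sub>E i\<in>I. space N)" "finite I"
  shows "posterior_mean I X x = (\<integral>t. f t x * lratio I g X t \<partial>\<pi>) / (\<integral>t. lratio I g X t \<partial>\<pi>)"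
proof -
  let ?G = "\<Prod>i\<in>I. g (X i)"
  have G: "0 < ?G" using bdensD(4)[OF assms(1)] PiE_mem[OF assms(2)] by (intro prod_pos) auto
  have "(\<Prod>i\<in>I. f t (X i)) = ?G * lratio I g X t" for t
    using G by (simp add: lratio_def prod_dividef)
  then have "posterior_mean I X x = (\<integral>t. ?G * (f t x * lratio I g X t) \<partial>\<pi>) / (\<integral>t. ?G * lratio I g X t \<partial>\<pi>)"
    by (simp add: posterior_mean_def algebra_simps)
  then show ?thesis using G by simp
qed

lemma f_measurable_fst: "x \<in> space N \<Longrightarrow> (\<lambda>t. f t x) \<in> borel_measurable \<pi>"
  by (rule f_measurable_comp) auto

lemma lratio_integrable:
  assumes g: "bdens g" and X: "X \<in> (\<Pi>\<^sub>E i\<in>I. space N)" and I: "finite I"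
    and h: "h \<in> borel_measurable \<pi>" "\<And>t. t \<in> space \<pi> \<Longrightarrow> \<bar>h t\<bar> \<le> K"
  shows "integrable \<pi> (\<lambda>t. h t * lratio I g X t)"
proof (rule prior.integrable_const_bound[where B = "K * (M / m) ^ card I"])
  have [measurable]: "lratio I g X \<in> borel_measurable \<pi>"
    using X by (intro lratio_measurable[OF g _ _ I]) (auto simp: space_PiM)
  show "(\<lambda>t. h t * lratio I g X t) \<in> borel_measurable \<pi>" using h(1) by measurable
  have "\<bar>h t\<bar> * \<bar>lratio I g X t\<bar> \<le> K * (M / m) ^ card I" if "t \<in> space \<pi>" for t
    using h(2)[OF that] lratio_bounds[OF g X that]
    by (intro mult_mono) (auto intro: order_trans[OF abs_ge_zero])
  then show "AE t in \<pi>. norm (h t * lratio I g X t) \<le> K * (M / m) ^ card I"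
    by (auto intro!: AE_I2 simp: abs_mult)
qed

lemma lratio_integral_pos:
  assumes g: "bdens g" and X: "X \<in> (\<Pi>\<^sub>E i\<in>I. space N)" and I: "finite I"
  shows "0 < (\<integral>t. lratio I g X t \<partial>\<pi>)"
proof -
  have "(\<integral>t. (m / M) ^ card I \<partial>\<pi>) \<le> (\<integral>t. lratio I g X t \<partial>\<pi>)"
    using lratio_integrable[OF g X I, of "\<lambda>_. 1" 1] lratio_bounds(1)[OF g X]
    by (intro integral_mono) auto
  then show ?thesis using m_pos M_pos
    by (auto simp: prior.prob_space intro: less_le_trans[rotated])
qed

lemma posterior_mean_bounds:
  assumes g: "bdens g" and X: "X \<in> (\<Pi>\<^sub>E i\<in>I. space N)" and I: "finite I" and x: "x \<in> space N"
  shows "m \<le> posterior_mean I X x" "posterior_mean I X x \<le> M"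
proof -
  let ?D = "\<integral>t. lratio I g X t \<partial>\<pi>"
  have i: "integrable \<pi> (lratio I g X)" using lratio_integrable[OF g X I, of "\<lambda>_. 1" 1] by simp
  have b: "m \<le> f t x" "f t x \<le> M" if "t \<in> space \<pi>" for t
    using bdensD(2,3)[OF f_bdens[OF that] x] by auto
  have i2: "integrable \<pi> (\<lambda>t. f t x * lratio I g X t)"
    using b m_pos by (intro lratio_integrable[OF g X I f_measurable_fst[OF x], where K = M]) force
  have "(\<integral>t. m * lratio I g X t \<partial>\<pi>) \<le> (\<integral>t. f t x * lratio I g X t \<partial>\<pi>)"
    using i i2 b lratio_bounds(3)[OF g X] by (intro integral_mono mult_right_mono) (auto simp: less_imp_le)
  moreover have "(\<integral>t. f t x * lratio I g X t \<partial>\<pi>) \<le> (\<integral>t. M * lratio I g X t \<partial>\<pi>)"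
    using i i2 b lratio_bounds(3)[OF g X] by (intro integral_mono mult_right_mono) (auto simp: less_imp_le)
  ultimately show "m \<le> posterior_mean I X x" "posterior_mean I X x \<le> M"
    using lratio_integral_pos[OF g X I] unfolding posterior_mean_lratio[OF g X I]
    by (simp_all add: le_divide_eq divide_le_eq)
qed

lemma posterior_mean_measurable:
  assumes I: "finite I"
  shows "(\<lambda>(X, x). posterior_mean I X x) \<in> borel_measurable (sample_space I \<Otimes>\<^sub>M N)"
proof -
  have c: "(\<lambda>z. f (snd z) (fst (fst z) i)) \<in> borel_measurable ((sample_space I \<Otimes>\<^sub>M N) \<Otimes>\<^sub>M \<pi>)"
    if i: "i \<in> I" for i
  proof (rule f_measurable_comp)
    note [measurable] = measurable_component_singleton[OF i, of "\<lambda>_. N"]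
    show "(\<lambda>z. fst (fst z) i) \<in> measurable ((sample_space I \<Otimes>\<^sub>M N) \<Otimes>\<^sub>M \<pi>) N" by measurable
  qed simp
  have d: "(\<lambda>z. f (snd z) (snd (fst z))) \<in> borel_measurable ((sample_space I \<Otimes>\<^sub>M N) \<Otimes>\<^sub>M \<pi>)"
    by (rule f_measurable_comp) measurable
  have p: "(\<lambda>z. \<Prod>i\<in>I. f (snd z) (fst (fst z) i)) \<in> borel_measurable ((sample_space I \<Otimes>\<^sub>M N) \<Otimes>\<^sub>M \<pi>)"
    using c by (rule borel_measurable_prod)
  have "(\<lambda>(z, t). f t (snd z) * (\<Prod>i\<in>I. f t (fst z i))) \<in> borel_measurable ((sample_space I \<Otimes>\<^sub>M N) \<Otimes>\<^sub>M \<pi>)"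
    "(\<lambda>(z, t). (\<Prod>i\<in>I. f t (fst z i))) \<in> borel_measurable ((sample_space I \<Otimes>\<^sub>M N) \<Otimes>\<^sub>M \<pi>)"
    using borel_measurable_times[OF d p] p by (simp_all add: split_beta')
  from this[THEN prior.borel_measurable_lebesgue_integral]
  show ?thesis unfolding posterior_mean_def split_beta' by (rule borel_measurable_divide)
qed

text \<open>
  The squared distance is convex, so the loss of the posterior mean is at most the posterior mean of the loss. The
  latter is at most \<open>\<tau>\<close> on the ball of squared radius \<open>\<tau>\<close> and at most \<open>M\<^sup>2\<close> outside; the factor
  \<open>1 / (4 * m)\<close> passes from \<open>L\<^sup>2\<close> to Hellinger distance.
\<close>

lemma posterior_mean_loss_le:
  assumes g: "bdens g" and X: "X \<in> (\<Pi>\<^sub>E i\<in>I. space N)" and I: "finite I" and \<tau>: "0 \<le> \<tau>"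
  shows "(\<integral>x. (sqrt (g x) - sqrt (posterior_mean I X x))\<^sup>2 \<partial>N)
    \<le> (\<tau> + M\<^sup>2 * ((\<integral>t. indicat_real {t \<in> space \<pi>. \<tau> < sqdist N (f t) g} t * lratio I g X t \<partial>\<pi>)
          / (\<integral>t. lratio I g X t \<partial>\<pi>))) / (4 * m)"
proof -
  let ?A = "{t \<in> space \<pi>. \<tau> < sqdist N (f t) g}"
  let ?w = "lratio I g X" and ?r = "posterior_mean I X"
  let ?D = "\<integral>t. ?w t \<partial>\<pi>"
  have D: "0 < ?D" by (rule lratio_integral_pos[OF g X I])
  have [measurable]: "g \<in> borel_measurable N" by (rule bdensD(1)[OF g])
  note [measurable] = f_measurable
  have [measurable]: "?w \<in> borel_measurable \<pi>"
    using X by (intro lratio_measurable[OF g _ _ I]) (auto simp: space_PiM)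
  have Xs: "X \<in> space (sample_space I)" using X by (simp add: space_PiM)
  have rm[measurable]: "?r \<in> borel_measurable N"
    using measurable_compose_Pair1[OF Xs posterior_mean_measurable[OF I]] by simp
  have diff: "\<bar>f t x - g x\<bar> \<le> M" if "t \<in> space \<pi>" "x \<in> space N" for t x
    using bdensD(2,3)[OF f_bdens[OF that(1)] that(2)] bdensD(2,3)[OF g that(2)] m_pos by force
  then have diff2: "(f t x - g x)\<^sup>2 \<le> M\<^sup>2" if "t \<in> space \<pi>" "x \<in> space N" for t x
    using that power_mono[OF diff[OF that] abs_ge_zero, of 2] by simp
  have iw: "integrable \<pi> ?w" using lratio_integrable[OF g X I, of "\<lambda>_. 1" 1] by simp
  have ih: "integrable \<pi> (\<lambda>t. (f t x - g x) * ?w t)" if x: "x \<in> space N" for x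
    using diff x f_measurable_fst[OF x] by (intro lratio_integrable[OF g X I, where K = M]) auto
  have ih2: "integrable \<pi> (\<lambda>t. (f t x - g x)\<^sup>2 * ?w t)" if x: "x \<in> space N" for x
    using diff2 x f_measurable_fst[OF x] by (intro lratio_integrable[OF g X I, where K = "M\<^sup>2"]) auto
  have ip: "integrable (\<pi> \<Otimes>\<^sub>M N) (\<lambda>(t, x). (f t x - g x)\<^sup>2 * ?w t)"
  proof (rule pair.P.integrable_const_bound[where B = "M\<^sup>2 * (M / m) ^ card I"])
    show "(\<lambda>(t, x). (f t x - g x)\<^sup>2 * ?w t) \<in> borel_measurable (\<pi> \<Otimes>\<^sub>M N)" by measurable
    have "(f t x - g x)\<^sup>2 * ?w t \<le> M\<^sup>2 * (M / m) ^ card I" "0 \<le> ?w t"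
      if "t \<in> space \<pi>" "x \<in> space N" for t x
      using diff2[OF that] lratio_bounds(2,3)[OF g X that(1)] by (auto intro!: mult_mono simp: less_imp_le)
    then show "AE z in \<pi> \<Otimes>\<^sub>M N. norm (case z of (t, x) \<Rightarrow> (f t x - g x)\<^sup>2 * ?w t) \<le> M\<^sup>2 * (M / m) ^ card I"
      by (intro AE_I2) (auto simp: space_pair_measure)
  qed
  have point: "(sqrt (g x) - sqrt (?r x))\<^sup>2 \<le> (\<integral>t. (f t x - g x)\<^sup>2 * ?w t \<partial>\<pi>) / ?D / (4 * m)"
    if x: "x \<in> space N" for x
  proof -
    have ifw: "integrable \<pi> (\<lambda>t. f t x * ?w t)"
      using bdensD(2,3)[OF f_bdens x] m_pos
      by (intro lratio_integrable[OF g X I f_measurable_fst[OF x], where K = M]) force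
    have "(\<integral>t. (f t x - g x) * ?w t \<partial>\<pi>) = (\<integral>t. f t x * ?w t \<partial>\<pi>) - g x * ?D"
      using ifw iw by (simp add: left_diff_distrib)
    then have "?r x - g x = (\<integral>t. (f t x - g x) * ?w t \<partial>\<pi>) / ?D"
      using D by (simp add: posterior_mean_lratio[OF g X I] field_simps)
    then have "(?r x - g x)\<^sup>2 \<le> (\<integral>t. (f t x - g x)\<^sup>2 * ?w t \<partial>\<pi>) / ?D"
      using prior.weighted_mean_sq_le[OF iw ih[OF x] ih2[OF x] _ D] lratio_bounds(3)[OF g X]
      by (simp add: less_imp_le)
    moreover have "(sqrt (g x) - sqrt (?r x))\<^sup>2 \<le> (g x - ?r x)\<^sup>2 / (4 * m)"
      using bdensD(2)[OF g x] posterior_mean_bounds(1)[OF g X I x] by (intro sqrt_diff_sq_le)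
    ultimately show ?thesis using m_pos unfolding power2_commute[of "g x" "?r x"]
      by (elim order_trans) (intro divide_right_mono, auto)
  qed
  have imarg: "integrable N (\<lambda>x. \<integral>t. (f t x - g x)\<^sup>2 * ?w t \<partial>\<pi>)"
    using pair.integrable_snd[OF ip] .
  have "(\<integral>x. (sqrt (g x) - sqrt (?r x))\<^sup>2 \<partial>N) \<le> (\<integral>x. (\<integral>t. (f t x - g x)\<^sup>2 * ?w t \<partial>\<pi>) / ?D / (4 * m) \<partial>N)"
  proof (rule integral_mono_AE')
    show "integrable N (\<lambda>x. (\<integral>t. (f t x - g x)\<^sup>2 * ?w t \<partial>\<pi>) / ?D / (4 * m))"
      using imarg by simp
  qed (use point order_trans[OF zero_le_power2 point] in \<open>auto intro!: AE_I2\<close>)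
  also have "\<dots> = (\<integral>x. (\<integral>t. (f t x - g x)\<^sup>2 * ?w t \<partial>\<pi>) \<partial>N) / ?D / (4 * m)" by simp
  also have "(\<integral>x. (\<integral>t. (f t x - g x)\<^sup>2 * ?w t \<partial>\<pi>) \<partial>N) = (\<integral>t. (\<integral>x. (f t x - g x)\<^sup>2 * ?w t \<partial>N) \<partial>\<pi>)"
    using ip by (rule pair.Fubini_integral)
  also have "\<dots> = (\<integral>t. sqdist N (f t) g * ?w t \<partial>\<pi>)" by (simp add: sqdist_def)
  also have "\<dots> \<le> (\<integral>t. \<tau> * ?w t + M\<^sup>2 * (indicat_real ?A t * ?w t) \<partial>\<pi>)"
  proof (rule integral_mono)
    note [measurable] = sqdist_f_measurable[OF g]
    have Am: "?A \<in> sets \<pi>" by measurable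
    show "integrable \<pi> (\<lambda>t. sqdist N (f t) g * ?w t)"
      using sqdist_nonneg sqdist_le[OF f_bdens g]
      by (intro lratio_integrable[OF g X I, where K = "M\<^sup>2"]) auto
    have "integrable \<pi> (\<lambda>t. indicat_real ?A t * ?w t)"
      using Am by (intro lratio_integrable[OF g X I, where K = 1]) (auto split: split_indicator)
    then show "integrable \<pi> (\<lambda>t. \<tau> * ?w t + M\<^sup>2 * (indicat_real ?A t * ?w t))" using iw by simp
    fix t assume t: "t \<in> space \<pi>"
    have "sqdist N (f t) g \<le> \<tau> + M\<^sup>2 * indicat_real ?A t"
      using t sqdist_le[OF f_bdens[OF t] g] \<tau> by (auto split: split_indicator)
    then have "sqdist N (f t) g * ?w t \<le> (\<tau> + M\<^sup>2 * indicat_real ?A t) * ?w t"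
      using lratio_bounds(3)[OF g X t] by (intro mult_right_mono) auto
    then show "sqdist N (f t) g * ?w t \<le> \<tau> * ?w t + M\<^sup>2 * (indicat_real ?A t * ?w t)"
      by (simp add: algebra_simps)
  qed
  also have "\<dots> = \<tau> * ?D + M\<^sup>2 * (\<integral>t. indicat_real ?A t * ?w t \<partial>\<pi>)"
  proof -
    note [measurable] = sqdist_f_measurable[OF g]
    have Am: "?A \<in> sets \<pi>" by measurable
    have "integrable \<pi> (\<lambda>t. indicat_real ?A t * ?w t)"
      using Am by (intro lratio_integrable[OF g X I, where K = 1]) (auto split: split_indicator)
    then show ?thesis using iw by simp
  qed
  finally have "(\<integral>x. (sqrt (g x) - sqrt (?r x))\<^sup>2 \<partial>N)
      \<le> (\<tau> * ?D + M\<^sup>2 * (\<integral>t. indicat_real ?A t * ?w t \<partial>\<pi>)) / ?D / (4 * m)"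
    using D m_pos by (simp add: divide_right_mono)
  also have "\<dots> = (\<tau> + M\<^sup>2 * ((\<integral>t. indicat_real ?A t * ?w t \<partial>\<pi>) / ?D)) / (4 * m)"
    using D by (simp add: add_divide_distrib)
  finally show ?thesis .
qed

theorem posterior_mean_risk_le:
  fixes C :: "('a \<Rightarrow> real) set" and I :: "'i set"
  assumes g: "bdens g" and I: "finite I"
    and mass: "b \<le> prior.prob {t \<in> space \<pi>. sqdist N (f t) g \<le> \<epsilon>}" "0 < b"
    and C: "finite C" "\<And>q. q \<in> C \<Longrightarrow> bdens q"
      "\<And>t. t \<in> space \<pi> \<Longrightarrow> \<exists>q\<in>C. sqdist N (f t) q \<le> \<delta>"
    and d0: "0 < d0" and \<tau>: "0 \<le> \<tau>"
  shows "(\<integral>\<^sup>+X. ennreal (\<integral>x. (sqrt (g x) - sqrt (posterior_mean I X x))\<^sup>2 \<partial>N) \<partial>iid I N g)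
    \<le> ennreal ((\<tau> + M\<^sup>2 * (d0 / b * exp (real (card I) * \<epsilon> / m)
         + real (card C) * (exp (- (real (card I) * (\<tau> / 2 - \<delta>) / (8 * M)))
         + exp (- (real (card I) * ((\<tau> / 2 - \<delta>) / (16 * M) - M / m\<^sup>2 * \<delta>))) / d0))) / (4 * m))"
    (is "?L \<le> ennreal ((\<tau> + M\<^sup>2 * ?R) / (4 * m))")
proof -
  let ?A = "{t \<in> space \<pi>. \<tau> < sqdist N (f t) g}"
  let ?post = "\<lambda>X. (\<integral>t. indicat_real ?A t * lratio I g X t \<partial>\<pi>) / (\<integral>t. lratio I g X t \<partial>\<pi>)"
  interpret P: prob_space "iid I N g" by (rule prob_space_iid[OF g])
  have R: "0 \<le> ?R" using d0 mass(2) by (intro add_nonneg_nonneg mult_nonneg_nonneg) auto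
  have p0: "0 \<le> ?post X" if "X \<in> space (iid I N g)" for X
  proof -
    have "0 \<le> lratio I g X t" if "t \<in> space \<pi>" for t
      using lratio_bounds(3)[OF g _ that, of X I] \<open>X \<in> space (iid I N g)\<close> by (simp add: space_iid less_imp_le)
    then show ?thesis by (intro divide_nonneg_nonneg Bochner_Integration.integral_nonneg) auto
  qed
  have Am: "?A \<in> sets \<pi>"
  proof -
    note [measurable] = sqdist_f_measurable[OF g]
    show ?thesis by measurable
  qed
  have pm: "(\<lambda>X. ennreal (?post X)) \<in> borel_measurable (iid I N g)"
  proof -
    have lm: "(\<lambda>(X, t). lratio I g X t) \<in> borel_measurable (sample_space I \<Otimes>\<^sub>M \<pi>)"
      using lratio_measurable[OF g measurable_fst measurable_snd I] by (simp add: split_beta')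
    have "(\<lambda>(X, t). indicat_real ?A t * lratio I g X t) \<in> borel_measurable (sample_space I \<Otimes>\<^sub>M \<pi>)"
    proof -
      note [measurable] = lm Am
      show ?thesis by measurable
    qed
    from prior.borel_measurable_lebesgue_integral[OF this] prior.borel_measurable_lebesgue_integral[OF lm]
    have "?post \<in> borel_measurable (sample_space I)" by (rule borel_measurable_divide)
    then have "?post \<in> borel_measurable (iid I N g)" by (simp cong: measurable_cong_sets add: sets_iid)
    then show ?thesis by measurable
  qed
  have "?L \<le> (\<integral>\<^sup>+X. ennreal (\<tau> / (4 * m)) + ennreal (M\<^sup>2 / (4 * m)) * ennreal (?post X) \<partial>iid I N g)"
  proof (rule nn_integral_mono)
    fix X assume X: "X \<in> space (iid I N g)"
    have "(\<tau> + M\<^sup>2 * P) / (4 * m) = \<tau> / (4 * m) + M\<^sup>2 / (4 * m) * P" for P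
      by (simp add: add_divide_distrib)
    from this[of "?post X"]
    have "(\<integral>x. (sqrt (g x) - sqrt (posterior_mean I X x))\<^sup>2 \<partial>N) \<le> \<tau> / (4 * m) + M\<^sup>2 / (4 * m) * ?post X"
      using posterior_mean_loss_le[OF g _ I \<tau>, of X] X unfolding space_iid by (simp only:)
    from ennreal_leI[OF this]
    have "ennreal (\<integral>x. (sqrt (g x) - sqrt (posterior_mean I X x))\<^sup>2 \<partial>N)
        \<le> ennreal (\<tau> / (4 * m) + M\<^sup>2 / (4 * m) * ?post X)" .
    moreover have "ennreal (u + v * P) = ennreal u + ennreal v * ennreal P"
      if "0 \<le> u" "0 \<le> v" "0 \<le> P" for u v P
      using that by (simp add: ennreal_mult)
    from this[OF _ _ p0[OF X], of "\<tau> / (4 * m)" "M\<^sup>2 / (4 * m)"]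
    have "ennreal (\<tau> / (4 * m) + M\<^sup>2 / (4 * m) * ?post X)
        = ennreal (\<tau> / (4 * m)) + ennreal (M\<^sup>2 / (4 * m)) * ennreal (?post X)"
      using m_pos \<tau> by simp
    ultimately show "ennreal (\<integral>x. (sqrt (g x) - sqrt (posterior_mean I X x))\<^sup>2 \<partial>N)
        \<le> ennreal (\<tau> / (4 * m)) + ennreal (M\<^sup>2 / (4 * m)) * ennreal (?post X)"
      by (simp only:)
  qed
  also have "\<dots> = ennreal (\<tau> / (4 * m)) + ennreal (M\<^sup>2 / (4 * m)) * (\<integral>\<^sup>+X. ennreal (?post X) \<partial>iid I N g)"
    using pm by (simp add: nn_integral_add nn_integral_cmult P.emeasure_space_1)
  also have "\<dots> \<le> ennreal (\<tau> / (4 * m)) + ennreal (M\<^sup>2 / (4 * m)) * ennreal ?R"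
    by (intro add_left_mono mult_left_mono expected_posterior_tail_le[OF g I mass C d0]) auto
  also have "\<dots> = ennreal ((\<tau> + M\<^sup>2 * ?R) / (4 * m))"
    using R m_pos \<tau>
    by (simp add: ennreal_plus[symmetric] ennreal_mult[symmetric] add_divide_distrib del: ennreal_plus)
  finally show ?thesis .
qed

end

section \<open>Lower bounds from two points and from hypercubes\<close>

context density_bounds
begin

lemma iid_eq_density:
  assumes g: "bdens g" and I: "finite I"
  shows "iid I N g = density (\<Pi>\<^sub>M i\<in>I. N) (\<lambda>X. \<Prod>i\<in>I. ennreal (g (X i)))"
proof -
  have [measurable]: "g \<in> borel_measurable N" by (rule bdensD(1)[OF g])
  interpret D: product_prob_space "\<lambda>_. density N (\<lambda>x. ennreal (g x))" I
    by (rule product_prob_space_bdens[OF g])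
  interpret P: product_sigma_finite "\<lambda>_. N"
    by (simp add: product_sigma_finite_def sigma_finite_measure_axioms)
  have "density (\<Pi>\<^sub>M i\<in>I. N) (\<lambda>X. \<Prod>i\<in>I. ennreal (g (X i))) = iid I N g"
    unfolding iid_def
  proof (rule D.PiM_eqI[OF I])
    show "sets (density (\<Pi>\<^sub>M i\<in>I. N) (\<lambda>X. \<Prod>i\<in>I. ennreal (g (X i))))
        = sets (\<Pi>\<^sub>M i\<in>I. density N (\<lambda>x. ennreal (g x)))"
      using sets_iid[of I N g] by (simp add: iid_def)
    fix A assume "\<And>i. i \<in> I \<Longrightarrow> A i \<in> sets (density N (\<lambda>x. ennreal (g x)))"
    then have A[measurable]: "\<And>i. i \<in> I \<Longrightarrow> A i \<in> sets N" by simp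
    have m: "(\<lambda>X. \<Prod>i\<in>I. ennreal (g (X i))) \<in> borel_measurable (\<Pi>\<^sub>M i\<in>I. N)" by measurable
    have "emeasure (density (\<Pi>\<^sub>M i\<in>I. N) (\<lambda>X. \<Prod>i\<in>I. ennreal (g (X i)))) (Pi\<^sub>E I A)
        = (\<integral>\<^sup>+X. (\<Prod>i\<in>I. ennreal (g (X i))) * indicator (Pi\<^sub>E I A) X \<partial>(\<Pi>\<^sub>M i\<in>I. N))"
      using A I m by (intro emeasure_density sets_PiM_I_finite) auto
    also have "\<dots> = (\<integral>\<^sup>+X. (\<Prod>i\<in>I. ennreal (g (X i)) * indicator (A i) (X i)) \<partial>(\<Pi>\<^sub>M i\<in>I. N))"
    proof (rule nn_integral_cong)
      fix X assume "X \<in> space (\<Pi>\<^sub>M i\<in>I. N)"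
      then have X: "X \<in> extensional I" by (auto simp: space_PiM PiE_def)
      show "(\<Prod>i\<in>I. ennreal (g (X i))) * indicator (Pi\<^sub>E I A) X
          = (\<Prod>i\<in>I. ennreal (g (X i)) * indicator (A i) (X i))"
      proof (cases "X \<in> Pi\<^sub>E I A")
        case True then show ?thesis by (auto intro!: prod.cong simp: PiE_mem)
      next
        case False
        then obtain i where "i \<in> I" "X i \<notin> A i" using X by (auto simp: PiE_def)
        then have "(\<Prod>i\<in>I. ennreal (g (X i)) * indicator (A i) (X i)) = 0"
          using I by (intro prod_zero bexI[of _ i]) auto
        then show ?thesis using False by simp
      qed
    qed
    also have "\<dots> = (\<Prod>i\<in>I. \<integral>\<^sup>+x. ennreal (g x) * indicator (A i) x \<partial>N)"
      using A I by (intro P.product_nn_integral_prod) auto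
    also have "\<dots> = (\<Prod>i\<in>I. emeasure (density N (\<lambda>x. ennreal (g x))) (A i))"
      using A by (intro prod.cong refl emeasure_density[symmetric]) auto
    finally show "emeasure (density (\<Pi>\<^sub>M i\<in>I. N) (\<lambda>X. \<Prod>i\<in>I. ennreal (g (X i)))) (Pi\<^sub>E I A)
        = (\<Prod>i\<in>I. emeasure (density N (\<lambda>x. ennreal (g x))) (A i))" .
  qed
  then show ?thesis ..
qed

lemma nn_integral_iid_change:
  assumes g: "bdens g" and h: "bdens h" and I: "finite I"
    and F: "F \<in> borel_measurable (\<Pi>\<^sub>M i\<in>I. N)"
  shows "(\<integral>\<^sup>+X. F X \<partial>iid I N h) = (\<integral>\<^sup>+X. ennreal (\<Prod>i\<in>I. h (X i) / g (X i)) * F X \<partial>iid I N g)"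
proof -
  have [measurable]: "g \<in> borel_measurable N" "h \<in> borel_measurable N"
    using bdensD(1)[OF g] bdensD(1)[OF h] by auto
  note [measurable] = F
  have "(\<integral>\<^sup>+X. F X \<partial>iid I N h) = (\<integral>\<^sup>+X. (\<Prod>i\<in>I. ennreal (h (X i))) * F X \<partial>(\<Pi>\<^sub>M i\<in>I. N))"
    unfolding iid_eq_density[OF h I] using I by (intro nn_integral_density) measurable
  also have "\<dots> = (\<integral>\<^sup>+X. (\<Prod>i\<in>I. ennreal (g (X i))) * (ennreal (\<Prod>i\<in>I. h (X i) / g (X i)) * F X) \<partial>(\<Pi>\<^sub>M i\<in>I. N))"
  proof (rule nn_integral_cong)
    fix X assume "X \<in> space (\<Pi>\<^sub>M i\<in>I. N)"
    then have X: "X i \<in> space N" if "i \<in> I" for i using that by (auto simp: space_PiM PiE_def)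
    have "ennreal (\<Prod>i\<in>I. h (X i) / g (X i)) = (\<Prod>i\<in>I. ennreal (h (X i) / g (X i)))"
      using X bdensD(4)[OF g] bdensD(4)[OF h] by (intro prod_ennreal[symmetric]) (simp add: less_imp_le)
    moreover have "(\<Prod>i\<in>I. ennreal (g (X i))) * (\<Prod>i\<in>I. ennreal (h (X i) / g (X i))) = (\<Prod>i\<in>I. ennreal (h (X i)))"
      unfolding prod.distrib[symmetric]
    proof (intro prod.cong refl)
      fix i assume "i \<in> I"
      then have "0 < g (X i)" "0 < h (X i)" using X bdensD(4)[OF g] bdensD(4)[OF h] by auto
      then show "ennreal (g (X i)) * ennreal (h (X i) / g (X i)) = ennreal (h (X i))"
        by (subst ennreal_mult[symmetric]) auto
    qed
    ultimately show "(\<Prod>i\<in>I. ennreal (h (X i))) * F X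
        = (\<Prod>i\<in>I. ennreal (g (X i))) * (ennreal (\<Prod>i\<in>I. h (X i) / g (X i)) * F X)"
      by (simp add: mult.assoc[symmetric])
  qed
  also have "\<dots> = (\<integral>\<^sup>+X. ennreal (\<Prod>i\<in>I. h (X i) / g (X i)) * F X \<partial>iid I N g)"
    unfolding iid_eq_density[OF g I] using I by (intro nn_integral_density[symmetric]) measurable
  finally show ?thesis .
qed

text \<open>
  For fixed \<open>r\<close> the minimum over \<open>u\<close> of \<open>u\<^sup>2 + r * (\<delta> - u)\<^sup>2\<close> is
  \<open>\<delta>\<^sup>2 * r / (1 + r)\<close>, and \<open>1 / (1 + r)\<close> lies above its tangent \<open>3 / 4 - r / 4\<close> at \<open>r = 1\<close>.
  A bound that is quadratic in \<open>r\<close> needs only two moments of the likelihood ratio.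
\<close>

lemma two_point_pointwise:
  fixes r u \<delta> :: real
  assumes "0 \<le> r"
  shows "\<delta>\<^sup>2 * (3 / 4) * r \<le> u\<^sup>2 + r * (\<delta> - u)\<^sup>2 + \<delta>\<^sup>2 / 4 * (r * r)"
proof -
  have "(1 + r) * (u\<^sup>2 + r * (\<delta> - u)\<^sup>2) - r * \<delta>\<^sup>2 = (u - r * (\<delta> - u))\<^sup>2"
    by (simp add: power2_eq_square algebra_simps)
  then have a: "r * \<delta>\<^sup>2 \<le> (1 + r) * (u\<^sup>2 + r * (\<delta> - u)\<^sup>2)" by (smt (verit) zero_le_power2)
  have "r * \<delta>\<^sup>2 - (1 + r) * (\<delta>\<^sup>2 * (3 / 4) * r - \<delta>\<^sup>2 / 4 * (r * r)) = \<delta>\<^sup>2 / 4 * (r * (1 - r)\<^sup>2)"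
    by (simp add: power2_eq_square field_simps)
  moreover have "0 \<le> \<delta>\<^sup>2 / 4 * (r * (1 - r)\<^sup>2)" using assms by simp
  ultimately have "(1 + r) * (\<delta>\<^sup>2 * (3 / 4) * r - \<delta>\<^sup>2 / 4 * (r * r)) \<le> (1 + r) * (u\<^sup>2 + r * (\<delta> - u)\<^sup>2)"
    using a by linarith
  then have "\<delta>\<^sup>2 * (3 / 4) * r - \<delta>\<^sup>2 / 4 * (r * r) \<le> u\<^sup>2 + r * (\<delta> - u)\<^sup>2"
    using assms by (subst (asm) mult_le_cancel_left_pos) auto
  then show ?thesis by simp
qed

text \<open>
  No statistic \<open>u\<close> can be close to \<open>0\<close> under \<open>g\<close> and close to \<open>\<delta>\<close> under \<open>h\<close> when the
  likelihood ratio of the two sample laws has second moment at most \<open>2\<close>. With that ratio as \<open>r\<close>, the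
  previous inequality gives \<open>3 / 4 - 2 / 4\<close> times \<open>\<delta>\<^sup>2\<close>.
\<close>

lemma two_point_lower_bound:
  assumes g: "bdens g" and h: "bdens h" and I: "finite I"
    and u: "u \<in> borel_measurable (\<Pi>\<^sub>M i\<in>I. N)"
    and close: "exp (real (card I) * sqdist N h g / m) \<le> 2"
  shows "ennreal (\<delta>\<^sup>2 / 4) \<le> (\<integral>\<^sup>+X. ennreal ((u X)\<^sup>2) \<partial>iid I N g) + (\<integral>\<^sup>+X. ennreal ((\<delta> - u X)\<^sup>2) \<partial>iid I N h)"
    (is "_ \<le> ?A + ?B")
proof -
  define r where "r X = (\<Prod>i\<in>I. h (X i) / g (X i))" for X
  interpret H: prob_space "iid I N h" by (rule prob_space_iid[OF h])
  have gh: "g \<in> borel_measurable N" "h \<in> borel_measurable N"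
    using bdensD(1)[OF g] bdensD(1)[OF h] by auto
  have r[measurable]: "r \<in> borel_measurable (\<Pi>\<^sub>M i\<in>I. N)"
    using gh I unfolding r_def by measurable
  note [measurable] = u
  have mg: "measurable (iid I N g) borel = measurable (\<Pi>\<^sub>M i\<in>I. N) (borel :: ennreal measure)"
    by (intro measurable_cong_sets sets_iid refl)
  have r0: "0 \<le> r X" if "X \<in> space (iid I N g)" for X
    unfolding r_def using PiE_mem[OF that[unfolded space_iid]] bdensD(4)[OF g] bdensD(4)[OF h]
    by (intro prod_nonneg) (simp add: less_imp_le)
  have r1: "(\<integral>\<^sup>+X. ennreal (r X) \<partial>iid I N g) = 1"
    using nn_integral_iid_change[OF g h I, of "\<lambda>_. 1"] by (simp add: r_def H.emeasure_space_1)
  \<comment> \<open>The second moment under \<open>g\<close> is the mean under \<open>h\<close>, hence a reciprocal likelihood ratio as in \<open>chi_iid\<close>.\<close>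
  have "(\<integral>\<^sup>+X. ennreal (r X) * ennreal (r X) \<partial>iid I N g) = (\<integral>\<^sup>+X. ennreal (r X) \<partial>iid I N h)"
    using nn_integral_iid_change[OF g h I, of "\<lambda>X. ennreal (r X)"] by (simp add: r_def[symmetric])
  also have "\<dots> \<le> ennreal (exp (real (card I) * sqdist N h g / m))"
    unfolding r_def by (rule chi_iid[OF h g I])
  also have "\<dots> \<le> ennreal 2" by (intro ennreal_leI close)
  finally have r2: "(\<integral>\<^sup>+X. ennreal (r X) * ennreal (r X) \<partial>iid I N g) \<le> 2" by simp
  have B: "?B = (\<integral>\<^sup>+X. ennreal (r X) * ennreal ((\<delta> - u X)\<^sup>2) \<partial>iid I N g)"
    unfolding r_def by (rule nn_integral_iid_change[OF g h I]) measurable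
  have "ennreal (\<delta>\<^sup>2 * (3 / 4)) = (\<integral>\<^sup>+X. ennreal (\<delta>\<^sup>2 * (3 / 4)) * ennreal (r X) \<partial>iid I N g)"
    by (subst nn_integral_cmult) (auto simp: mg r1)
  also have "\<dots> \<le> (\<integral>\<^sup>+X. ennreal ((u X)\<^sup>2) + ennreal (r X) * ennreal ((\<delta> - u X)\<^sup>2)
      + ennreal (\<delta>\<^sup>2 / 4) * (ennreal (r X) * ennreal (r X)) \<partial>iid I N g)"
  proof (rule nn_integral_mono)
    fix X assume X: "X \<in> space (iid I N g)"
    have "ennreal (\<delta>\<^sup>2 * (3 / 4)) * ennreal (r X) = ennreal (\<delta>\<^sup>2 * (3 / 4) * r X)"
      using r0[OF X] by (intro ennreal_mult[symmetric]) auto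
    also have "\<dots> \<le> ennreal ((u X)\<^sup>2 + r X * (\<delta> - u X)\<^sup>2 + \<delta>\<^sup>2 / 4 * (r X * r X))"
      by (intro ennreal_leI two_point_pointwise r0 X)
    also have "\<dots> = ennreal ((u X)\<^sup>2) + ennreal (r X) * ennreal ((\<delta> - u X)\<^sup>2)
      + ennreal (\<delta>\<^sup>2 / 4) * (ennreal (r X) * ennreal (r X))"
    proof -
      have "ennreal (a + b * c + d * (b * b)) = ennreal a + ennreal b * ennreal c + ennreal d * (ennreal b * ennreal b)"
        if "0 \<le> a" "0 \<le> b" "0 \<le> c" "0 \<le> d" for a b c d
        using that by (simp add: ennreal_mult)
      from this[of "(u X)\<^sup>2" "r X" "(\<delta> - u X)\<^sup>2" "\<delta>\<^sup>2 / 4"] show ?thesis using r0[OF X] by simp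
    qed
    finally show "ennreal (\<delta>\<^sup>2 * (3 / 4)) * ennreal (r X) \<le> ennreal ((u X)\<^sup>2) + ennreal (r X) * ennreal ((\<delta> - u X)\<^sup>2)
      + ennreal (\<delta>\<^sup>2 / 4) * (ennreal (r X) * ennreal (r X))" .
  qed
  also have "\<dots> = ?A + ?B + ennreal (\<delta>\<^sup>2 / 4) * (\<integral>\<^sup>+X. ennreal (r X) * ennreal (r X) \<partial>iid I N g)"
  proof -
    have "(\<lambda>X. ennreal ((u X)\<^sup>2)) \<in> borel_measurable (iid I N g)"
      "(\<lambda>X. ennreal (r X) * ennreal ((\<delta> - u X)\<^sup>2)) \<in> borel_measurable (iid I N g)"
      "(\<lambda>X. ennreal (r X) * ennreal (r X)) \<in> borel_measurable (iid I N g)"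
      unfolding mg by measurable
    then show ?thesis unfolding B by (simp add: nn_integral_add nn_integral_cmult)
  qed
  also have "\<dots> \<le> ?A + ?B + ennreal (\<delta>\<^sup>2 / 4) * 2" by (intro add_left_mono mult_left_mono r2) simp
  finally have "ennreal (\<delta>\<^sup>2 * (3 / 4)) \<le> ?A + ?B + ennreal (\<delta>\<^sup>2 / 2)"
    by (simp add: ennreal_mult''[symmetric] flip: ennreal_numeral)
  then have "ennreal (\<delta>\<^sup>2 * (3 / 4)) - ennreal (\<delta>\<^sup>2 / 2) \<le> ?A + ?B"
    by (subst ennreal_minus_le_iff) (auto simp: add.commute)
  moreover have "ennreal (\<delta>\<^sup>2 * (3 / 4)) - ennreal (\<delta>\<^sup>2 / 2) = ennreal (\<delta>\<^sup>2 / 4)"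
    by (subst ennreal_minus) (auto simp: field_simps)
  ultimately show ?thesis by simp
qed

end

text \<open>
  Assouad's averaging: over all vertices \<open>S\<close> of the cube, the \<open>j\<close>-th errors pair up along the edges in
  direction \<open>j\<close>, so their average is at least \<open>\<eta> / 2\<close>. The worst vertex is at least as bad as the
  average one.
\<close>

lemma hypercube_lower_bound:
  fixes a :: "'j \<Rightarrow> 'j set \<Rightarrow> ennreal"
  assumes J: "finite J"
    and pair: "\<And>j S. j \<in> J \<Longrightarrow> S \<subseteq> J - {j} \<Longrightarrow> ennreal \<eta> \<le> a j S + a j (insert j S)"
    and up: "\<And>S. S \<subseteq> J \<Longrightarrow> (\<Sum>j\<in>J. a j S) \<le> R" and \<eta>: "0 \<le> \<eta>"
  shows "ennreal (real (card J) * \<eta> / 2) \<le> R"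
proof (cases "J = {}")
  case False
  define k where "k = card J"
  have k: "0 < k" using J False by (simp add: k_def card_gt_0_iff)
  have one: "of_nat (2 ^ (k - 1)) * ennreal \<eta> \<le> (\<Sum>S\<in>Pow J. a j S)" if j: "j \<in> J" for j
  proof -
    have J': "J = insert j (J - {j})" using j by auto
    have inj: "inj_on (insert j) (Pow (J - {j}))" by (auto simp: inj_on_def)
    have "Pow J = Pow (J - {j}) \<union> insert j ` Pow (J - {j})"
      by (subst J', subst Pow_insert) simp
    then have "(\<Sum>S\<in>Pow J. a j S) = (\<Sum>S\<in>Pow (J - {j}). a j S) + (\<Sum>S\<in>insert j ` Pow (J - {j}). a j S)"
      using J by (simp add: sum.union_disjoint[symmetric]) (subst sum.union_disjoint, auto)
    also have "\<dots> = (\<Sum>S\<in>Pow (J - {j}). a j S + a j (insert j S))"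
      by (simp add: sum.reindex[OF inj] sum.distrib)
    also have "\<dots> \<ge> (\<Sum>S\<in>Pow (J - {j}). ennreal \<eta>)"
      using pair[OF j] by (intro sum_mono) auto
    finally show ?thesis using J j by (simp add: card_Pow k_def)
  qed
  have "of_nat k * (of_nat (2 ^ (k - 1)) * ennreal \<eta>) \<le> (\<Sum>j\<in>J. \<Sum>S\<in>Pow J. a j S)"
    using sum_mono[OF one, of J "\<lambda>j. j"] by (simp add: k_def)
  also have "\<dots> = (\<Sum>S\<in>Pow J. \<Sum>j\<in>J. a j S)" by (rule sum.swap)
  also have "\<dots> \<le> (\<Sum>S\<in>Pow J. R)" using up by (intro sum_mono) auto
  also have "\<dots> = of_nat (2 ^ k) * R" using J by (simp add: card_Pow k_def)
  finally have le: "of_nat k * (of_nat (2 ^ (k - 1)) * ennreal \<eta>) \<le> of_nat (2 ^ k) * R" .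
  show ?thesis
  proof (cases R)
    case (real x)
    have "ennreal (real k * (2 ^ (k - 1) * \<eta>)) \<le> ennreal (2 ^ k * x)"
      using le \<eta> real by (simp add: ennreal_mult ennreal_of_nat_eq_real_of_nat)
    then have "real k * (2 ^ (k - 1) * \<eta>) \<le> 2 ^ k * x" using real by (simp add: ennreal_le_iff)
    moreover have "(2::real) ^ k = 2 * 2 ^ (k - 1)" using k by (cases k) auto
    ultimately have "2 ^ (k - 1) * (real k * \<eta>) \<le> 2 ^ (k - 1) * (2 * x)" by (simp add: algebra_simps)
    then have "real k * \<eta> / 2 \<le> x" by simp
    then show ?thesis using real by (simp add: k_def ennreal_leI)
  qed simp
qed simp

section \<open>The exponential family of the trigonometric system\<close>

lemma prob_space_lebesgue01: "prob_space lebesgue01"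
proof (rule prob_spaceI)
  show "emeasure lebesgue01 (space lebesgue01) = 1"
    by (subst emeasure_restrict_space) (auto simp: space_restrict_space)
qed

interpretation U: prob_space lebesgue01 by (rule prob_space_lebesgue01)

lemma space_lebesgue01: "space lebesgue01 = {0..1}"
  by (simp add: space_restrict_space)

lemma measure_lebesgue01 [simp]: "measure lebesgue01 {0..1} = 1"
  using U.prob_space by (simp add: space_lebesgue01)

lemma borel_measurable_lebesgue01: "f \<in> borel_measurable borel \<Longrightarrow> f \<in> borel_measurable lebesgue01"
  by (simp add: measurable_restrict_space1)

lemma trig_measurable[measurable]: "trig j \<in> borel_measurable borel"
  unfolding trig_def by measurable

lemma abs_trig_le: "\<bar>trig j x\<bar> \<le> sqrt 2"
proof -
  have "1 \<le> sqrt (2::real)" by simp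
  then show ?thesis unfolding trig_def by (auto simp: abs_mult)
qed

lemma integrable_lebesgue01:
  fixes f :: "real \<Rightarrow> real"
  assumes "f \<in> borel_measurable lebesgue01" "\<And>x. \<bar>f x\<bar> \<le> K"
  shows "integrable lebesgue01 f"
  using assms by (intro U.integrable_const_bound[where B = K]) auto

lemma integral_lebesgue01_FTC:
  fixes f F :: "real \<Rightarrow> real"
  assumes "\<And>x. (F has_real_derivative f x) (at x)" "\<And>x. isCont f x"
  shows "(\<integral>x. f x \<partial>lebesgue01) = F 1 - F 0"
proof -
  have "(\<integral>x. f x \<partial>lebesgue01) = (\<integral>x. f x * indicator {0..1} x \<partial>lborel)"
    by (subst integral_restrict_space) (auto simp: mult.commute)
  also have "\<dots> = F 1 - F 0" using assms by (intro integral_FTC_Icc_real) auto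
  finally show ?thesis .
qed

lemma integral_cos_int: "(\<integral>x. cos (2 * pi * of_int z * x) \<partial>lebesgue01) = of_bool (z = 0)"
proof (cases "z = 0")
  case False
  have "(\<integral>x. cos (2 * pi * of_int z * x) \<partial>lebesgue01)
      = sin (2 * pi * of_int z * 1) / (2 * pi * of_int z) - sin (2 * pi * of_int z * 0) / (2 * pi * of_int z)"
    using False by (intro integral_lebesgue01_FTC) (auto intro!: derivative_eq_intros continuous_intros)
  then show ?thesis using False by simp
qed (use U.prob_space in \<open>simp add: space_lebesgue01\<close>)

lemma integral_sin_int: "(\<integral>x. sin (2 * pi * of_int z * x) \<partial>lebesgue01) = 0"
proof (cases "z = 0")
  case False
  have "(\<integral>x. sin (2 * pi * of_int z * x) \<partial>lebesgue01)
      = - cos (2 * pi * of_int z * 1) / (2 * pi * of_int z) - - cos (2 * pi * of_int z * 0) / (2 * pi * of_int z)"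
    using False by (intro integral_lebesgue01_FTC) (auto intro!: derivative_eq_intros continuous_intros)
  then show ?thesis using False by simp
qed simp

lemma integrable_cos_sin [simp]:
  "integrable lebesgue01 (\<lambda>x. cos (c * x))" "integrable lebesgue01 (\<lambda>x. sin (c * x))"
  by (rule integrable_lebesgue01[where K = 1], rule borel_measurable_lebesgue01, simp_all)+

lemma trig_orthonormal: "(\<integral>x. trig i x * trig j x \<partial>lebesgue01) = of_bool (i = j)"
proof -
  \<comment> \<open>Integer frequencies make differences of frequencies meaningful in the product formulas.\<close>
  define a :: "nat \<Rightarrow> int" where "a j = int ((j + 1) div 2)" for j
  have t: "trig j x = (if j = 0 then 1 else if odd j then sqrt 2 * sin (2 * pi * of_int (a j) * x)
      else sqrt 2 * cos (2 * pi * of_int (a j) * x))" for j x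
    by (auto simp: trig_def a_def)
  have cc: "cos (2 * pi * of_int u * x) * cos (2 * pi * of_int v * x)
      = cos (2 * pi * of_int (u - v) * x) / 2 + cos (2 * pi * of_int (u + v) * x) / 2" for u v :: int and x
    using cos_times_cos[of "2 * pi * of_int u * x" "2 * pi * of_int v * x"] by (simp add: algebra_simps add_divide_distrib)
  have ss: "sin (2 * pi * of_int u * x) * sin (2 * pi * of_int v * x)
      = cos (2 * pi * of_int (u - v) * x) / 2 - cos (2 * pi * of_int (u + v) * x) / 2" for u v :: int and x
    using sin_times_sin[of "2 * pi * of_int u * x" "2 * pi * of_int v * x"] by (simp add: algebra_simps diff_divide_distrib)
  have sc: "sin (2 * pi * of_int u * x) * cos (2 * pi * of_int v * x)
      = sin (2 * pi * of_int (u + v) * x) / 2 + sin (2 * pi * of_int (u - v) * x) / 2" for u v :: int and x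
    using sin_times_cos[of "2 * pi * of_int u * x" "2 * pi * of_int v * x"] by (simp add: algebra_simps add_divide_distrib)
  have CC: "(\<integral>x. cos (2 * pi * of_int u * x) * cos (2 * pi * of_int v * x) \<partial>lebesgue01)
      = of_bool (u = v) / 2 + of_bool (u + v = 0) / 2" for u v
    unfolding cc by (subst Bochner_Integration.integral_add) (simp_all del: of_int_add of_int_diff add: integral_cos_int)
  have SS: "(\<integral>x. sin (2 * pi * of_int u * x) * sin (2 * pi * of_int v * x) \<partial>lebesgue01)
      = of_bool (u = v) / 2 - of_bool (u + v = 0) / 2" for u v
    unfolding ss by (subst Bochner_Integration.integral_diff) (simp_all del: of_int_add of_int_diff add: integral_cos_int)
  have SC: "(\<integral>x. sin (2 * pi * of_int u * x) * cos (2 * pi * of_int v * x) \<partial>lebesgue01) = 0" for u v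
    unfolding sc by (subst Bochner_Integration.integral_add) (simp_all del: of_int_add of_int_diff add: integral_sin_int)
  have CS: "(\<integral>x. cos (2 * pi * of_int u * x) * sin (2 * pi * of_int v * x) \<partial>lebesgue01) = 0" for u v
    using SC[of v u] by (simp add: mult.commute)
  have pos: "0 < a j" if "j \<noteq> 0" for j using that by (cases j) (auto simp: a_def)
  have inj: "i = j" if "a i = a j" "odd i = odd j" for i j
    using that unfolding a_def by presburger
  have sq: "sqrt 2 * u * (sqrt 2 * v) = 2 * (u * v)" for u v :: real by simp
  show ?thesis
  proof (cases "i = 0 \<or> j = 0")
    case True
    then show ?thesis using pos[of i] pos[of j]
      by (cases "odd i"; cases "odd j") (auto simp: t integral_cos_int integral_sin_int)
  next
    case False
    then have p: "a i > 0" "a j > 0" using pos by auto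
    show ?thesis
      using False p inj[of i j]
      by (cases "odd i"; cases "odd j") (auto simp: t sq CC SS SC CS simp del: of_int_of_nat_eq)
  qed
qed

lemma integrable_trig_mult: "integrable lebesgue01 (\<lambda>x. trig i x * trig j x)"
proof (rule integrable_lebesgue01[where K = 2])
  show "(\<lambda>x. trig i x * trig j x) \<in> borel_measurable lebesgue01"
    by (intro borel_measurable_lebesgue01) measurable
  show "\<bar>trig i x * trig j x\<bar> \<le> 2" for x
    using mult_mono[OF abs_trig_le[of i x] abs_trig_le[of j x]] by (simp add: abs_mult)
qed

lemma integral_trig_poly_sq:
  assumes "finite J"
  shows "(\<integral>x. (\<Sum>j\<in>J. c j * trig j x)\<^sup>2 \<partial>lebesgue01) = (\<Sum>j\<in>J. (c j)\<^sup>2)"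
proof -
  have "(\<Sum>j\<in>J. c j * trig j x)\<^sup>2 = (\<Sum>i\<in>J. \<Sum>j\<in>J. c i * c j * (trig i x * trig j x))" for x
    by (simp add: power2_eq_square sum_product algebra_simps)
  then have "(\<integral>x. (\<Sum>j\<in>J. c j * trig j x)\<^sup>2 \<partial>lebesgue01)
      = (\<Sum>i\<in>J. \<Sum>j\<in>J. c i * c j * (\<integral>x. trig i x * trig j x \<partial>lebesgue01))"
    using integrable_trig_mult by simp
  also have "\<dots> = (\<Sum>i\<in>J. \<Sum>j\<in>J. if j = i then c i * c j else 0)"
    by (intro sum.cong refl) (auto simp: trig_orthonormal)
  also have "\<dots> = (\<Sum>j\<in>J. (c j)\<^sup>2)"
    using assms by (simp add: power2_eq_square)
  finally show ?thesis .
qed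

text \<open>
  Expand the square of \<open>h\<close> minus its projection to the span of the \<open>trig j\<close> with \<open>j\<in>J\<close>.
\<close>

lemma bessel_trig:
  assumes h: "h \<in> borel_measurable lebesgue01" "\<And>x. x \<in> {0..1} \<Longrightarrow> \<bar>h x\<bar> \<le> K" and J: "finite J"
  shows "(\<Sum>j\<in>J. (\<integral>x. h x * trig j x \<partial>lebesgue01)\<^sup>2) \<le> (\<integral>x. (h x)\<^sup>2 \<partial>lebesgue01)"
proof -
  define c where "c j = (\<integral>x. h x * trig j x \<partial>lebesgue01)" for j
  let ?S = "\<lambda>x. \<Sum>j\<in>J. c j * trig j x"
  have tm: "trig j \<in> borel_measurable lebesgue01" for j by (intro borel_measurable_lebesgue01) measurable
  note [measurable] = h(1) tm
  have i1: "integrable lebesgue01 (\<lambda>x. (h x)\<^sup>2)"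
  proof (rule U.integrable_const_bound[where B = "K\<^sup>2"])
    show "AE x in lebesgue01. norm ((h x)\<^sup>2) \<le> K\<^sup>2"
      using h(2) power_mono[OF h(2) abs_ge_zero, of _ 2] by (auto intro!: AE_I2 simp: space_lebesgue01)
  qed measurable
  have i2: "integrable lebesgue01 (\<lambda>x. h x * trig j x)" for j
  proof (rule U.integrable_const_bound[where B = "K * sqrt 2"])
    have "0 \<le> K" using h(2)[of 0] by auto
    then show "AE x in lebesgue01. norm (h x * trig j x) \<le> K * sqrt 2"
      using h(2) by (auto intro!: AE_I2 mult_mono abs_trig_le simp: space_lebesgue01 abs_mult
          intro: order_trans[OF abs_ge_zero])
  qed measurable
  have i3: "integrable lebesgue01 (\<lambda>x. (?S x)\<^sup>2)"
  proof (rule integrable_lebesgue01[where K = "(\<Sum>j\<in>J. \<bar>c j\<bar> * sqrt 2)\<^sup>2"])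
    fix x
    have "\<bar>?S x\<bar> \<le> (\<Sum>j\<in>J. \<bar>c j\<bar> * sqrt 2)"
      by (rule order_trans[OF sum_abs sum_mono]) (auto simp: abs_mult intro!: mult_left_mono abs_trig_le)
    from power_mono[OF this abs_ge_zero, of 2]
    show "\<bar>(?S x)\<^sup>2\<bar> \<le> (\<Sum>j\<in>J. \<bar>c j\<bar> * sqrt 2)\<^sup>2" by simp
  qed measurable
  have cross: "(\<integral>x. h x * ?S x \<partial>lebesgue01) = (\<Sum>j\<in>J. (c j)\<^sup>2)"
    and i4: "integrable lebesgue01 (\<lambda>x. h x * ?S x)"
  proof -
    have e: "h x * ?S x = (\<Sum>j\<in>J. c j * (h x * trig j x))" for x
      by (simp add: sum_distrib_left algebra_simps)
    show "(\<integral>x. h x * ?S x \<partial>lebesgue01) = (\<Sum>j\<in>J. (c j)\<^sup>2)"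
      unfolding e using i2 by (simp add: c_def[symmetric] power2_eq_square)
    show "integrable lebesgue01 (\<lambda>x. h x * ?S x)" unfolding e using i2 by simp
  qed
  have "0 \<le> (\<integral>x. (h x - ?S x)\<^sup>2 \<partial>lebesgue01)" by simp
  also have "\<dots> = (\<integral>x. (h x)\<^sup>2 - 2 * (h x * ?S x) + (?S x)\<^sup>2 \<partial>lebesgue01)"
    by (intro Bochner_Integration.integral_cong) (auto simp: power2_diff)
  also have "\<dots> = (\<integral>x. (h x)\<^sup>2 \<partial>lebesgue01) - 2 * (\<Sum>j\<in>J. (c j)\<^sup>2) + (\<Sum>j\<in>J. (c j)\<^sup>2)"
    using i1 i3 i4 by (simp add: cross integral_trig_poly_sq[OF J])
  finally show ?thesis by (simp add: c_def)
qed

text \<open>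
  A squared norm. Coordinate \<open>0\<close> is left out since \<open>log_series\<close>, and with it the density, starts at
  index \<open>1\<close>.
\<close>

definition coef_norm :: "(nat \<Rightarrow> real) \<Rightarrow> real" where
  "coef_norm \<theta> = (\<Sum>j. (\<theta> (Suc j))\<^sup>2)"

lemma log_series_measurable_pair:
  "(\<lambda>(\<theta>, x). log_series \<theta> x) \<in> borel_measurable ((\<Pi>\<^sub>M j\<in>UNIV. borel) \<Otimes>\<^sub>M borel)"
  unfolding log_series_def by measurable

lemma log_series_measurable[measurable]: "log_series \<theta> \<in> borel_measurable borel"
  unfolding log_series_def by measurable

lemma summable_log_series:
  assumes "summable (\<lambda>j. \<bar>\<theta> (Suc j)\<bar>)"
  shows "summable (\<lambda>j. \<theta> (Suc j) * trig (Suc j) x)"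
    and "\<bar>log_series \<theta> x\<bar> \<le> sqrt 2 * (\<Sum>j. \<bar>\<theta> (Suc j)\<bar>)"
proof -
  have b: "norm (\<theta> (Suc j) * trig (Suc j) x) \<le> sqrt 2 * \<bar>\<theta> (Suc j)\<bar>" for j
    using mult_left_mono[OF abs_trig_le[of "Suc j" x] abs_ge_zero[of "\<theta> (Suc j)"]]
    by (simp add: abs_mult mult.commute)
  have s: "summable (\<lambda>j. sqrt 2 * \<bar>\<theta> (Suc j)\<bar>)" using assms by (rule summable_mult)
  show sm: "summable (\<lambda>j. \<theta> (Suc j) * trig (Suc j) x)"
    using b by (intro summable_comparison_test'[OF s]) auto
  have "norm (\<Sum>j. \<theta> (Suc j) * trig (Suc j) x) \<le> (\<Sum>j. sqrt 2 * \<bar>\<theta> (Suc j)\<bar>)"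
    using b by (intro summable_norm[THEN order_trans] suminf_le summable_comparison_test'[OF s] s) auto
  then show "\<bar>log_series \<theta> x\<bar> \<le> sqrt 2 * (\<Sum>j. \<bar>\<theta> (Suc j)\<bar>)"
    using assms by (simp add: log_series_def suminf_mult)
qed

text \<open>
  The partial sums are uniformly bounded, so their squared norms, which are explicit by orthonormality, converge to
  the squared norm of the series.
\<close>

lemma parseval_log_series:
  assumes s: "summable (\<lambda>j. \<bar>\<theta> (Suc j)\<bar>)"
  shows "summable (\<lambda>j. (\<theta> (Suc j))\<^sup>2)" "(\<integral>x. (log_series \<theta> x)\<^sup>2 \<partial>lebesgue01) = coef_norm \<theta>"
proof -
  let ?S = "\<lambda>n x. \<Sum>j<n. \<theta> (Suc j) * trig (Suc j) x"
  let ?K = "sqrt 2 * (\<Sum>j. \<bar>\<theta> (Suc j)\<bar>)"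
  have bound: "\<bar>?S n x\<bar> \<le> ?K" for n x
  proof -
    have "\<bar>?S n x\<bar> \<le> (\<Sum>j<n. sqrt 2 * \<bar>\<theta> (Suc j)\<bar>)"
      by (rule order_trans[OF sum_abs sum_mono])
        (metis abs_ge_zero abs_mult abs_trig_le mult.commute mult_left_mono)
    also have "\<dots> \<le> ?K"
      unfolding sum_distrib_left[symmetric] using s by (intro mult_left_mono sum_le_suminf) auto
    finally show ?thesis .
  qed
  have "(\<lambda>n. \<integral>x. (?S n x)\<^sup>2 \<partial>lebesgue01) \<longlonglongrightarrow> (\<integral>x. (log_series \<theta> x)\<^sup>2 \<partial>lebesgue01)"
  proof (rule integral_dominated_convergence[where w = "\<lambda>_. ?K\<^sup>2"])
    show "(\<lambda>x. (log_series \<theta> x)\<^sup>2) \<in> borel_measurable lebesgue01"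
      by (intro borel_measurable_lebesgue01) measurable
    show "(\<lambda>x. (?S n x)\<^sup>2) \<in> borel_measurable lebesgue01" for n
      by (intro borel_measurable_lebesgue01) measurable
    show "AE x in lebesgue01. (\<lambda>n. (?S n x)\<^sup>2) \<longlonglongrightarrow> (log_series \<theta> x)\<^sup>2"
      using summable_LIMSEQ[OF summable_log_series(1)[OF s]]
      by (auto intro!: AE_I2 tendsto_power simp: log_series_def)
    have "(?S n x)\<^sup>2 \<le> ?K\<^sup>2" for n x
      using power_mono[OF bound[of x n] abs_ge_zero, of 2] by simp
    then show "AE x in lebesgue01. norm ((?S n x)\<^sup>2) \<le> ?K\<^sup>2" for n
      by (intro AE_I2) simp
  qed simp
  moreover have "(\<integral>x. (?S n x)\<^sup>2 \<partial>lebesgue01) = (\<Sum>j<n. (\<theta> (Suc j))\<^sup>2)" for n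
  proof -
    have "?S n x = (\<Sum>j\<in>Suc ` {..<n}. \<theta> j * trig j x)" for x
      by (simp add: sum.reindex)
    then show ?thesis by (simp only: integral_trig_poly_sq finite_imageI finite_lessThan) (simp add: sum.reindex)
  qed
  ultimately have "(\<lambda>j. (\<theta> (Suc j))\<^sup>2) sums (\<integral>x. (log_series \<theta> x)\<^sup>2 \<partial>lebesgue01)"
    by (simp add: sums_def)
  then show "summable (\<lambda>j. (\<theta> (Suc j))\<^sup>2)" "(\<integral>x. (log_series \<theta> x)\<^sup>2 \<partial>lebesgue01) = coef_norm \<theta>"
    by (auto simp: coef_norm_def sums_iff)
qed

lemma log_series_diff:
  assumes "summable (\<lambda>j. \<bar>\<theta> (Suc j)\<bar>)" "summable (\<lambda>j. \<bar>\<eta> (Suc j)\<bar>)"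
  shows "log_series \<theta> x - log_series \<eta> x = log_series (\<lambda>j. \<theta> j - \<eta> j) x"
  unfolding log_series_def
  using suminf_diff[OF summable_log_series(1)[OF assms(1)] summable_log_series(1)[OF assms(2)]]
  by (simp add: left_diff_distrib)

lemma summable_abs_diff:
  fixes f g :: "nat \<Rightarrow> real"
  assumes "summable (\<lambda>j. \<bar>f j\<bar>)" "summable (\<lambda>j. \<bar>g j\<bar>)"
  shows "summable (\<lambda>j. \<bar>f j - g j\<bar>)"
  using summable_add[OF assms]
  by (rule summable_comparison_test'[where N = 0]) (simp add: abs_triangle_ineq4)

text \<open>
  By the inequality between arithmetic and geometric mean \<open>\<bar>\<theta> j\<bar>\<close> is at most half of
  \<open>vseq j ^ (2 * p) * (\<theta> j)\<^sup>2 + 1 / vseq j ^ (2 * p)\<close>, and both terms have bounded sums when \<open>p \<ge> 1\<close>.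
  This is where the uniform bounds for all densities come from.
\<close>

lemma ellipsoid_abs_summable:
  assumes p: "p \<ge> 1" and \<theta>: "\<theta> \<in> ellipsoid p R"
  shows "summable (\<lambda>j. \<bar>\<theta> (Suc j)\<bar>)" "\<bar>log_series \<theta> x\<bar> \<le> R + 3"
proof -
  let ?e = "\<lambda>j. vseq j ^ (2 * p) * (\<theta> j)\<^sup>2"
  let ?q = "\<lambda>j::nat. 1 / (real j + 1)\<^sup>2"
  have S: "summable ?e" "(\<Sum>j. ?e j) < R" using \<theta> by (auto simp: ellipsoid_def)
  have se: "summable (\<lambda>j. ?e (Suc j))" using S(1) by (subst summable_Suc_iff)
  have "0 \<le> ?e 0" by (intro mult_nonneg_nonneg) (auto simp: vseq_def)
  then have le: "(\<Sum>j. ?e (Suc j)) < R" using suminf_split_head[OF S(1)] S(2) by linarith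
  have sq: "summable ?q" "(\<Sum>j. ?q j) = pi\<^sup>2 / 6"
    using inverse_squares_sums by (auto simp: sums_iff add.commute)
  have point: "\<bar>\<theta> (Suc j)\<bar> \<le> (?e (Suc j) + ?q j) / 2" for j
  proof -
    define v where "v = vseq (Suc j) ^ p"
    have "real j + 1 \<le> vseq (Suc j)" by (simp add: vseq_def)
    moreover have "(real j + 1) ^ 1 \<le> (real j + 1) ^ p" using p by (intro power_increasing) auto
    ultimately have v: "real j + 1 \<le> v" unfolding v_def
      using power_mono[of "real j + 1" "vseq (Suc j)" p] by simp
    then have v0: "0 < v" by linarith
    have v2: "vseq (Suc j) ^ (2 * p) = v\<^sup>2" by (simp add: v_def power_mult[symmetric] mult.commute)
    have "0 \<le> (v * \<bar>\<theta> (Suc j)\<bar> - 1 / v)\<^sup>2" by simp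
    also have "\<dots> = ?e (Suc j) + 1 / v\<^sup>2 - 2 * \<bar>\<theta> (Suc j)\<bar>"
      using v0 by (simp add: power2_diff power_mult_distrib power_divide v2)
    also have "1 / v\<^sup>2 \<le> ?q j" using v by (intro divide_left_mono power_mono) auto
    finally show ?thesis by simp
  qed
  have s: "summable (\<lambda>j. (?e (Suc j) + ?q j) / 2)"
    by (intro summable_divide summable_add se sq)
  show sm: "summable (\<lambda>j. \<bar>\<theta> (Suc j)\<bar>)"
    using point by (intro summable_comparison_test'[OF s, of 0]) auto
  have "(\<Sum>j. \<bar>\<theta> (Suc j)\<bar>) \<le> (\<Sum>j. (?e (Suc j) + ?q j) / 2)"
    by (intro suminf_le point sm s)
  also have "\<dots> = ((\<Sum>j. ?e (Suc j)) + pi\<^sup>2 / 6) / 2"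
    using suminf_divide[OF summable_add[OF se sq(1)], of 2] suminf_add[OF se sq(1)] sq(2) by simp
  also have "\<dots> \<le> (R + 3) / 2"
  proof -
    have "pi\<^sup>2 \<le> 4\<^sup>2" using pi_less_4 pi_ge_zero by (intro power_mono) auto
    then show ?thesis using le by simp
  qed
  finally have t: "(\<Sum>j. \<bar>\<theta> (Suc j)\<bar>) \<le> (R + 3) / 2" .
  have "sqrt 2 \<le> (2::real)" by (rule real_le_lsqrt) auto
  moreover have "0 \<le> (\<Sum>j. \<bar>\<theta> (Suc j)\<bar>)" by (intro suminf_nonneg sm) auto
  ultimately have "sqrt 2 * (\<Sum>j. \<bar>\<theta> (Suc j)\<bar>) \<le> 2 * ((R + 3) / 2)"
    using t by (intro mult_mono) auto
  then show "\<bar>log_series \<theta> x\<bar> \<le> R + 3" using summable_log_series(2)[OF sm, of x] by simp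
qed

definition normaliser :: "(nat \<Rightarrow> real) \<Rightarrow> real" where
  "normaliser \<theta> = (\<integral>t. exp (log_series \<theta> t) \<partial>lebesgue01)"

lemma dens_eq: "dens \<theta> x = exp (log_series \<theta> x) / normaliser \<theta>"
  by (simp add: dens_def normaliser_def)

context
  fixes \<theta> :: "nat \<Rightarrow> real" and B :: real
  assumes bd: "\<And>x. \<bar>log_series \<theta> x\<bar> \<le> B"
begin

lemma integrable_exp_log_series: "integrable lebesgue01 (\<lambda>x. exp (log_series \<theta> x))"
proof (rule integrable_lebesgue01[where K = "exp B"])
  show "(\<lambda>x. exp (log_series \<theta> x)) \<in> borel_measurable lebesgue01"
    by (intro borel_measurable_lebesgue01) measurable
  show "\<bar>exp (log_series \<theta> x)\<bar> \<le> exp B" for x using bd[of x] by simp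
qed

lemma normaliser_bounds: "exp (- B) \<le> normaliser \<theta>" "normaliser \<theta> \<le> exp B" "0 < normaliser \<theta>"
proof -
  have b: "- B \<le> log_series \<theta> x" "log_series \<theta> x \<le> B" for x using bd[of x] by (auto simp: abs_le_iff)
  have "(\<integral>x. exp (- B) \<partial>lebesgue01) \<le> normaliser \<theta>"
    unfolding normaliser_def using b integrable_exp_log_series by (intro integral_mono) auto
  then show l: "exp (- B) \<le> normaliser \<theta>" by (simp add: U.prob_space)
  show "0 < normaliser \<theta>" using l exp_gt_zero[of "- B"] by linarith
  have "normaliser \<theta> \<le> (\<integral>x. exp B \<partial>lebesgue01)"
    unfolding normaliser_def using b integrable_exp_log_series by (intro integral_mono) auto
  then show "normaliser \<theta> \<le> exp B" by (simp add: U.prob_space)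
qed

lemma dens_bounds: "exp (- (2 * B)) \<le> dens \<theta> x" "dens \<theta> x \<le> exp (2 * B)" "0 < dens \<theta> x"
proof -
  have b: "exp (- B) \<le> exp (log_series \<theta> x)" "exp (log_series \<theta> x) \<le> exp B"
    using bd[of x] by (auto simp: abs_le_iff)
  have "exp (- B) / exp B \<le> dens \<theta> x"
    unfolding dens_eq using b normaliser_bounds by (intro frac_le) auto
  then show "exp (- (2 * B)) \<le> dens \<theta> x" by (simp add: exp_diff[symmetric])
  have "dens \<theta> x \<le> exp B / exp (- B)"
    unfolding dens_eq using b normaliser_bounds by (intro frac_le) auto
  then show "dens \<theta> x \<le> exp (2 * B)" by (simp add: exp_diff[symmetric])
  show "0 < dens \<theta> x" unfolding dens_eq using normaliser_bounds by simp
qed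

lemma integral_dens: "(\<integral>x. dens \<theta> x \<partial>lebesgue01) = 1"
  unfolding dens_eq using normaliser_bounds(3) by (simp add: normaliser_def[symmetric])

end

lemma dens_measurable: "dens \<theta> \<in> borel_measurable borel"
  unfolding dens_def by measurable

lemma dens_measurable_pair:
  "(\<lambda>(\<theta>, x). dens \<theta> x) \<in> borel_measurable ((\<Pi>\<^sub>M j\<in>UNIV. borel) \<Otimes>\<^sub>M lebesgue01)"
proof -
  let ?P = "\<Pi>\<^sub>M j\<in>(UNIV :: nat set). borel :: real measure"
  have id: "(\<lambda>z. snd z) \<in> measurable (?P \<Otimes>\<^sub>M lebesgue01) borel"
    using measurable_compose[OF measurable_snd borel_measurable_lebesgue01[OF measurable_ident]] by simp
  have e: "(\<lambda>(\<theta>, x). exp (log_series \<theta> x)) \<in> borel_measurable (?P \<Otimes>\<^sub>M lebesgue01)"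
    using measurable_compose[OF measurable_Pair[OF measurable_fst id] log_series_measurable_pair]
    by (simp add: split_beta')
  have "(\<lambda>\<theta>. \<integral>x. exp (log_series \<theta> x) \<partial>lebesgue01) \<in> borel_measurable ?P"
    by (rule U.borel_measurable_lebesgue_integral[OF e])
  then have n: "(\<lambda>z. \<integral>x. exp (log_series (fst z) x) \<partial>lebesgue01) \<in> borel_measurable (?P \<Otimes>\<^sub>M lebesgue01)"
    using measurable_compose[OF measurable_fst] by fastforce
  show ?thesis using borel_measurable_divide[OF e n] by (simp add: dens_def split_beta')
qed

lemma abs_exp_diff_le:
  fixes a b B :: real
  assumes "\<bar>a\<bar> \<le> B" "\<bar>b\<bar> \<le> B"
  shows "\<bar>exp a - exp b\<bar> \<le> exp B * \<bar>a - b\<bar>"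
proof -
  have *: "exp u - exp v \<le> exp B * (u - v)" if "v \<le> u" "u \<le> B" for u v :: real
  proof -
    have "exp u * (1 + (v - u)) \<le> exp u * exp (v - u)"
      by (intro mult_left_mono exp_ge_add_one_self) auto
    then have "exp u * (1 + (v - u)) \<le> exp v" by (simp add: exp_diff)
    then have "exp u - exp v \<le> exp u * (u - v)" by (simp add: algebra_simps)
    also have "\<dots> \<le> exp B * (u - v)" using that by (intro mult_right_mono) auto
    finally show ?thesis .
  qed
  show ?thesis
  proof (cases "b \<le> a")
    case True then show ?thesis using *[of b a] assms by (simp add: abs_le_iff)
  next
    case False then show ?thesis using *[of a b] assms by (simp add: abs_le_iff)
  qed
qed

lemma integral_abs_sq_le:
  fixes h :: "real \<Rightarrow> real"
  assumes "h \<in> borel_measurable lebesgue01" "\<And>x. \<bar>h x\<bar> \<le> K"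
  shows "(\<integral>x. \<bar>h x\<bar> \<partial>lebesgue01)\<^sup>2 \<le> (\<integral>x. (h x)\<^sup>2 \<partial>lebesgue01)"
proof -
  have k: "\<bar>(h x)\<^sup>2\<bar> \<le> K\<^sup>2" for x using power_mono[OF assms(2) abs_ge_zero, of x 2] by simp
  have "integrable lebesgue01 (\<lambda>x. \<bar>h x\<bar>)" "integrable lebesgue01 (\<lambda>x. (h x)\<^sup>2)"
    using assms k by (auto intro!: integrable_lebesgue01)
  then show ?thesis
    using U.weighted_mean_sq_le[of "\<lambda>_. 1" "\<lambda>x. \<bar>h x\<bar>"] by (simp add: U.prob_space)
qed

text \<open>
  The exponential function is Lipschitz on \<open>[-B, B]\<close>. The normalising constants differ by at most a multiple of
  the \<open>L\<^sup>1\<close> norm of the difference of the series, which is dominated by its \<open>L\<^sup>2\<close> norm; that one is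
  given by Parseval.
\<close>

lemma sqdist_dens_le:
  assumes s: "summable (\<lambda>j. \<bar>\<theta> (Suc j)\<bar>)" "summable (\<lambda>j. \<bar>\<eta> (Suc j)\<bar>)"
    and b: "\<And>x. \<bar>log_series \<theta> x\<bar> \<le> B" "\<And>x. \<bar>log_series \<eta> x\<bar> \<le> B" and B: "0 \<le> B"
  shows "sqdist lebesgue01 (dens \<theta>) (dens \<eta>) \<le> 4 * exp (8 * B) * coef_norm (\<lambda>j. \<theta> j - \<eta> j)"
proof -
  let ?g = "log_series \<theta>" and ?h = "log_series \<eta>"
  let ?d = "log_series (\<lambda>j. \<theta> j - \<eta> j)"
  let ?I = "\<integral>x. \<bar>?d x\<bar> \<partial>lebesgue01"
  have d: "?g x - ?h x = ?d x" for x by (rule log_series_diff[OF s])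
  have sd: "summable (\<lambda>j. \<bar>\<theta> (Suc j) - \<eta> (Suc j)\<bar>)" by (rule summable_abs_diff[OF s])
  have dB: "\<bar>?d x\<bar> \<le> 2 * B" for x using b[of x] d[of x] by linarith
  have dm: "?d \<in> borel_measurable lebesgue01" by (intro borel_measurable_lebesgue01) measurable
  have id: "integrable lebesgue01 (\<lambda>x. \<bar>?d x\<bar>)"
    using dm dB by (intro integrable_lebesgue01[where K = "2 * B"]) auto
  have id2: "integrable lebesgue01 (\<lambda>x. (?d x)\<^sup>2)"
    using dm power_mono[OF dB abs_ge_zero, of _ 2]
    by (intro integrable_lebesgue01[where K = "(2 * B)\<^sup>2"]) auto
  have expd: "\<bar>exp (?g x) - exp (?h x)\<bar> \<le> exp B * \<bar>?d x\<bar>" for x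
    using abs_exp_diff_le[OF b(1)[of x] b(2)[of x]] d[of x] by simp
  have I0: "0 \<le> ?I" by simp
  have Zd: "\<bar>normaliser \<theta> - normaliser \<eta>\<bar> \<le> exp B * ?I"
  proof -
    have "normaliser \<theta> - normaliser \<eta> = (\<integral>x. exp (?g x) - exp (?h x) \<partial>lebesgue01)"
      unfolding normaliser_def using integrable_exp_log_series[OF b(1)] integrable_exp_log_series[OF b(2)] by simp
    also have "\<bar>\<dots>\<bar> \<le> (\<integral>x. \<bar>exp (?g x) - exp (?h x)\<bar> \<partial>lebesgue01)" by (rule integral_abs_bound)
    also have "\<dots> \<le> (\<integral>x. exp B * \<bar>?d x\<bar> \<partial>lebesgue01)"
      using integrable_exp_log_series[OF b(1)] integrable_exp_log_series[OF b(2)] id expd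
      by (intro integral_mono) auto
    finally show ?thesis by simp
  qed
  note Z = normaliser_bounds[OF b(1)] and W = normaliser_bounds[OF b(2)]
  have point: "\<bar>dens \<theta> x - dens \<eta> x\<bar> \<le> exp (4 * B) * (\<bar>?d x\<bar> + ?I)" for x
  proof -
    have h: "exp (?h x) \<le> exp B" using b(2)[of x] by (simp add: abs_le_iff)
    have e: "dens \<theta> x - dens \<eta> x = (exp (?g x) - exp (?h x)) / normaliser \<theta>
        + exp (?h x) * (normaliser \<eta> - normaliser \<theta>) / (normaliser \<theta> * normaliser \<eta>)"
      using Z(3) W(3) by (simp add: dens_eq field_simps)
    have "\<bar>(exp (?g x) - exp (?h x)) / normaliser \<theta>\<bar> \<le> exp B * \<bar>?d x\<bar> / exp (- B)"
      using expd[of x] Z by (auto simp: abs_divide intro!: frac_le)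
    also have "\<dots> = exp (2 * B) * \<bar>?d x\<bar>" by (simp add: exp_minus field_simps flip: exp_add)
    also have "\<dots> \<le> exp (4 * B) * \<bar>?d x\<bar>" using B by (intro mult_right_mono) auto
    finally have 1: "\<bar>(exp (?g x) - exp (?h x)) / normaliser \<theta>\<bar> \<le> exp (4 * B) * \<bar>?d x\<bar>" .
    have "\<bar>exp (?h x) * (normaliser \<eta> - normaliser \<theta>) / (normaliser \<theta> * normaliser \<eta>)\<bar>
        \<le> exp B * (exp B * ?I) / (exp (- B) * exp (- B))"
      unfolding abs_divide abs_mult using Zd Z W h I0
      by (intro frac_le mult_mono) (auto simp: abs_minus_commute)
    also have "\<dots> = exp (4 * B) * ?I" by (simp add: exp_minus field_simps flip: exp_add)
    finally show ?thesis unfolding e using 1 by (auto simp: algebra_simps intro: order_trans[OF abs_triangle_ineq])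
  qed
  have "sqdist lebesgue01 (dens \<theta>) (dens \<eta>) \<le> (\<integral>x. 2 * exp (8 * B) * (?d x)\<^sup>2 + 2 * exp (8 * B) * ?I\<^sup>2 \<partial>lebesgue01)"
    unfolding sqdist_def
  proof (rule integral_mono)
    have "\<bar>(dens \<theta> x - dens \<eta> x)\<^sup>2\<bar> \<le> (2 * exp (2 * B))\<^sup>2" for x
      using dens_bounds[OF b(1), of x] dens_bounds[OF b(2), of x]
        power_mono[of "\<bar>dens \<theta> x - dens \<eta> x\<bar>" "2 * exp (2 * B)" 2] by (simp add: abs_le_iff)
    then show "integrable lebesgue01 (\<lambda>x. (dens \<theta> x - dens \<eta> x)\<^sup>2)"
      using dens_measurable by (intro integrable_lebesgue01 borel_measurable_lebesgue01) auto
    show "integrable lebesgue01 (\<lambda>x. 2 * exp (8 * B) * (?d x)\<^sup>2 + 2 * exp (8 * B) * ?I\<^sup>2)"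
      using id2 by simp
    fix x
    have "(dens \<theta> x - dens \<eta> x)\<^sup>2 \<le> (exp (4 * B) * (\<bar>?d x\<bar> + ?I))\<^sup>2"
      using power_mono[OF point abs_ge_zero, of x 2] by simp
    also have "\<dots> = exp (8 * B) * (\<bar>?d x\<bar> + ?I)\<^sup>2"
      by (simp add: power_mult_distrib flip: exp_double)
    also have "\<dots> \<le> exp (8 * B) * (2 * (?d x)\<^sup>2 + 2 * ?I\<^sup>2)"
    proof (intro mult_left_mono)
      have "0 \<le> (\<bar>?d x\<bar> - ?I)\<^sup>2" by simp
      then show "(\<bar>?d x\<bar> + ?I)\<^sup>2 \<le> 2 * (?d x)\<^sup>2 + 2 * ?I\<^sup>2" by (simp add: power2_diff power2_sum)
    qed simp
    finally show "(dens \<theta> x - dens \<eta> x)\<^sup>2 \<le> 2 * exp (8 * B) * (?d x)\<^sup>2 + 2 * exp (8 * B) * ?I\<^sup>2"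
      by (simp add: algebra_simps)
  qed
  also have "\<dots> = 2 * exp (8 * B) * (\<integral>x. (?d x)\<^sup>2 \<partial>lebesgue01) + 2 * exp (8 * B) * ?I\<^sup>2"
    using id2 by (simp add: U.prob_space)
  also have "\<dots> \<le> 2 * exp (8 * B) * (\<integral>x. (?d x)\<^sup>2 \<partial>lebesgue01) + 2 * exp (8 * B) * (\<integral>x. (?d x)\<^sup>2 \<partial>lebesgue01)"
    by (intro add_left_mono mult_left_mono integral_abs_sq_le[OF dm dB]) auto
  also have "\<dots> = 4 * exp (8 * B) * coef_norm (\<lambda>j. \<theta> j - \<eta> j)"
    using parseval_log_series(2)[of "\<lambda>j. \<theta> j - \<eta> j"] sd by simp
  finally show ?thesis .
qed

text \<open>
  The logarithm of the density is the series minus the logarithm of the normalising constant, and constants are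
  orthogonal to \<open>trig j\<close> for \<open>j \<noteq> 0\<close>.
\<close>

lemma log_dens_coefficient:
  assumes J: "finite J" "0 \<notin> J" and \<theta>: "\<And>j. j \<notin> J \<Longrightarrow> \<theta> j = 0" and j: "j \<noteq> 0"
    and b: "\<And>x. \<bar>log_series \<theta> x\<bar> \<le> B"
  shows "(\<integral>x. ln (dens \<theta> x) * trig j x \<partial>lebesgue01) = \<theta> j"
proof -
  have ls: "log_series \<theta> x = (\<Sum>i\<in>J. \<theta> i * trig i x)" for x
  proof -
    have "log_series \<theta> x = (\<Sum>i\<in>{i. Suc i \<in> J}. \<theta> (Suc i) * trig (Suc i) x)"
      unfolding log_series_def
      by (intro suminf_finite) (use J(1) \<theta> in \<open>auto intro: finite_vimageI[of J Suc, unfolded vimage_def]\<close>)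
    also have "\<dots> = (\<Sum>i\<in>J. \<theta> i * trig i x)"
      using J(2) by (intro sum.reindex_bij_betw[of Suc])
        (auto simp: bij_betw_def image_iff, metis not0_implies_Suc)
    finally show ?thesis .
  qed
  have it: "integrable lebesgue01 (trig j)" for j
    using integrable_trig_mult[of j 0] by (simp add: trig_0)
  have "ln (dens \<theta> x) = log_series \<theta> x - ln (normaliser \<theta>)" for x
    using normaliser_bounds(3)[OF b] by (simp add: dens_eq ln_div)
  then have "(\<integral>x. ln (dens \<theta> x) * trig j x \<partial>lebesgue01)
      = (\<integral>x. (\<Sum>i\<in>J. \<theta> i * (trig i x * trig j x)) - ln (normaliser \<theta>) * (trig 0 x * trig j x) \<partial>lebesgue01)"
    by (simp add: ls left_diff_distrib sum_distrib_right trig_0 mult.assoc)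
  also have "\<dots> = (\<Sum>i\<in>J. \<theta> i * (\<integral>x. trig i x * trig j x \<partial>lebesgue01))
      - ln (normaliser \<theta>) * (\<integral>x. trig 0 x * trig j x \<partial>lebesgue01)"
    using integrable_trig_mult by simp
  also have "\<dots> = (\<Sum>i\<in>J. if i = j then \<theta> i else 0)"
    using j by (auto intro!: sum.cong simp: trig_orthonormal)
  also have "\<dots> = \<theta> j" using J(1) \<theta>[of j] by (simp add: sum.delta)
  finally show ?thesis .
qed

section \<open>Covering the Sobolev ellipsoid\<close>

text \<open>
  A single term of the exponential series. It replaces Stirling's formula for the products of \<open>real j / real k\<close>
  over \<open>1 \<le> j \<le> k\<close> that occur in the count of grid points and in the prior mass.
\<close>

lemma pow_self_le_exp_fact: "real k ^ k \<le> exp (real k) * fact k"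
proof -
  have "(\<Sum>n\<in>{k}. real k ^ n /\<^sub>R fact n) \<le> (\<Sum>n. real k ^ n /\<^sub>R fact n)"
    by (intro sum_le_suminf summable_exp_generic) auto
  then have "real k ^ k / fact k \<le> exp (real k)"
    by (simp add: exp_def divide_inverse mult.commute)
  then show ?thesis by (simp add: divide_le_eq)
qed

lemma sum_exp_abs_int_le:
  fixes s :: real
  assumes s: "0 < s"
  shows "(\<Sum>z\<in>{- int n..int n}. exp (- (s * \<bar>of_int z\<bar>))) \<le> 1 + 2 / s"
proof -
  \<comment> \<open>The subtracted term makes the bound inductive: it telescopes because \<open>1 + s \<le> exp s\<close>.\<close>
  have "(\<Sum>z\<in>{- int n..int n}. exp (- (s * \<bar>of_int z\<bar>))) \<le> 1 + 2 / s * (1 - exp (- (s * real n)))"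
  proof (induction n)
    case 0 then show ?case by simp
  next
    case (Suc n)
    have "{- int (Suc n)..int (Suc n)} = insert (- int (Suc n)) (insert (int (Suc n)) {- int n..int n})"
      by auto
    then have "(\<Sum>z\<in>{- int (Suc n)..int (Suc n)}. exp (- (s * \<bar>of_int z\<bar>)))
        = 2 * exp (- (s * real (Suc n))) + (\<Sum>z\<in>{- int n..int n}. exp (- (s * \<bar>of_int z\<bar>)))"
      by simp
    moreover have "exp (- (s * real (Suc n))) \<le> (exp (- (s * real n)) - exp (- (s * real (Suc n)))) / s"
    proof -
      have "exp (- (s * real n)) = exp (- (s * real (Suc n))) * exp s"
        by (simp add: algebra_simps flip: exp_add)
      moreover have "exp (- (s * real (Suc n))) * (1 + s) \<le> exp (- (s * real (Suc n))) * exp s"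
        by (intro mult_left_mono exp_ge_add_one_self) auto
      ultimately have "exp (- (s * real (Suc n))) * s \<le> exp (- (s * real n)) - exp (- (s * real (Suc n)))"
        by (simp add: algebra_simps)
      then show ?thesis using s by (simp add: le_divide_eq)
    qed
    ultimately have "(\<Sum>z\<in>{- int (Suc n)..int (Suc n)}. exp (- (s * \<bar>of_int z\<bar>)))
        \<le> 2 * ((exp (- (s * real n)) - exp (- (s * real (Suc n)))) / s) + (1 + 2 / s * (1 - exp (- (s * real n))))"
      using Suc by linarith
    also have "\<dots> = 1 + 2 / s * (1 - exp (- (s * real (Suc n))))"
      using s by (simp add: field_simps)
    finally show ?case .
  qed
  also have "\<dots> \<le> 1 + 2 / s * 1" using s by (intro add_left_mono mult_left_mono) auto
  finally show ?thesis by simp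
qed

text \<open>
  Since \<open>w\<^sup>2 * z\<^sup>2 + 1 \<ge> 2 * w * \<bar>z\<bar>\<close>, the Gaussian sum is dominated by a geometric one.
\<close>

lemma sum_exp_sq_int_le:
  fixes w :: real
  assumes w: "0 < w"
  shows "(\<Sum>z\<in>{- int n..int n}. exp (- (w\<^sup>2 * (of_int z)\<^sup>2))) \<le> exp 1 * (1 + 1 / w)"
proof -
  have "exp (- (w\<^sup>2 * (of_int z)\<^sup>2)) \<le> exp 1 * exp (- ((2 * w) * \<bar>of_int z\<bar>))" for z :: int
  proof -
    have "0 \<le> (w * \<bar>of_int z\<bar> - 1)\<^sup>2" by simp
    then have "- (w\<^sup>2 * (of_int z)\<^sup>2) \<le> 1 + - ((2 * w) * \<bar>of_int z\<bar>)"
      by (simp add: power2_diff power_mult_distrib)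
    then show ?thesis by (simp only: exp_add[symmetric] exp_le_cancel_iff)
  qed
  then have "(\<Sum>z\<in>{- int n..int n}. exp (- (w\<^sup>2 * (of_int z)\<^sup>2)))
      \<le> exp 1 * (\<Sum>z\<in>{- int n..int n}. exp (- ((2 * w) * \<bar>of_int z\<bar>)))"
    unfolding sum_distrib_left by (rule sum_mono)
  also have "\<dots> \<le> exp 1 * (1 + 2 / (2 * w))"
    using w by (intro mult_left_mono sum_exp_abs_int_le) auto
  finally show ?thesis by simp
qed

lemma vseq_ge: "real j \<le> vseq j" and vseq_le: "vseq j \<le> real j + 1"
  by (auto simp: vseq_def)

lemma vseq_power_le:
  assumes "j \<in> {1..k}" shows "vseq j ^ (2 * p) \<le> 4 ^ p * real k ^ (2 * p)"
proof -
  have "vseq j \<le> 2 * real k" "0 \<le> vseq j" using assms vseq_le[of j] vseq_ge[of j] by auto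
  then have "vseq j ^ (2 * p) \<le> (2 * real k) ^ (2 * p)" by (intro power_mono)
  also have "\<dots> = 4 ^ p * real k ^ (2 * p)" by (simp add: power_mult_distrib power_mult)
  finally show ?thesis .
qed

text \<open>
  The integer coordinates of the points \<open>\<delta> * z\<close> of the grid of spacing \<open>\<delta> = 1 / sqrt (k ^ (2 * p + 1))\<close>
  that lie in the ellipsoid, in the coordinates \<open>1, \<dots>, k\<close>.
\<close>

definition lattice_points :: "nat \<Rightarrow> real \<Rightarrow> nat \<Rightarrow> (nat \<Rightarrow> int) set" where
  "lattice_points p Q k =
     {z \<in> extensional {1..k}. (\<Sum>j\<in>{1..k}. (vseq j / real k) ^ (2 * p) * (of_int (z j))\<^sup>2) \<le> Q * real k}"

lemma lattice_points_bounded: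
  assumes k: "1 \<le> k" and Q: "0 < Q"
  shows "\<exists>n. lattice_points p Q k \<subseteq> (\<Pi>\<^sub>E j\<in>{1..k}. {- int n..int n})"
proof -
  define n where "n = nat \<lceil>Q * real k * real k ^ (2 * p)\<rceil>"
  have "z j \<in> {- int n..int n}" if z: "z \<in> lattice_points p Q k" and j: "j \<in> {1..k}" for z j
  proof -
    have w: "1 / real k ^ (2 * p) \<le> (vseq j / real k) ^ (2 * p)"
    proof -
      have "1 \<le> vseq j ^ (2 * p)" using j vseq_ge[of j] by (intro one_le_power) auto
      then show ?thesis by (simp add: power_divide divide_right_mono)
    qed
    have "(of_int (z j))\<^sup>2 / real k ^ (2 * p) = 1 / real k ^ (2 * p) * (of_int (z j))\<^sup>2" by simp
    also have "\<dots> \<le> (vseq j / real k) ^ (2 * p) * (of_int (z j))\<^sup>2"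
      by (intro mult_right_mono w) auto
    also have "\<dots> \<le> (\<Sum>j\<in>{1..k}. (vseq j / real k) ^ (2 * p) * (of_int (z j))\<^sup>2)"
      using j by (intro member_le_sum) (auto intro!: mult_nonneg_nonneg zero_le_power divide_nonneg_nonneg simp: vseq_def)
    also have "\<dots> \<le> Q * real k" using z by (simp add: lattice_points_def)
    finally have "(of_int (z j))\<^sup>2 \<le> Q * real k * real k ^ (2 * p)"
      using k by (simp add: divide_le_eq)
    then have "of_int ((z j)\<^sup>2) \<le> Q * real k * real k ^ (2 * p)" by simp
    then have "(z j)\<^sup>2 \<le> int n" unfolding n_def by linarith
    moreover have "\<bar>z j\<bar> \<le> (z j)\<^sup>2"
    proof (cases "z j = 0")
      case False
      then have "\<bar>z j\<bar> * 1 \<le> \<bar>z j\<bar> * \<bar>z j\<bar>" by (intro mult_left_mono) auto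
      then show ?thesis by (simp add: power2_eq_square)
    qed simp
    ultimately show ?thesis by auto
  qed
  then have "lattice_points p Q k \<subseteq> (\<Pi>\<^sub>E j\<in>{1..k}. {- int n..int n})"
    by (auto simp: PiE_def lattice_points_def)
  then show ?thesis ..
qed

text \<open>
  Counting by an exponential Markov inequality: each point contributes at least one to the sum of
  \<open>exp (Q * k - (\<Sum>j. (w j)\<^sup>2 * (z j)\<^sup>2))\<close>, which factorises over the coordinates. The factor for
  coordinate \<open>j\<close> is of order \<open>(k / j) ^ p\<close>, and the product of these is \<open>(k ^ k / fact k) ^ p\<close>.
  Counting the points of the enclosing box instead would lose a factor \<open>log k\<close> in the exponent and thereby the
  sharp rate.
\<close>

lemma card_lattice_points:
  assumes k: "1 \<le> k" and Q: "0 < Q"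
  shows "finite (lattice_points p Q k)"
    "real (card (lattice_points p Q k)) \<le> exp ((Q + 1 + ln (2 ^ p + 1) + real p) * real k)"
proof -
  let ?L = "lattice_points p Q k"
  obtain n where n: "?L \<subseteq> (\<Pi>\<^sub>E j\<in>{1..k}. {- int n..int n})" (is "_ \<subseteq> ?P")
    using lattice_points_bounded[OF assms] by blast
  have fP: "finite ?P" by (intro finite_PiE) auto
  show fin: "finite ?L" using n fP by (rule finite_subset)
  define w where "w j = (vseq j / real k) ^ p" for j
  have w2: "(w j)\<^sup>2 = (vseq j / real k) ^ (2 * p)" for j
    by (simp only: w_def power_mult[symmetric] mult.commute[of p])
  have w0: "0 < w j" if "j \<in> {1..k}" for j
    using that k vseq_pos[of j] by (auto simp: w_def)
  have kk: "real k > 0" using k by simp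
  have factor: "exp 1 * (1 + 1 / w j) \<le> exp 1 * (2 ^ p + 1) * (real k / real j) ^ p" if j: "j \<in> {1..k}" for j
  proof -
    have vj: "0 < vseq j" "real j \<le> vseq j" "vseq j \<le> 2 * real k"
      using vseq_pos[of j] j k vseq_ge[of j] vseq_le[of j] by auto
    have "1 / w j = (real k / vseq j) ^ p" by (simp add: w_def power_divide)
    also have "\<dots> \<le> (real k / real j) ^ p"
      using vj j kk by (intro power_mono divide_left_mono) auto
    finally have 1: "1 / w j \<le> (real k / real j) ^ p" .
    have "1 / 2 ^ p \<le> (real k / real j) ^ p"
    proof -
      have "1 \<le> (real k / real j) ^ p" using j by (intro one_le_power) auto
      moreover have "1 / 2 ^ p \<le> (1::real)" by (simp add: divide_le_eq)
      ultimately show ?thesis by linarith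
    qed
    then have "1 \<le> 2 ^ p * (real k / real j) ^ p" by (simp add: divide_le_eq mult.commute)
    with 1 have "1 + 1 / w j \<le> (2 ^ p + 1) * (real k / real j) ^ p" by (simp add: algebra_simps)
    then show ?thesis by (simp add: mult.assoc)
  qed
  have "real (card ?L) = (\<Sum>z\<in>?L. 1)" by simp
  also have "\<dots> \<le> (\<Sum>z\<in>?L. exp (Q * real k) * (\<Prod>j\<in>{1..k}. exp (- ((w j)\<^sup>2 * (of_int (z j))\<^sup>2))))"
  proof (rule sum_mono)
    fix z assume "z \<in> ?L"
    then have "(\<Sum>j\<in>{1..k}. (w j)\<^sup>2 * (of_int (z j))\<^sup>2) \<le> Q * real k"
      by (simp add: lattice_points_def w2)
    then have "0 \<le> Q * real k + (\<Sum>j\<in>{1..k}. - ((w j)\<^sup>2 * (of_int (z j))\<^sup>2))"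
      by (simp add: sum_negf)
    then have "exp 0 \<le> exp (Q * real k + (\<Sum>j\<in>{1..k}. - ((w j)\<^sup>2 * (of_int (z j))\<^sup>2)))"
      by (simp only: exp_le_cancel_iff)
    then show "1 \<le> exp (Q * real k) * (\<Prod>j\<in>{1..k}. exp (- ((w j)\<^sup>2 * (of_int (z j))\<^sup>2)))"
      by (simp only: exp_add exp_sum[OF finite_atLeastAtMost] exp_zero)
  qed
  also have "\<dots> \<le> (\<Sum>z\<in>?P. exp (Q * real k) * (\<Prod>j\<in>{1..k}. exp (- ((w j)\<^sup>2 * (of_int (z j))\<^sup>2))))"
    using n fP by (intro sum_mono2) (auto intro!: mult_nonneg_nonneg prod_nonneg)
  also have "\<dots> = exp (Q * real k) * (\<Prod>j\<in>{1..k}. \<Sum>i\<in>{- int n..int n}. exp (- ((w j)\<^sup>2 * (of_int i)\<^sup>2)))"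
    by (subst prod_sum_PiE) (auto simp: sum_distrib_left)
  also have "\<dots> \<le> exp (Q * real k) * (\<Prod>j\<in>{1..k}. exp 1 * (2 ^ p + 1) * (real k / real j) ^ p)"
    by (intro mult_left_mono prod_mono conjI sum_nonneg order_trans[OF sum_exp_sq_int_le factor] w0) auto
  also have "(\<Prod>j\<in>{1..k}. exp 1 * (2 ^ p + 1) * (real k / real j) ^ p)
      = (exp 1 * (2 ^ p + 1)) ^ k * (real k ^ k / fact k) ^ p"
  proof -
    have "(\<Prod>j\<in>{1..k}. exp 1 * (2 ^ p + 1) * (real k / real j) ^ p)
        = (exp 1 * (2 ^ p + 1)) ^ k * (\<Prod>j\<in>{1..k}. real k / real j) ^ p"
      by (simp add: prod.distrib prod_power_distrib)
    also have "(\<Prod>j\<in>{1..k}. real k / real j) = real k ^ k / fact k"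
      by (simp add: prod_dividef fact_prod)
    finally show ?thesis .
  qed
  also have "exp (Q * real k) * ((exp 1 * (2 ^ p + 1)) ^ k * (real k ^ k / fact k) ^ p)
      \<le> exp (Q * real k) * ((exp 1 * (2 ^ p + 1)) ^ k * exp (real k) ^ p)"
    using pow_self_le_exp_fact[of k]
    by (intro mult_left_mono power_mono) (auto simp: divide_le_eq)
  also have "\<dots> = exp ((Q + 1 + ln (2 ^ p + 1) + real p) * real k)"
  proof -
    have "(2::real) ^ p + 1 = exp (ln (2 ^ p + 1))" by (simp add: add_pos_pos)
    then have "exp 1 * ((2::real) ^ p + 1) = exp (1 + ln (2 ^ p + 1))" by (metis exp_add)
    then have "(exp 1 * ((2::real) ^ p + 1)) ^ k = exp (real k * (1 + ln (2 ^ p + 1)))"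
      by (simp add: exp_of_nat_mult)
    moreover have "exp (real k) ^ p = exp (real p * real k)" by (simp add: exp_of_nat_mult)
    ultimately show ?thesis by (simp add: algebra_simps flip: exp_add)
  qed
  finally show "real (card ?L) \<le> exp ((Q + 1 + ln (2 ^ p + 1) + real p) * real k)" .
qed

lemma ellipsoid_finite_support:
  assumes "p \<ge> 1" "\<And>j. j > k \<Longrightarrow> \<theta> j = 0"
  shows "\<theta> \<in> ellipsoid p R \<longleftrightarrow> (\<Sum>j\<in>{1..k}. vseq j ^ (2 * p) * (\<theta> j)\<^sup>2) < R"
proof -
  have "(\<Sum>j. vseq j ^ (2 * p) * (\<theta> j)\<^sup>2) = (\<Sum>j\<in>{1..k}. vseq j ^ (2 * p) * (\<theta> j)\<^sup>2)"
  proof (rule suminf_finite)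
    fix j assume "j \<notin> {1..k}"
    then have "j = 0 \<or> j > k" by auto
    then show "vseq j ^ (2 * p) * (\<theta> j)\<^sup>2 = 0" using assms by (auto simp: vseq_def)
  qed simp
  moreover have "summable (\<lambda>j. vseq j ^ (2 * p) * (\<theta> j)\<^sup>2)" "summable (\<lambda>j. (\<theta> j)\<^sup>2)"
    using assms(2) by (intro summable_finite[of "{..k}"]; simp)+
  ultimately show ?thesis by (simp add: ellipsoid_def)
qed

lemma ellipsoidD:
  assumes "\<theta> \<in> ellipsoid p R"
  shows "summable (\<lambda>j. vseq (Suc j) ^ (2 * p) * (\<theta> (Suc j))\<^sup>2)"
    "(\<Sum>j. vseq (Suc j) ^ (2 * p) * (\<theta> (Suc j))\<^sup>2) < R"
    "finite J \<Longrightarrow> (\<Sum>j\<in>J. vseq j ^ (2 * p) * (\<theta> j)\<^sup>2) < R"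
proof -
  let ?e = "\<lambda>j. vseq j ^ (2 * p) * (\<theta> j)\<^sup>2"
  have S: "summable ?e" "(\<Sum>j. ?e j) < R" using assms by (auto simp: ellipsoid_def)
  have e0: "0 \<le> ?e j" for j by (intro mult_nonneg_nonneg) (auto simp: vseq_def)
  show "summable (\<lambda>j. ?e (Suc j))" using S(1) by (subst summable_Suc_iff)
  show "(\<Sum>j. ?e (Suc j)) < R" using suminf_split_head[OF S(1)] S(2) e0[of 0] by linarith
  show "(\<Sum>j\<in>J. ?e j) < R" if "finite J"
    using sum_le_suminf[OF S(1) that] e0 S(2) by force
qed

text \<open>
  Beyond \<open>k\<close> the coefficients of a point of the ellipsoid are negligible, as \<open>vseq j / k\<close> is at least
  \<open>1\<close> there.
\<close>

lemma coef_norm_le: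
  assumes \<theta>: "\<theta> \<in> ellipsoid p Q" and k: "1 \<le> k"
    and near: "\<And>j. j \<in> {1..k} \<Longrightarrow> \<bar>\<theta> j - \<eta> j\<bar> \<le> \<delta>" and tail: "\<And>j. j > k \<Longrightarrow> \<eta> j = 0"
  shows "coef_norm (\<lambda>j. \<theta> j - \<eta> j) \<le> real k * \<delta>\<^sup>2 + Q / real k ^ (2 * p)"
proof -
  let ?e = "\<lambda>j. vseq (Suc j) ^ (2 * p) * (\<theta> (Suc j))\<^sup>2"
  let ?u = "\<lambda>j. (if j < k then \<delta>\<^sup>2 else 0) + ?e j / real k ^ (2 * p)"
  have kk: "0 < real k" using k by simp
  have point: "(\<theta> (Suc j) - \<eta> (Suc j))\<^sup>2 \<le> ?u j" for j
  proof (cases "j < k")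
    case True
    then have "\<bar>\<theta> (Suc j) - \<eta> (Suc j)\<bar> \<le> \<delta>" by (intro near) auto
    from power_mono[OF this abs_ge_zero, of 2] have "(\<theta> (Suc j) - \<eta> (Suc j))\<^sup>2 \<le> \<delta>\<^sup>2" by simp
    moreover have "0 \<le> ?e j / real k ^ (2 * p)"
      by (intro divide_nonneg_nonneg mult_nonneg_nonneg) (auto simp: vseq_def)
    ultimately show ?thesis unfolding if_P[OF True] by linarith
  next
    case False
    then have "real k \<le> vseq (Suc j)" using vseq_ge[of "Suc j"] by simp
    then have "real k ^ (2 * p) \<le> vseq (Suc j) ^ (2 * p)" by (intro power_mono) auto
    then have "(\<theta> (Suc j))\<^sup>2 * real k ^ (2 * p) \<le> (\<theta> (Suc j))\<^sup>2 * vseq (Suc j) ^ (2 * p)"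
      by (intro mult_left_mono) auto
    then show ?thesis using False kk tail[of "Suc j"] by (simp add: le_divide_eq mult.commute)
  qed
  have s1: "(\<lambda>j. if j < k then \<delta>\<^sup>2 else 0) sums (\<Sum>j\<in>{..<k}. \<delta>\<^sup>2)"
    using sums_If_finite_set[of "{..<k}" "\<lambda>_. \<delta>\<^sup>2"] by simp
  have s2: "(\<lambda>j. ?e j / real k ^ (2 * p)) sums ((\<Sum>j. ?e j) / real k ^ (2 * p))"
    by (intro sums_divide summable_sums ellipsoidD(1)[OF \<theta>])
  have s: "?u sums (real k * \<delta>\<^sup>2 + (\<Sum>j. ?e j) / real k ^ (2 * p))"
    using sums_add[OF s1 s2] by simp
  have "coef_norm (\<lambda>j. \<theta> j - \<eta> j) \<le> (\<Sum>j. ?u j)"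
    unfolding coef_norm_def
    using point by (intro suminf_le summable_comparison_test'[OF sums_summable[OF s], of 0] sums_summable[OF s]) auto
  also have "\<dots> = real k * \<delta>\<^sup>2 + (\<Sum>j. ?e j) / real k ^ (2 * p)" using s by (rule sums_unique[symmetric])
  also have "\<dots> \<le> real k * \<delta>\<^sup>2 + Q / real k ^ (2 * p)"
    using ellipsoidD(2)[OF \<theta>] by (intro add_left_mono divide_right_mono) auto
  finally show ?thesis .
qed

text \<open>
  Rounding towards zero: absolute values do not increase, so the rounded sequence stays in the ellipsoid.
\<close>

lemma truncate_to_grid:
  fixes t \<delta> :: real
  assumes \<delta>: "0 < \<delta>"
  shows "\<exists>z::int. \<bar>\<delta> * of_int z\<bar> \<le> \<bar>t\<bar> \<and> \<bar>t - \<delta> * of_int z\<bar> \<le> \<delta>"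
proof -
  have pos: "\<exists>z::int. \<bar>\<delta> * of_int z\<bar> \<le> \<bar>t\<bar> \<and> \<bar>t - \<delta> * of_int z\<bar> \<le> \<delta>" if t: "0 \<le> t" for t
  proof -
    define z where "z = \<lfloor>t / \<delta>\<rfloor>"
    have z: "of_int z \<le> t / \<delta>" "t / \<delta> < of_int z + 1" "0 \<le> z"
      using t \<delta> by (auto simp: z_def)
    then have "\<delta> * of_int z \<le> t" "t < \<delta> * of_int z + \<delta>" "0 \<le> \<delta> * of_int z"
      using \<delta> by (simp_all add: field_simps)
    then show ?thesis by (intro exI[of _ z]) auto
  qed
  show ?thesis
  proof (cases "0 \<le> t")
    case False
    then obtain z :: int where "\<bar>\<delta> * of_int z\<bar> \<le> \<bar>- t\<bar>" "\<bar>- t - \<delta> * of_int z\<bar> \<le> \<delta>"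
      using pos[of "- t"] by auto
    then show ?thesis by (intro exI[of _ "- z"]) auto
  qed (rule pos)
qed

text \<open>
  Centres are obtained by discarding the coordinates after \<open>k\<close> and rounding the others to the grid; both
  errors are of order \<open>1 / k ^ (2 * p)\<close>.
\<close>

theorem ellipsoid_covering:
  assumes p: "p \<ge> 1" and Q: "0 < Q" and k: "1 \<le> k"
  shows "\<exists>C. finite C \<and> C \<subseteq> ellipsoid p Q
    \<and> real (card C) \<le> exp ((Q + 1 + ln (2 ^ p + 1) + real p) * real k)
    \<and> (\<forall>\<theta>\<in>ellipsoid p Q. \<exists>\<eta>\<in>C. coef_norm (\<lambda>j. \<theta> j - \<eta> j) \<le> (1 + Q) / real k ^ (2 * p))"
proof -
  define \<delta> where "\<delta> = 1 / sqrt (real k ^ (2 * p + 1))"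
  have kk: "0 < real k" using k by simp
  have \<delta>: "0 < \<delta>" "\<delta>\<^sup>2 = 1 / real k ^ (2 * p + 1)" using kk by (auto simp: \<delta>_def power_divide)
  let ?L = "lattice_points p Q k"
  define cen where "cen z j = (if j \<in> {1..k} then \<delta> * of_int (z j) else 0)" for z :: "nat \<Rightarrow> int" and j
  define C where "C = cen ` ?L \<inter> ellipsoid p Q"
  note L = card_lattice_points[OF k Q, of p]
  have cov: "\<exists>\<eta>\<in>C. coef_norm (\<lambda>j. \<theta> j - \<eta> j) \<le> (1 + Q) / real k ^ (2 * p)"
    if \<theta>: "\<theta> \<in> ellipsoid p Q" for \<theta>
  proof -
    have "\<forall>j. \<exists>z::int. \<bar>\<delta> * of_int z\<bar> \<le> \<bar>\<theta> j\<bar> \<and> \<bar>\<theta> j - \<delta> * of_int z\<bar> \<le> \<delta>"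
      using truncate_to_grid[OF \<delta>(1)] by blast
    then obtain z0 :: "nat \<Rightarrow> int" where z0: "\<And>j. \<bar>\<delta> * of_int (z0 j)\<bar> \<le> \<bar>\<theta> j\<bar>" "\<And>j. \<bar>\<theta> j - \<delta> * of_int (z0 j)\<bar> \<le> \<delta>"
      by metis
    define z where "z = restrict z0 {1..k}"
    have cz: "cen z j = \<delta> * of_int (z0 j)" if "j \<in> {1..k}" for j using that by (simp add: cen_def z_def)
    have sum: "(\<Sum>j\<in>{1..k}. vseq j ^ (2 * p) * (cen z j)\<^sup>2) < Q"
    proof -
      have "(\<Sum>j\<in>{1..k}. vseq j ^ (2 * p) * (cen z j)\<^sup>2) \<le> (\<Sum>j\<in>{1..k}. vseq j ^ (2 * p) * (\<theta> j)\<^sup>2)"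
      proof (intro sum_mono mult_left_mono)
        fix j assume j: "j \<in> {1..k}"
        show "(cen z j)\<^sup>2 \<le> (\<theta> j)\<^sup>2" unfolding cz[OF j] using z0(1)[of j] by (simp only: abs_le_square_iff)
      qed (auto simp: vseq_def)
      also have "\<dots> < Q" by (rule ellipsoidD(3)[OF \<theta>]) simp
      finally show ?thesis .
    qed
    then have cE: "cen z \<in> ellipsoid p Q"
      by (subst ellipsoid_finite_support[OF p, of k]) (auto simp: cen_def)
    have zL: "z \<in> ?L"
    proof -
      have "(vseq j / real k) ^ (2 * p) * (of_int (z j))\<^sup>2 = vseq j ^ (2 * p) * (cen z j)\<^sup>2 * real k"
        if j: "j \<in> {1..k}" for j
      proof -
        have "(cen z j)\<^sup>2 = \<delta>\<^sup>2 * (of_int (z j))\<^sup>2" using j by (simp add: cen_def power_mult_distrib)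
        then show ?thesis unfolding \<delta>(2) using kk by (simp add: power_divide)
      qed
      then have "(\<Sum>j\<in>{1..k}. (vseq j / real k) ^ (2 * p) * (of_int (z j))\<^sup>2)
          = (\<Sum>j\<in>{1..k}. vseq j ^ (2 * p) * (cen z j)\<^sup>2) * real k"
        by (simp add: sum_distrib_right)
      also have "\<dots> \<le> Q * real k" using sum by (intro mult_right_mono) auto
      finally show ?thesis by (simp add: lattice_points_def z_def)
    qed
    have "coef_norm (\<lambda>j. \<theta> j - cen z j) \<le> real k * \<delta>\<^sup>2 + Q / real k ^ (2 * p)"
    proof (rule coef_norm_le[OF \<theta> k])
      show "\<bar>\<theta> j - cen z j\<bar> \<le> \<delta>" if "j \<in> {1..k}" for j
        unfolding cz[OF that] by (rule z0(2))
    qed (auto simp: cen_def)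
    also have "\<dots> = (1 + Q) / real k ^ (2 * p)" using kk by (simp add: \<delta>(2) add_divide_distrib)
    finally show ?thesis using cE zL by (auto simp: C_def)
  qed
  have "card C \<le> card (cen ` ?L)" using L(1) by (intro card_mono) (auto simp: C_def)
  also have "\<dots> \<le> card ?L" by (rule card_image_le[OF L(1)])
  finally have "real (card C) \<le> exp ((Q + 1 + ln (2 ^ p + 1) + real p) * real k)"
    using L(2) by linarith
  then show ?thesis using cov L(1) by (intro exI[of _ C]) (auto simp: C_def)
qed

abbreviation coef_ball :: "nat \<Rightarrow> real \<Rightarrow> (nat \<Rightarrow> real) \<Rightarrow> real \<Rightarrow> (nat \<Rightarrow> real) set" where
  "coef_ball p Q \<theta>\<^sub>0 r \<equiv> {\<theta> \<in> ellipsoid p Q. coef_norm (\<lambda>j. \<theta>\<^sub>0 j - \<theta> j) \<le> r}"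

section \<open>Prior mass around a truth in the smaller ellipsoid\<close>

lemma coord_prior_interval_ge:
  assumes j: "1 \<le> j" "j \<le> k" and \<delta>: "0 \<le> \<delta>"
  shows "ennreal (\<delta> / 2 * sqrt (vseq j ^ (2 * p + 1)) * exp (- (vseq j ^ (2 * p + 1) * (\<bar>t\<bar> + \<delta>)\<^sup>2 / 2)))
    \<le> emeasure (coord_prior p k j) {t - \<delta>..t + \<delta>}"
proof -
  let ?V = "vseq j ^ (2 * p + 1)"
  let ?c = "sqrt ?V / 4 * exp (- (?V * (\<bar>t\<bar> + \<delta>)\<^sup>2 / 2))"
  have V: "0 < ?V" using vseq_pos[OF j(1)] by simp
  have low: "?c \<le> normal_density 0 (sqrt (1 / ?V)) x" if x: "x \<in> {t - \<delta>..t + \<delta>}" for x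
  proof -
    have "\<bar>x\<bar> \<le> \<bar>t\<bar> + \<delta>" using x by auto
    from power_mono[OF this abs_ge_zero, of 2] have "x\<^sup>2 \<le> (\<bar>t\<bar> + \<delta>)\<^sup>2" by simp
    then have "?V * x\<^sup>2 / 2 \<le> ?V * (\<bar>t\<bar> + \<delta>)\<^sup>2 / 2"
      using V by (intro divide_right_mono mult_left_mono) auto
    then have e: "exp (- (?V * (\<bar>t\<bar> + \<delta>)\<^sup>2 / 2)) \<le> exp (- (?V * x\<^sup>2 / 2))"
      by (simp only: exp_le_cancel_iff neg_le_iff_le)
    have "2 * pi \<le> 4\<^sup>2" using pi_less_4 by simp
    then have "sqrt (2 * pi) \<le> sqrt (4\<^sup>2)" by (rule real_sqrt_le_mono)
    then have "sqrt (2 * pi) \<le> 4" by simp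
    then have "sqrt ?V / 4 \<le> sqrt ?V / sqrt (2 * pi)" using V by (intro divide_left_mono) auto
    with e have "?c \<le> sqrt ?V / sqrt (2 * pi) * exp (- (?V * x\<^sup>2 / 2))"
      using V by (intro mult_mono) auto
    also have "\<dots> = normal_density 0 (sqrt (1 / ?V)) x"
    proof -
      have "sqrt W / sqrt (2 * pi) * exp (- (W * x\<^sup>2 / 2)) = normal_density 0 (sqrt (1 / W)) x"
        if "0 < W" for W
        using that by (simp add: normal_density_def real_sqrt_mult real_sqrt_divide field_simps)
      then show ?thesis using V .
    qed
    finally show ?thesis .
  qed
  have "ennreal (\<delta> / 2 * sqrt ?V * exp (- (?V * (\<bar>t\<bar> + \<delta>)\<^sup>2 / 2))) = ennreal ?c * ennreal (2 * \<delta>)"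
    using V \<delta> by (subst ennreal_mult[symmetric]) (auto simp: field_simps)
  also have "\<dots> = ennreal ?c * emeasure lborel {t - \<delta>..t + \<delta>}"
    using \<delta> by simp
  also have "\<dots> = (\<integral>\<^sup>+x. ennreal ?c * indicator {t - \<delta>..t + \<delta>} x \<partial>lborel)"
    by (rule nn_integral_cmult_indicator[symmetric]) simp
  also have "\<dots> \<le> (\<integral>\<^sup>+x. ennreal (normal_density 0 (sqrt (1 / ?V)) x) * indicator {t - \<delta>..t + \<delta>} x \<partial>lborel)"
    using low by (intro nn_integral_mono) (auto split: split_indicator intro!: ennreal_leI)
  also have "\<dots> = emeasure (coord_prior p k j) {t - \<delta>..t + \<delta>}"
    using j by (simp add: coord_prior_def emeasure_density)
  finally show ?thesis .
qed

definition coef_box :: "nat \<Rightarrow> real \<Rightarrow> (nat \<Rightarrow> real) \<Rightarrow> (nat \<Rightarrow> real) set" where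
  "coef_box k \<delta> \<theta>\<^sub>0 = {\<theta>. (\<forall>j\<in>{1..k}. \<bar>\<theta> j - \<theta>\<^sub>0 j\<bar> \<le> \<delta>) \<and> (\<forall>j. k < j \<longrightarrow> \<theta> j = 0)}"

lemma coef_box_measurable: "coef_box k \<delta> \<theta>\<^sub>0 \<in> sets (\<Pi>\<^sub>M j\<in>UNIV. borel)"
proof -
  have "{\<theta> \<in> space (\<Pi>\<^sub>M j\<in>(UNIV::nat set). (borel :: real measure)).
      (\<forall>j\<in>{1..k}. \<bar>\<theta> j - \<theta>\<^sub>0 j\<bar> \<le> \<delta>) \<and> (\<forall>j. k < j \<longrightarrow> \<theta> j = 0)} \<in> sets (\<Pi>\<^sub>M j\<in>UNIV. borel)"
    by measurable
  then show ?thesis by (simp add: coef_box_def space_PiM)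
qed

text \<open>
  Almost surely all coordinates after \<open>k\<close> vanish, so only finitely many coordinates of the infinite product
  matter.
\<close>

lemma gauss_prior_box:
  "emeasure (gauss_prior p k) (coef_box k \<delta> \<theta>\<^sub>0)
     = (\<Prod>j\<in>{1..k}. emeasure (coord_prior p k j) {\<theta>\<^sub>0 j - \<delta>..\<theta>\<^sub>0 j + \<delta>})"
proof -
  interpret P: product_prob_space "coord_prior p k" UNIV
    by (simp add: product_prob_space_def product_prob_space_axioms_def product_sigma_finite_def
        prob_space_imp_sigma_finite prob_space_coord_prior)
  have sp: "space (coord_prior p k j) = UNIV" for j
    using sets_eq_imp_space_eq[OF sets_coord_prior] by simp
  have zero: "AE \<theta> in gauss_prior p k. \<theta> j = 0" if "k < j" for j
    unfolding gauss_prior_def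
  proof (rule AE_PiM_component)
    have "coord_prior p k j = return borel 0" using that by (simp add: coord_prior_def)
    moreover have "AE x in return borel (0::real). x = 0" by (subst AE_return) auto
    ultimately show "AE x in coord_prior p k j. x = 0" by (simp only:)
  qed (auto simp: prob_space_coord_prior)
  have "AE \<theta> in gauss_prior p k. \<forall>j. k < j \<longrightarrow> \<theta> j = 0"
    using zero by (simp add: AE_all_countable)
  then have "emeasure (gauss_prior p k) (coef_box k \<delta> \<theta>\<^sub>0)
      = emeasure (gauss_prior p k) {\<theta> \<in> space (\<Pi>\<^sub>M j\<in>UNIV. coord_prior p k j). \<forall>j\<in>{1..k}. \<theta> j \<in> {\<theta>\<^sub>0 j - \<delta>..\<theta>\<^sub>0 j + \<delta>}}"
  proof (intro emeasure_eq_AE)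
    show "AE \<theta> in gauss_prior p k. (\<theta> \<in> coef_box k \<delta> \<theta>\<^sub>0)
        = (\<theta> \<in> {\<theta> \<in> space (\<Pi>\<^sub>M j\<in>UNIV. coord_prior p k j). \<forall>j\<in>{1..k}. \<theta> j \<in> {\<theta>\<^sub>0 j - \<delta>..\<theta>\<^sub>0 j + \<delta>}})"
      using \<open>AE \<theta> in gauss_prior p k. \<forall>j. k < j \<longrightarrow> \<theta> j = 0\<close>
      by eventually_elim (auto simp: coef_box_def space_PiM sp abs_le_iff)
    show "coef_box k \<delta> \<theta>\<^sub>0 \<in> sets (gauss_prior p k)"
      by (simp add: sets_gauss_prior coef_box_measurable)
    show "{\<theta> \<in> space (\<Pi>\<^sub>M j\<in>UNIV. coord_prior p k j). \<forall>j\<in>{1..k}. \<theta> j \<in> {\<theta>\<^sub>0 j - \<delta>..\<theta>\<^sub>0 j + \<delta>}}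
        \<in> sets (gauss_prior p k)"
      unfolding gauss_prior_def
      by (intro sets.sets_Collect_finite_All measurable_sets_Collect[OF measurable_component_singleton])
        (auto simp: sets_coord_prior sp)
  qed
  also have "\<dots> = (\<Prod>j\<in>{1..k}. emeasure (coord_prior p k j) {\<theta>\<^sub>0 j - \<delta>..\<theta>\<^sub>0 j + \<delta>})"
    unfolding gauss_prior_def by (rule P.emeasure_PiM_Collect) (auto simp: sets_coord_prior)
  finally show ?thesis .
qed

text \<open>
  The sides \<open>\<delta>\<close> of the box are of order \<open>k powr - (p + 1 / 2)\<close>, the largest possible for a box with equal
  sides around a point of the smaller ellipsoid to stay in the larger one. The constant \<open>s\<close> is chosen such that the box uses a
  quarter of the gap \<open>Q - Q'\<close>, after half of the gap is spent on the factor \<open>1 + e\<close> in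
  \<open>(\<bar>\<theta>\<^sub>0 j\<bar> + \<delta>)\<^sup>2 \<le> (1 + e) * (\<theta>\<^sub>0 j)\<^sup>2 + (1 + 1 / e) * \<delta>\<^sup>2\<close>.
\<close>

lemma box_in_ellipsoid:
  assumes p: "p \<ge> 1" and \<theta>\<^sub>0: "\<theta>\<^sub>0 \<in> ellipsoid p Q'" and Q: "0 < Q'" "Q' < Q" and k: "1 \<le> k"
  defines "s \<equiv> sqrt ((Q - Q') / (4 * 4 ^ p * (1 + 2 * Q' / (Q - Q'))))"
  defines "\<delta> \<equiv> s / sqrt (real k ^ (2 * p + 1))"
  shows "0 < s" "0 < \<delta>" "\<delta>\<^sup>2 = s\<^sup>2 / real k ^ (2 * p + 1)"
    "(\<Sum>j\<in>{1..k}. vseq j ^ (2 * p) * (\<bar>\<theta>\<^sub>0 j\<bar> + \<delta>)\<^sup>2) < Q"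
proof -
  define e where "e = (Q - Q') / (2 * Q')"
  have e: "0 < e" "1 / e = 2 * Q' / (Q - Q')" using Q by (auto simp: e_def)
  have den: "0 < 4 * 4 ^ p * (1 + 1 / e)" using e(1) by (intro mult_pos_pos add_pos_pos) auto
  have s2: "s\<^sup>2 = (Q - Q') / (4 * 4 ^ p * (1 + 1 / e))" unfolding s_def e(2)[symmetric]
    using den Q by (subst real_sqrt_pow2) (auto intro!: divide_nonneg_nonneg simp: less_imp_le)
  show s: "0 < s" unfolding s_def e(2)[symmetric] using den Q by simp
  have kk: "0 < real k" using k by simp
  show \<delta>: "0 < \<delta>" "\<delta>\<^sup>2 = s\<^sup>2 / real k ^ (2 * p + 1)" using s kk by (auto simp: \<delta>_def power_divide)
  have sq: "(\<bar>\<theta>\<^sub>0 j\<bar> + \<delta>)\<^sup>2 \<le> (1 + e) * (\<theta>\<^sub>0 j)\<^sup>2 + (1 + 1 / e) * \<delta>\<^sup>2" for j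
  proof -
    have "0 \<le> (sqrt e * \<bar>\<theta>\<^sub>0 j\<bar> - \<delta> / sqrt e)\<^sup>2" by simp
    also have "\<dots> = e * (\<theta>\<^sub>0 j)\<^sup>2 + \<delta>\<^sup>2 / e - 2 * \<bar>\<theta>\<^sub>0 j\<bar> * \<delta>"
      using e(1) by (simp add: power2_diff power_mult_distrib power_divide)
    finally show ?thesis by (simp add: power2_sum algebra_simps)
  qed
  have vsum: "(\<Sum>j\<in>{1..k}. vseq j ^ (2 * p)) \<le> real k * (4 ^ p * real k ^ (2 * p))"
  proof -
    from sum_mono[of "{1..k}" "\<lambda>j. vseq j ^ (2 * p)" "\<lambda>_. 4 ^ p * real k ^ (2 * p)", OF vseq_power_le] show ?thesis by simp
  qed
  have "(\<Sum>j\<in>{1..k}. vseq j ^ (2 * p) * (\<bar>\<theta>\<^sub>0 j\<bar> + \<delta>)\<^sup>2)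
      \<le> (\<Sum>j\<in>{1..k}. vseq j ^ (2 * p) * ((1 + e) * (\<theta>\<^sub>0 j)\<^sup>2 + (1 + 1 / e) * \<delta>\<^sup>2))"
    using sq by (intro sum_mono mult_left_mono) (auto simp: vseq_def)
  also have "\<dots> = (1 + e) * (\<Sum>j\<in>{1..k}. vseq j ^ (2 * p) * (\<theta>\<^sub>0 j)\<^sup>2)
      + (1 + 1 / e) * \<delta>\<^sup>2 * (\<Sum>j\<in>{1..k}. vseq j ^ (2 * p))"
    by (simp add: sum_distrib_left sum.distrib algebra_simps)
  also have "\<dots> \<le> (1 + e) * Q' + (1 + 1 / e) * \<delta>\<^sup>2 * (real k * (4 ^ p * real k ^ (2 * p)))"
    using ellipsoidD(3)[OF \<theta>\<^sub>0, of "{1..k}"] e(1) vsum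
    by (intro add_mono mult_left_mono) auto
  also have "(1 + 1 / e) * \<delta>\<^sup>2 * (real k * (4 ^ p * real k ^ (2 * p))) = (1 + 1 / e) * 4 ^ p * s\<^sup>2"
    using kk by (simp add: \<delta>(2))
  also have "(1 + 1 / e) * 4 ^ p * s\<^sup>2 = (Q - Q') / 4"
  proof -
    have "X * F * (D / (4 * F * X)) = D / 4" if "X \<noteq> 0" "F \<noteq> 0" for X F D :: real using that by simp
    from this[of "1 + 1 / e" "4 ^ p" "Q - Q'"] show ?thesis unfolding s2 using den by auto
  qed
  also have "(1 + e) * Q' + (Q - Q') / 4 < Q" using Q by (simp add: e_def field_simps)
  finally show "(\<Sum>j\<in>{1..k}. vseq j ^ (2 * p) * (\<bar>\<theta>\<^sub>0 j\<bar> + \<delta>)\<^sup>2) < Q" .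
qed

text \<open>
  Coordinate \<open>j\<close> has standard deviation \<open>1 / sqrt (vseq j ^ (2 * p + 1))\<close>, so the interval of length
  \<open>2 * \<delta>\<close> has probability of order \<open>sqrt (j / k) ^ (2 * p + 1)\<close> times an exponential factor. The first
  factors multiply to at least \<open>exp (- k * (2 * p + 1) / 2)\<close> up to a power \<open>(s / 2) ^ k\<close>. In the second
  ones the inverse variances have one more power of \<open>vseq j \<le> 2 * k\<close> than the ellipsoid condition, so their product is at
  least \<open>exp (- Q * k)\<close>.
\<close>

theorem gauss_prior_mass:
  assumes p: "p \<ge> 1" and Q: "0 < Q'" "Q' < Q"
  shows "\<exists>A D. 0 \<le> D \<and> (\<forall>k\<ge>1. \<forall>\<theta>\<^sub>0\<in>ellipsoid p Q'. \<exists>S\<in>sets (\<Pi>\<^sub>M j\<in>UNIV. borel).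
     S \<subseteq> coef_ball p Q \<theta>\<^sub>0 (D / real k ^ (2 * p)) \<and>
     ennreal (exp (- (A * real k))) \<le> emeasure (gauss_prior p k) S)"
proof -
  define s where "s = sqrt ((Q - Q') / (4 * 4 ^ p * (1 + 2 * Q' / (Q - Q'))))"
  define A where "A = Q + real (2 * p + 1) / 2 - ln (s / 2)"
  have main: "\<exists>S\<in>sets (\<Pi>\<^sub>M j\<in>UNIV. borel).
     S \<subseteq> coef_ball p Q \<theta>\<^sub>0 ((s\<^sup>2 + Q) / real k ^ (2 * p)) \<and>
     ennreal (exp (- (A * real k))) \<le> emeasure (gauss_prior p k) S"
    if k: "1 \<le> k" and \<theta>\<^sub>0: "\<theta>\<^sub>0 \<in> ellipsoid p Q'" for k \<theta>\<^sub>0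
  proof -
    define \<delta> where "\<delta> = s / sqrt (real k ^ (2 * p + 1))"
    note b = box_in_ellipsoid[OF p \<theta>\<^sub>0 Q k, folded s_def, folded \<delta>_def]
    have kk: "0 < real k" using k by simp
    have \<theta>\<^sub>0Q: "\<theta>\<^sub>0 \<in> ellipsoid p Q" using \<theta>\<^sub>0 Q by (auto simp: ellipsoid_def)
    have "\<theta> \<in> ellipsoid p Q \<and> coef_norm (\<lambda>j. \<theta>\<^sub>0 j - \<theta> j) \<le> (s\<^sup>2 + Q) / real k ^ (2 * p)"
      if \<theta>: "\<theta> \<in> coef_box k \<delta> \<theta>\<^sub>0" for \<theta>
    proof
      have near: "\<bar>\<theta> j - \<theta>\<^sub>0 j\<bar> \<le> \<delta>" if "j \<in> {1..k}" for j using \<theta> that by (auto simp: coef_box_def)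
      have tail: "\<theta> j = 0" if "k < j" for j using \<theta> that by (auto simp: coef_box_def)
      have "(\<Sum>j\<in>{1..k}. vseq j ^ (2 * p) * (\<theta> j)\<^sup>2) \<le> (\<Sum>j\<in>{1..k}. vseq j ^ (2 * p) * (\<bar>\<theta>\<^sub>0 j\<bar> + \<delta>)\<^sup>2)"
      proof (intro sum_mono mult_left_mono)
        fix j assume "j \<in> {1..k}"
        then have "\<bar>\<theta> j\<bar> \<le> \<bar>\<theta>\<^sub>0 j\<bar> + \<delta>" using near[of j] by linarith
        from power_mono[OF this abs_ge_zero, of 2] show "(\<theta> j)\<^sup>2 \<le> (\<bar>\<theta>\<^sub>0 j\<bar> + \<delta>)\<^sup>2" by simp
      qed (auto simp: vseq_def)
      then show "\<theta> \<in> ellipsoid p Q"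
        using b(4) by (subst ellipsoid_finite_support[OF p tail]) auto
      have "coef_norm (\<lambda>j. \<theta>\<^sub>0 j - \<theta> j) \<le> real k * \<delta>\<^sup>2 + Q / real k ^ (2 * p)"
        using near tail by (intro coef_norm_le[OF \<theta>\<^sub>0Q k]) (auto simp: abs_minus_commute)
      also have "\<dots> = (s\<^sup>2 + Q) / real k ^ (2 * p)" using kk by (simp add: b(3) add_divide_distrib)
      finally show "coef_norm (\<lambda>j. \<theta>\<^sub>0 j - \<theta> j) \<le> (s\<^sup>2 + Q) / real k ^ (2 * p)" .
    qed
    moreover have "ennreal (exp (- (A * real k))) \<le> emeasure (gauss_prior p k) (coef_box k \<delta> \<theta>\<^sub>0)"
    proof -
      let ?V = "\<lambda>j. vseq j ^ (2 * p + 1)"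
      let ?c = "\<lambda>j. \<delta> / 2 * sqrt (?V j) * exp (- (?V j * (\<bar>\<theta>\<^sub>0 j\<bar> + \<delta>)\<^sup>2 / 2))"
      have fac: "s / 2 * (sqrt (real j / real k)) ^ (2 * p + 1) * exp (- (vseq j ^ (2 * p) * (\<bar>\<theta>\<^sub>0 j\<bar> + \<delta>)\<^sup>2 * real k)) \<le> ?c j"
        if j: "j \<in> {1..k}" for j
      proof (rule mult_mono)
        have e1: "(sqrt (real j / real k)) ^ (2 * p + 1) = sqrt ((real j / real k) ^ (2 * p + 1))"
          by (rule real_sqrt_power[symmetric])
        have "u / r / 2 * q = u / 2 * (q / r)" for u r q :: real by simp
        then have e2: "\<delta> / 2 * sqrt (?V j) = s / 2 * sqrt (?V j / real k ^ (2 * p + 1))"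
          unfolding \<delta>_def real_sqrt_divide .
        have "sqrt ((real j / real k) ^ (2 * p + 1)) \<le> sqrt (?V j / real k ^ (2 * p + 1))"
          unfolding power_divide using vseq_ge[of j]
          by (intro real_sqrt_le_mono divide_right_mono power_mono) auto
        then have "s / 2 * sqrt ((real j / real k) ^ (2 * p + 1)) \<le> s / 2 * sqrt (?V j / real k ^ (2 * p + 1))"
          using b(1) by (intro mult_left_mono) auto
        then show "s / 2 * (sqrt (real j / real k)) ^ (2 * p + 1) \<le> \<delta> / 2 * sqrt (?V j)"
          unfolding e1 e2 .
        have "?V j * (\<bar>\<theta>\<^sub>0 j\<bar> + \<delta>)\<^sup>2 / 2 = vseq j ^ (2 * p) * (\<bar>\<theta>\<^sub>0 j\<bar> + \<delta>)\<^sup>2 * (vseq j / 2)" by simp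
        also have "\<dots> \<le> vseq j ^ (2 * p) * (\<bar>\<theta>\<^sub>0 j\<bar> + \<delta>)\<^sup>2 * real k"
          using vseq_le[of j] j by (intro mult_left_mono mult_nonneg_nonneg) (auto simp: vseq_def)
        finally show "exp (- (vseq j ^ (2 * p) * (\<bar>\<theta>\<^sub>0 j\<bar> + \<delta>)\<^sup>2 * real k)) \<le> exp (- (?V j * (\<bar>\<theta>\<^sub>0 j\<bar> + \<delta>)\<^sup>2 / 2))"
          by simp
        show "0 \<le> \<delta> / 2 * sqrt (?V j)" using b(2) by (auto simp: vseq_def)
      qed auto
      have "exp (- (A * real k)) = (s / 2) ^ k * exp (- real k) powr (real (2 * p + 1) / 2) * exp (- (Q * real k))"
      proof -
        have "(s / 2) ^ k = exp (real k * ln (s / 2))" using b(1) by (simp add: exp_of_nat_mult)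
        then show ?thesis by (simp add: A_def powr_def algebra_simps add_divide_distrib flip: exp_add)
      qed
      also have "\<dots> \<le> (s / 2) ^ k * (sqrt (fact k / real k ^ k)) ^ (2 * p + 1)
          * exp (- ((\<Sum>j\<in>{1..k}. vseq j ^ (2 * p) * (\<bar>\<theta>\<^sub>0 j\<bar> + \<delta>)\<^sup>2) * real k))"
      proof (intro mult_mono mult_left_mono)
        have "exp (- real k) powr (real (2 * p + 1) / 2) = (sqrt (exp (- real k))) ^ (2 * p + 1)"
        proof -
          have "sqrt (exp (- real k)) = exp (- real k / 2)"
            by (rule real_sqrt_unique) (simp_all add: exp_double[symmetric])
          moreover have "exp (- real k / 2) ^ (2 * p + 1) = exp (real (2 * p + 1) * (- real k / 2))"
            by (rule exp_of_nat_mult[symmetric])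
          ultimately show ?thesis by (simp add: powr_def)
        qed
        also have "\<dots> \<le> (sqrt (fact k / real k ^ k)) ^ (2 * p + 1)"
        proof (intro power_mono real_sqrt_le_mono)
          show "exp (- real k) \<le> fact k / real k ^ k"
            using pow_self_le_exp_fact[of k] kk by (simp add: exp_minus field_simps)
        qed auto
        finally show "exp (- real k) powr (real (2 * p + 1) / 2) \<le> (sqrt (fact k / real k ^ k)) ^ (2 * p + 1)" .
        show "exp (- (Q * real k)) \<le> exp (- ((\<Sum>j\<in>{1..k}. vseq j ^ (2 * p) * (\<bar>\<theta>\<^sub>0 j\<bar> + \<delta>)\<^sup>2) * real k))"
          using b(4) by (simp add: mult_right_mono)
      qed (use b(1) in auto)
      also have "\<dots> = (\<Prod>j\<in>{1..k}. s / 2 * (sqrt (real j / real k)) ^ (2 * p + 1)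
          * exp (- (vseq j ^ (2 * p) * (\<bar>\<theta>\<^sub>0 j\<bar> + \<delta>)\<^sup>2 * real k)))"
      proof -
        have "(\<Prod>j\<in>{1..n}. sqrt (real j / real k)) = sqrt (\<Prod>j\<in>{1..n}. real j / real k)" for n
          by (induction n) (simp_all add: real_sqrt_mult[symmetric])
        from this[of k]
        have "(\<Prod>j\<in>{1..k}. sqrt (real j / real k)) = sqrt (\<Prod>j\<in>{1..k}. real j / real k)" .
        also have "(\<Prod>j\<in>{1..k}. real j / real k) = fact k / real k ^ k"
          by (simp add: prod_dividef fact_prod)
        finally have 1: "(\<Prod>j\<in>{1..k}. (sqrt (real j / real k)) ^ (2 * p + 1)) = (sqrt (fact k / real k ^ k)) ^ (2 * p + 1)"
          by (simp only: prod_power_distrib[symmetric])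
        have 2: "(\<Prod>j\<in>{1..k}. exp (- (vseq j ^ (2 * p) * (\<bar>\<theta>\<^sub>0 j\<bar> + \<delta>)\<^sup>2 * real k)))
            = exp (- ((\<Sum>j\<in>{1..k}. vseq j ^ (2 * p) * (\<bar>\<theta>\<^sub>0 j\<bar> + \<delta>)\<^sup>2) * real k))"
          by (subst exp_sum[symmetric]) (auto simp: sum_negf sum_distrib_right)
        show ?thesis unfolding prod.distrib 1 2 by simp
      qed
      also have "\<dots> \<le> (\<Prod>j\<in>{1..k}. ?c j)"
        using b(1) by (intro prod_mono conjI fac) auto
      finally have "ennreal (exp (- (A * real k))) \<le> ennreal (\<Prod>j\<in>{1..k}. ?c j)" by (rule ennreal_leI)
      also have "\<dots> = (\<Prod>j\<in>{1..k}. ennreal (?c j))"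
        using b(2) by (intro prod_ennreal[symmetric]) (auto simp: vseq_def)
      also have "\<dots> \<le> (\<Prod>j\<in>{1..k}. emeasure (coord_prior p k j) {\<theta>\<^sub>0 j - \<delta>..\<theta>\<^sub>0 j + \<delta>})"
        using b(2) by (intro prod_mono_ennreal coord_prior_interval_ge) auto
      also have "\<dots> = emeasure (gauss_prior p k) (coef_box k \<delta> \<theta>\<^sub>0)"
        by (rule gauss_prior_box[symmetric])
      finally show ?thesis .
    qed
    ultimately show ?thesis using coef_box_measurable[of k \<delta> \<theta>\<^sub>0] by blast
  qed
  have "0 \<le> s\<^sup>2 + Q" using Q by simp
  then show ?thesis
    using main by blast
qed

section \<open>Bayes estimation with the restricted sieve prior\<close>

abbreviation coef_space :: "(nat \<Rightarrow> real) measure" where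
  "coef_space \<equiv> \<Pi>\<^sub>M j\<in>UNIV. borel"

text \<open>
  The restricted prior lives on the ellipsoid only almost surely. Redirecting the other sequences to \<open>0\<close>, whose
  density is uniform, makes the bounds on densities hold for every parameter and changes no integral against the prior.
\<close>

definition clip :: "nat \<Rightarrow> real \<Rightarrow> (nat \<Rightarrow> real) \<Rightarrow> nat \<Rightarrow> real" where
  "clip p Q \<theta> = (if \<theta> \<in> ellipsoid p Q then \<theta> else (\<lambda>_. 0))"

locale ellipsoid_prior =
  fixes p :: nat and lam :: "nat pmf" and Q :: real
  assumes p: "1 \<le> p" and Q: "0 < Q"
    and mass_pos: "emeasure (sieve_prior p lam) (ellipsoid p Q) \<noteq> 0"
begin

abbreviation "lower \<equiv> exp (- (2 * (Q + 3)))"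
abbreviation "upper \<equiv> exp (2 * (Q + 3))"
abbreviation "prior_measure \<equiv> restricted_prior p lam Q"

lemma sets_prior: "sets prior_measure = sets coef_space"
  by (simp add: restricted_prior_def sets_sieve_prior)

lemma space_prior: "space prior_measure = UNIV"
  using sets_eq_imp_space_eq[OF sets_prior] by (simp add: space_PiM)

lemma prior_finite: "emeasure (sieve_prior p lam) (ellipsoid p Q) \<noteq> \<infinity>"
  using prob_space.emeasure_le_1[OF prob_space_sieve_prior[of p lam], of "ellipsoid p Q"]
  by (auto simp: top_unique)

lemma prob_space_prior: "prob_space prior_measure"
  unfolding restricted_prior_def using mass_pos prior_finite by (rule prob_space_uniform_measure)

lemma AE_prior: "AE \<theta> in prior_measure. \<theta> \<in> ellipsoid p Q"
  unfolding restricted_prior_def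
  by (subst AE_uniform_measure) (use mass_pos prior_finite in \<open>auto simp: less_top\<close>)

lemma zero_in_ellipsoid: "0 < R \<Longrightarrow> (\<lambda>_. 0) \<in> ellipsoid p R"
  by (simp add: ellipsoid_def)

lemma clip_in_ellipsoid: "clip p Q \<theta> \<in> ellipsoid p Q"
  using zero_in_ellipsoid[OF Q] by (simp add: clip_def)

lemma clip_measurable: "clip p Q \<in> measurable coef_space coef_space"
proof -
  have "(\<lambda>\<theta>. if \<theta> \<in> ellipsoid p Q then \<theta> else (\<lambda>_. 0)) \<in> measurable coef_space coef_space"
    by (rule measurable_If_set) (use ellipsoid_measurable in \<open>auto simp: space_PiM\<close>)
  then show ?thesis by (simp add: clip_def[abs_def])
qed

lemma dens_bounds_ellipsoid:
  assumes "\<theta> \<in> ellipsoid p Q"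
  shows "lower \<le> dens \<theta> x" "dens \<theta> x \<le> upper" "(\<integral>x. dens \<theta> x \<partial>lebesgue01) = 1"
  using dens_bounds[of \<theta>, OF ellipsoid_abs_summable(2)[OF p assms]]
    integral_dens[of \<theta>, OF ellipsoid_abs_summable(2)[OF p assms]] by auto

sublocale density_bounds lebesgue01 lower upper
  using Q by (simp add: density_bounds_def prob_space_lebesgue01 density_bounds_axioms_def)

lemma bdens_dens: "\<theta> \<in> ellipsoid p Q \<Longrightarrow> bdens (dens \<theta>)"
  unfolding bdens_def using dens_bounds_ellipsoid dens_measurable
  by (auto intro: borel_measurable_lebesgue01)

sublocale bayes_model lebesgue01 lower upper prior_measure "\<lambda>\<theta>. dens (clip p Q \<theta>)"
proof -
  interpret prob_space prior_measure by (rule prob_space_prior)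
  show "bayes_model lebesgue01 lower upper prior_measure (\<lambda>\<theta>. dens (clip p Q \<theta>))"
  proof
    have c: "(\<lambda>z. clip p Q (fst z)) \<in> measurable (coef_space \<Otimes>\<^sub>M lebesgue01) coef_space"
      using measurable_compose[OF measurable_fst clip_measurable] .
    have "(\<lambda>(\<theta>, x). dens (clip p Q \<theta>) x) \<in> borel_measurable (coef_space \<Otimes>\<^sub>M lebesgue01)"
      using measurable_compose[OF measurable_Pair[OF c measurable_snd] dens_measurable_pair]
      by (simp add: split_beta')
    then show "(\<lambda>(\<theta>, x). dens (clip p Q \<theta>) x) \<in> borel_measurable (prior_measure \<Otimes>\<^sub>M lebesgue01)"
      by (simp cong: measurable_cong_sets add: sets_pair_measure_cong[OF sets_prior refl])
    show "bdens (dens (clip p Q \<theta>))" for \<theta> by (rule bdens_dens[OF clip_in_ellipsoid])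
  qed
qed

lemma bayes_estimator_eq:
  assumes X: "X \<in> (\<Pi>\<^sub>E i\<in>{1..n}. space lebesgue01)" and x: "x \<in> space lebesgue01"
  shows "bayes_estimator prior_measure n X x = posterior_mean {1..n} X x"
proof -
  have dm: "(\<lambda>\<theta>. dens \<theta> y) \<in> borel_measurable prior_measure" if "y \<in> space lebesgue01" for y
    using measurable_compose[OF measurable_Pair2'[OF that] dens_measurable_pair]
    by (simp cong: measurable_cong_sets add: sets_prior)
  have fm: "(\<lambda>\<theta>. dens (clip p Q \<theta>) y) \<in> borel_measurable prior_measure" if "y \<in> space lebesgue01" for y
    using f_measurable_fst[OF that] .
  have Xi: "X i \<in> space lebesgue01" if "i \<in> {1..n}" for i using X that by auto
  have pm: "(\<lambda>\<theta>. \<Prod>i\<in>{1..n}. dens \<theta> (X i)) \<in> borel_measurable prior_measure"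
    "(\<lambda>\<theta>. \<Prod>i\<in>{1..n}. dens (clip p Q \<theta>) (X i)) \<in> borel_measurable prior_measure"
    using dm[OF Xi] fm[OF Xi] by (auto intro!: borel_measurable_prod)
  have e: "AE \<theta> in prior_measure. clip p Q \<theta> = \<theta>"
    using AE_prior by eventually_elim (simp add: clip_def)
  have "(\<integral>\<theta>. dens \<theta> x * (\<Prod>i\<in>{1..n}. dens \<theta> (X i)) \<partial>prior_measure)
      = (\<integral>\<theta>. dens (clip p Q \<theta>) x * (\<Prod>i\<in>{1..n}. dens (clip p Q \<theta>) (X i)) \<partial>prior_measure)"
    using e by (intro integral_cong_AE borel_measurable_times pm dm[OF x] fm[OF x]) (auto elim!: eventually_mono)
  moreover have "(\<integral>\<theta>. (\<Prod>i\<in>{1..n}. dens \<theta> (X i)) \<partial>prior_measure)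
      = (\<integral>\<theta>. (\<Prod>i\<in>{1..n}. dens (clip p Q \<theta>) (X i)) \<partial>prior_measure)"
    using e by (intro integral_cong_AE pm) (auto elim!: eventually_mono)
  ultimately show ?thesis by (simp add: bayes_estimator_def posterior_mean_def)
qed

definition loss :: "(nat \<Rightarrow> real) \<Rightarrow> nat \<Rightarrow> (nat \<Rightarrow> real) \<Rightarrow> real" where
  "loss \<theta> n X = (\<integral>x. (sqrt (dens \<theta> x) - sqrt (posterior_mean {1..n} X x))\<^sup>2 \<partial>lebesgue01)"

lemma risk_eq:
  "risk prior_measure n \<theta> = (\<integral>\<^sup>+X. ennreal (loss \<theta> n X) \<partial>iid {1..n} lebesgue01 (dens \<theta>))"
proof -
  have "risk prior_measure n \<theta> = (\<integral>\<^sup>+X. ennreal ((hellinger (dens \<theta>) (bayes_estimator prior_measure n X))\<^sup>2)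
      \<partial>iid {1..n} lebesgue01 (dens \<theta>))"
    by (simp add: risk_def iid_def dens_measure_def)
  also have "\<dots> = (\<integral>\<^sup>+X. ennreal (loss \<theta> n X) \<partial>iid {1..n} lebesgue01 (dens \<theta>))"
  proof (intro nn_integral_cong arg_cong[where f = ennreal])
    fix X assume "X \<in> space (iid {1..n} lebesgue01 (dens \<theta>))"
    then have X: "X \<in> (\<Pi>\<^sub>E i\<in>{1..n}. space lebesgue01)" by (simp only: space_iid)
    have "(\<integral>x. (sqrt (dens \<theta> x) - sqrt (bayes_estimator prior_measure n X x))\<^sup>2 \<partial>lebesgue01) = loss \<theta> n X"
      unfolding loss_def
      by (intro Bochner_Integration.integral_cong refl arg_cong[where f = "\<lambda>y. y\<^sup>2"]
          arg_cong2[where f = minus] arg_cong[where f = sqrt] bayes_estimator_eq[OF X])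
    moreover have "0 \<le> loss \<theta> n X" by (simp add: loss_def)
    ultimately show "(hellinger (dens \<theta>) (bayes_estimator prior_measure n X))\<^sup>2 = loss \<theta> n X"
      by (simp add: hellinger_def)
  qed
  finally show ?thesis .
qed

section \<open>Upper bound for the risk\<close>

definition lipschitz :: real where "lipschitz = 4 * exp (8 * (Q + 3))"

lemma lipschitz_pos: "0 < lipschitz" by (simp add: lipschitz_def)

lemma sqdist_dens_ellipsoid:
  assumes "\<theta> \<in> ellipsoid p Q" "\<eta> \<in> ellipsoid p Q"
  shows "sqdist lebesgue01 (dens \<theta>) (dens \<eta>) \<le> lipschitz * coef_norm (\<lambda>j. \<theta> j - \<eta> j)"
  unfolding lipschitz_def
  using ellipsoid_abs_summable[OF p assms(1)] ellipsoid_abs_summable[OF p assms(2)] Q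
  by (intro sqdist_dens_le) auto

text \<open>
  The constants are balanced as follows. The covering has \<open>exp (A1 * k)\<close> balls, the prior mass is
  \<open>exp (- A * k)\<close>, and replacing the truth by densities in the corresponding ball costs \<open>exp (A3 * k)\<close>.
  The threshold \<open>d0 = exp (- (A + A3 + 1) * k)\<close> leaves \<open>exp (- k)\<close> for the normalising integral, and
  \<open>T\<close> solves the equation that makes the exponents of both test errors at least
  \<open>(A1 + A + A3 + 2) * k\<close>, which pays for the number of balls and for the division by \<open>d0\<close>.
\<close>

lemma risk_upper_bound_at_resolution:
  assumes k: "1 \<le> k" "real n \<le> real k ^ (2 * p + 1)" "real k ^ (2 * p + 1) \<le> 2 ^ (2 * p + 1) * real n"
    and \<theta>\<^sub>0: "\<theta>\<^sub>0 \<in> ellipsoid p Q"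
    and S: "S \<in> sets coef_space" "S \<subseteq> coef_ball p Q \<theta>\<^sub>0 (D / real k ^ (2 * p))"
      "exp (- (A * real k)) \<le> measure prior_measure S"
    and A: "0 \<le> A" and D: "0 \<le> D"
    and cov: "A1 = Q + 1 + ln (2 ^ p + 1) + real p" and A3: "A3 = lipschitz * D / lower"
    and T: "T = 2 * (lipschitz * (1 + Q) + 16 * upper * (2 ^ (2 * p + 1) * (A1 + A + A3 + 2)
        + upper / lower\<^sup>2 * (lipschitz * (1 + Q))))"
  shows "risk prior_measure n \<theta>\<^sub>0
    \<le> ennreal ((T + upper\<^sup>2 * (3 * fact (2 * p))) / (4 * lower) / real k ^ (2 * p))"
proof -
  define K where "K = real k ^ (2 * p)"
  define \<epsilon> where "\<epsilon> = lipschitz * D / K"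
  define \<delta> where "\<delta> = lipschitz * (1 + Q) / K"
  define \<tau> where "\<tau> = T / K"
  define H where "H = A1 + A + A3 + 2"
  define d0 where "d0 = exp (- ((A + A3 + 1) * real k))"
  have kk: "0 < real k" and K: "0 < K" using k(1) by (auto simp: K_def)
  have A1: "0 \<le> A1" using Q unfolding cov by (intro add_nonneg_nonneg ln_ge_zero) auto
  have A3': "0 \<le> A3" unfolding A3 using lipschitz_pos D by simp
  have H: "0 \<le> H" using A A1 A3' by (simp add: H_def)
  have nK: "real n / K \<le> real k" using k(2) K by (simp add: K_def divide_le_eq)
  have kn: "real k \<le> 2 ^ (2 * p + 1) * (real n / K)"
    using k(3) K by (simp add: K_def le_divide_eq)
  obtain C where C: "finite C" "C \<subseteq> ellipsoid p Q" "real (card C) \<le> exp (A1 * real k)"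
    "\<And>\<theta>. \<theta> \<in> ellipsoid p Q \<Longrightarrow> \<exists>\<eta>\<in>C. coef_norm (\<lambda>j. \<theta> j - \<eta> j) \<le> (1 + Q) / K"
    using ellipsoid_covering[OF p Q k(1)] unfolding cov K_def by blast
  have \<delta>_cov: "\<exists>q\<in>dens ` C. sqdist lebesgue01 (dens (clip p Q \<theta>)) q \<le> \<delta>" for \<theta>
  proof -
    obtain \<eta> where \<eta>: "\<eta> \<in> C" "coef_norm (\<lambda>j. clip p Q \<theta> j - \<eta> j) \<le> (1 + Q) / K"
      using C(4)[OF clip_in_ellipsoid] by blast
    have "sqdist lebesgue01 (dens (clip p Q \<theta>)) (dens \<eta>) \<le> lipschitz * coef_norm (\<lambda>j. clip p Q \<theta> j - \<eta> j)"
      using \<eta> C(2) by (intro sqdist_dens_ellipsoid clip_in_ellipsoid) auto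
    also have "\<dots> \<le> \<delta>" unfolding \<delta>_def times_divide_eq_right[symmetric]
      using \<eta>(2) lipschitz_pos by (intro mult_left_mono) auto
    finally show ?thesis using \<eta>(1) by blast
  qed
  have mass: "exp (- (A * real k)) \<le> prior.prob {\<theta> \<in> space prior_measure. sqdist lebesgue01 (dens (clip p Q \<theta>)) (dens \<theta>\<^sub>0) \<le> \<epsilon>}"
  proof (rule order_trans[OF S(3) prior.finite_measure_mono])
    show "S \<subseteq> {\<theta> \<in> space prior_measure. sqdist lebesgue01 (dens (clip p Q \<theta>)) (dens \<theta>\<^sub>0) \<le> \<epsilon>}"
    proof
      fix \<theta> assume "\<theta> \<in> S"
      then have \<theta>: "\<theta> \<in> ellipsoid p Q" "coef_norm (\<lambda>j. \<theta>\<^sub>0 j - \<theta> j) \<le> D / K"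
        using S(2) by (auto simp: K_def)
      have "sqdist lebesgue01 (dens \<theta>\<^sub>0) (dens \<theta>) \<le> lipschitz * coef_norm (\<lambda>j. \<theta>\<^sub>0 j - \<theta> j)"
        by (rule sqdist_dens_ellipsoid[OF \<theta>\<^sub>0 \<theta>(1)])
      also have "\<dots> \<le> \<epsilon>" unfolding \<epsilon>_def times_divide_eq_right[symmetric]
        using \<theta>(2) lipschitz_pos by (intro mult_left_mono) auto
      finally show "\<theta> \<in> {\<theta> \<in> space prior_measure. sqdist lebesgue01 (dens (clip p Q \<theta>)) (dens \<theta>\<^sub>0) \<le> \<epsilon>}"
        using \<theta>(1) by (simp add: space_prior clip_def sqdist_commute[of "dens \<theta>\<^sub>0"])
    qed
    note [measurable] = sqdist_f_measurable[OF bdens_dens[OF \<theta>\<^sub>0]]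
    show "{\<theta> \<in> space prior_measure. sqdist lebesgue01 (dens (clip p Q \<theta>)) (dens \<theta>\<^sub>0) \<le> \<epsilon>} \<in> sets prior_measure"
      by measurable
  qed
  have L0: "0 \<le> lipschitz * (1 + Q)" using lipschitz_pos Q by simp
  have T0: "0 \<le> T" unfolding T H_def[symmetric] using L0 H lipschitz_pos Q by (intro mult_nonneg_nonneg add_nonneg_nonneg) auto
  define R where "R = d0 / exp (- (A * real k)) * exp (real (card {1..n}) * \<epsilon> / lower)
         + real (card (dens ` C)) * (exp (- (real (card {1..n}) * (\<tau> / 2 - \<delta>) / (8 * upper)))
         + exp (- (real (card {1..n}) * ((\<tau> / 2 - \<delta>) / (16 * upper) - upper / lower\<^sup>2 * \<delta>))) / d0)"
  have risk: "risk prior_measure n \<theta>\<^sub>0 \<le> ennreal ((\<tau> + upper\<^sup>2 * R) / (4 * lower))"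
    unfolding risk_eq loss_def R_def
  proof (rule posterior_mean_risk_le[OF bdens_dens[OF \<theta>\<^sub>0] _ mass])
    show "finite (dens ` C)" using C(1) by simp
    show "\<And>q. q \<in> dens ` C \<Longrightarrow> bdens q" using C(2) bdens_dens by auto
  qed (use \<delta>_cov T0 K in \<open>auto simp: \<tau>_def d0_def\<close>)
  have e0: "d0 / exp (- (A * real k)) * exp (real n * \<epsilon> / lower) \<le> exp (- real k)"
  proof -
    have "real n * \<epsilon> / lower = A3 * (real n / K)" by (simp add: \<epsilon>_def A3 mult_ac)
    also have "\<dots> \<le> A3 * real k" by (intro mult_left_mono nK A3')
    finally have "exp (real n * \<epsilon> / lower) \<le> exp (A3 * real k)" by simp
    then have "d0 / exp (- (A * real k)) * exp (real n * \<epsilon> / lower)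
        \<le> d0 / exp (- (A * real k)) * exp (A3 * real k)"
      by (intro mult_left_mono) (auto simp: d0_def)
    also have "\<dots> = exp (- real k)"
      by (simp add: d0_def algebra_simps flip: exp_add exp_diff)
    finally show ?thesis .
  qed
  have G: "H * real k \<le> real n * ((\<tau> / 2 - \<delta>) / (16 * upper) - upper / lower\<^sup>2 * \<delta>)"
  proof -
    have gen: "(T' / K / 2 - L / K) / (16 * u) - c * (L / K) = F * h / K"
      if "T' = 2 * (L + 16 * u * (F * h + c * L))" "0 < u" for T' L u c F h :: real
      unfolding that(1) using that(2) K by (simp add: field_simps)
    have "(\<tau> / 2 - \<delta>) / (16 * upper) - upper / lower\<^sup>2 * \<delta> = 2 ^ (2 * p + 1) * H / K"
      unfolding \<tau>_def \<delta>_def by (rule gen) (auto simp: T H_def)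
    moreover have "H * real k \<le> H * (2 ^ (2 * p + 1) * (real n / K))" by (intro mult_left_mono kn H)
    ultimately show ?thesis by (simp add: mult_ac)
  qed
  have dpos: "0 \<le> \<delta>" using L0 K by (simp add: \<delta>_def)
  have "0 \<le> (\<tau> / 2 - \<delta>)"
  proof -
    have "lipschitz * (1 + Q) \<le> T / 2" unfolding T H_def[symmetric]
      using L0 H by (simp add: add_nonneg_nonneg)
    then have "lipschitz * (1 + Q) / K \<le> T / 2 / K" using K by (intro divide_right_mono) auto
    then show ?thesis by (simp add: \<tau>_def \<delta>_def)
  qed
  then have "(\<tau> / 2 - \<delta>) / (16 * upper) \<le> (\<tau> / 2 - \<delta>) / (8 * upper)"
    by (intro divide_left_mono) auto
  moreover have "0 \<le> upper / lower\<^sup>2 * \<delta>" using dpos by simp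
  ultimately have "(\<tau> / 2 - \<delta>) / (16 * upper) - upper / lower\<^sup>2 * \<delta> \<le> (\<tau> / 2 - \<delta>) / (8 * upper)"
    by linarith
  then have G': "H * real k \<le> real n * ((\<tau> / 2 - \<delta>) / (8 * upper))"
    using mult_left_mono[of _ _ "real n"] G by (meson of_nat_0_le_iff order_trans)
  have e1: "real (card (dens ` C)) * (exp (- (real n * (\<tau> / 2 - \<delta>) / (8 * upper)))
         + exp (- (real n * ((\<tau> / 2 - \<delta>) / (16 * upper) - upper / lower\<^sup>2 * \<delta>))) / d0) \<le> 2 * exp (- real k)"
  proof -
    have c: "real (card (dens ` C)) \<le> exp (A1 * real k)" using C(3) card_image_le[OF C(1), of dens] by linarith
    have 1: "exp (- (real n * (\<tau> / 2 - \<delta>) / (8 * upper))) \<le> exp (- (H * real k)) / d0"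
    proof -
      have "exp (- (real n * (\<tau> / 2 - \<delta>) / (8 * upper))) \<le> exp (- (H * real k))"
        using G' by simp
      also have "\<dots> \<le> exp (- (H * real k)) / d0"
        using A A3' by (simp add: d0_def le_divide_eq mult_left_le)
      finally show ?thesis .
    qed
    have 2: "exp (- (real n * ((\<tau> / 2 - \<delta>) / (16 * upper) - upper / lower\<^sup>2 * \<delta>))) / d0 \<le> exp (- (H * real k)) / d0"
      using G by (intro divide_right_mono) (auto simp: d0_def)
    have "real (card (dens ` C)) * (exp (- (real n * (\<tau> / 2 - \<delta>) / (8 * upper)))
         + exp (- (real n * ((\<tau> / 2 - \<delta>) / (16 * upper) - upper / lower\<^sup>2 * \<delta>))) / d0)
        \<le> exp (A1 * real k) * (exp (- (H * real k)) / d0 + exp (- (H * real k)) / d0)"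
      using 1 2 c by (intro mult_mono add_mono) (auto simp: d0_def)
    also have "\<dots> = 2 * exp (A1 * real k - H * real k + (A + A3 + 1) * real k)"
      by (simp add: d0_def exp_add exp_diff exp_minus field_simps)
    also have "A1 * real k - H * real k + (A + A3 + 1) * real k = - real k"
      by (simp add: H_def algebra_simps)
    finally show ?thesis .
  qed
  \<comment> \<open>Finally an exponential is traded for the rate by one term of the series of \<open>exp (real k)\<close>.\<close>
  have "R \<le> 3 * exp (- real k)" unfolding R_def using e0 e1 by simp
  also have "exp (- real k) \<le> fact (2 * p) / K"
  proof -
    have "(\<Sum>n\<in>{2 * p}. real k ^ n /\<^sub>R fact n) \<le> (\<Sum>n. real k ^ n /\<^sub>R fact n)"
      by (intro sum_le_suminf summable_exp_generic) auto
    then have "K / fact (2 * p) \<le> exp (real k)"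
      by (simp add: exp_def K_def divide_inverse mult.commute)
    then show ?thesis using K by (simp add: exp_minus field_simps)
  qed
  finally have R: "R \<le> 3 * fact (2 * p) / K" by simp
  have "(\<tau> + upper\<^sup>2 * R) / (4 * lower) \<le> (\<tau> + upper\<^sup>2 * (3 * fact (2 * p) / K)) / (4 * lower)"
    using R by (intro divide_right_mono add_left_mono mult_left_mono) auto
  also have "\<dots> = (T + upper\<^sup>2 * (3 * fact (2 * p))) / (4 * lower) / K"
    using K by (simp add: \<tau>_def field_simps)
  finally show ?thesis using risk unfolding K_def by (meson ennreal_leI order_trans)
qed

section \<open>Lower bound for the risk\<close>

lemma ln_diff_sq_le:
  fixes a b :: real
  assumes "lower \<le> a" "lower \<le> b"
  shows "(ln a - ln b)\<^sup>2 \<le> 4 / lower * (sqrt a - sqrt b)\<^sup>2"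
proof -
  have l: "0 < sqrt lower" by simp
  have key: "ln u - ln v \<le> (u - v) / sqrt lower" if "sqrt lower \<le> v" "v \<le> u" for u v :: real
  proof -
    have v: "0 < v" "0 < u" using that l by linarith+
    have "ln u - ln v = ln (u / v)" using v by (simp add: ln_div)
    also have "\<dots> \<le> u / v - 1" using v by (intro ln_le_minus_one) auto
    also have "\<dots> = (u - v) / v" using v by (simp add: field_simps)
    also have "\<dots> \<le> (u - v) / sqrt lower" using that v l by (intro divide_left_mono) auto
    finally show ?thesis .
  qed
  have s: "sqrt lower \<le> sqrt a" "sqrt lower \<le> sqrt b" using assms by auto
  have "\<bar>ln (sqrt a) - ln (sqrt b)\<bar> \<le> \<bar>sqrt a - sqrt b\<bar> / sqrt lower"
  proof (cases "sqrt b \<le> sqrt a")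
    case True
    then have "0 \<le> ln (sqrt a) - ln (sqrt b)" using s l by (auto intro!: ln_mono order_less_le_trans[OF l])
    then show ?thesis using key[OF s(2) True] True by simp
  next
    case False
    then have "0 \<le> ln (sqrt b) - ln (sqrt a)" using s l by (auto intro!: ln_mono order_less_le_trans[OF l])
    then show ?thesis using key[OF s(1)] False by simp
  qed
  from power_mono[OF this abs_ge_zero, of 2]
  have *: "(ln (sqrt a) - ln (sqrt b))\<^sup>2 \<le> (sqrt a - sqrt b)\<^sup>2 / lower"
    by (simp add: power_divide)
  have "0 < a" "0 < b" using assms by (auto intro: less_le_trans[rotated])
  then have "ln a - ln b = 2 * (ln (sqrt a) - ln (sqrt b))" by (simp add: ln_sqrt)
  then have "(ln a - ln b)\<^sup>2 = 4 * (ln (sqrt a) - ln (sqrt b))\<^sup>2"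
    by (simp only: power_mult_distrib) simp
  also have "\<dots> \<le> 4 * ((sqrt a - sqrt b)\<^sup>2 / lower)" by (intro mult_left_mono *) simp
  finally show ?thesis by (simp only: times_divide_eq_left times_divide_eq_right)
qed

text \<open>
  The estimator of \<open>\<theta> j\<close> induced by the posterior mean.
\<close>

definition log_coef :: "nat \<Rightarrow> nat \<Rightarrow> (nat \<Rightarrow> real) \<Rightarrow> real" where
  "log_coef n j X = (\<integral>x. ln (posterior_mean {1..n} X x) * trig j x \<partial>lebesgue01)"

lemma log_coef_measurable: "log_coef n j \<in> borel_measurable (\<Pi>\<^sub>M i\<in>{1..n}. lebesgue01)"
  unfolding log_coef_def
proof (rule U.borel_measurable_lebesgue_integral)
  have "(\<lambda>z. trig j (snd z)) \<in> borel_measurable ((\<Pi>\<^sub>M i\<in>{1..n}. lebesgue01) \<Otimes>\<^sub>M lebesgue01)"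
    using measurable_compose[OF measurable_snd borel_measurable_lebesgue01[OF trig_measurable]] .
  from borel_measurable_times[OF borel_measurable_ln[OF posterior_mean_measurable[of "{1..n}"]] this]
  show "(\<lambda>(X, x). ln (posterior_mean {1..n} X x) * trig j x)
      \<in> borel_measurable ((\<Pi>\<^sub>M i\<in>{1..n}. lebesgue01) \<Otimes>\<^sub>M lebesgue01)"
    by (simp add: split_beta')
qed

text \<open>
  The logarithm is Lipschitz in the square root on values above \<open>lower\<close>, so the loss dominates the squared
  \<open>L\<^sup>2\<close> distance of the logarithms; Bessel's inequality applies to the latter. Logarithms are used because
  the Fourier coefficients of \<open>ln (dens \<theta> x)\<close> are the parameters themselves.
\<close>

lemma loss_lower_bound:
  assumes J: "finite J" "0 \<notin> J" and \<theta>: "\<theta> \<in> ellipsoid p Q" "\<And>j. j \<notin> J \<Longrightarrow> \<theta> j = 0"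
    and X: "X \<in> (\<Pi>\<^sub>E i\<in>{1..n}. space lebesgue01)"
  shows "(\<Sum>j\<in>J. (\<theta> j - log_coef n j X)\<^sup>2) \<le> 4 / lower * loss \<theta> n X"
proof -
  let ?r = "posterior_mean {1..n} X"
  have d: "lower \<le> dens \<theta> x" "dens \<theta> x \<le> upper" for x using dens_bounds_ellipsoid[OF \<theta>(1)] by auto
  have r: "lower \<le> ?r x" "?r x \<le> upper" if "x \<in> space lebesgue01" for x
    using posterior_mean_bounds[OF bdens_dens[OF \<theta>(1)] X _ that] by auto
  have dm[measurable]: "dens \<theta> \<in> borel_measurable lebesgue01"
    by (intro borel_measurable_lebesgue01 dens_measurable)
  have Xs: "X \<in> space (\<Pi>\<^sub>M i\<in>{1..n}. lebesgue01)" using X by (simp add: space_PiM)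
  have rm[measurable]: "?r \<in> borel_measurable lebesgue01"
    using measurable_compose_Pair1[OF Xs posterior_mean_measurable[of "{1..n}"]] by simp
  have tm[measurable]: "trig j \<in> borel_measurable lebesgue01" for j
    by (intro borel_measurable_lebesgue01 trig_measurable)
  have lnb: "\<bar>ln y\<bar> \<le> 2 * (Q + 3)" if "lower \<le> y" "y \<le> upper" for y :: real
  proof -
    have "0 < y" using that(1) exp_gt_zero by (rule less_le_trans[rotated])
    with that have "ln lower \<le> ln y" "ln y \<le> ln upper"
      by (simp_all only: ln_le_cancel_iff exp_gt_zero)
    then show ?thesis unfolding ln_exp by (intro abs_leI; linarith)
  qed
  define h where "h x = ln (dens \<theta> x) - ln (?r x)" for x
  have hm: "h \<in> borel_measurable lebesgue01" unfolding h_def by measurable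
  have hb: "\<bar>h x\<bar> \<le> 4 * (Q + 3)" if "x \<in> {0..1}" for x
    unfolding h_def using lnb[OF d, of x] lnb[OF r, of x] that by (simp add: space_lebesgue01 abs_le_iff)
  have il: "integrable lebesgue01 (\<lambda>x. ln (g x) * trig j x)"
    if [measurable]: "g \<in> borel_measurable lebesgue01" and g: "\<And>x. x \<in> space lebesgue01 \<Longrightarrow> lower \<le> g x \<and> g x \<le> upper" for g j
  proof (rule U.integrable_const_bound[where B = "2 * (Q + 3) * sqrt 2"])
    show "AE x in lebesgue01. norm (ln (g x) * trig j x) \<le> 2 * (Q + 3) * sqrt 2"
      using lnb g abs_trig_le Q by (intro AE_I2) (auto simp: abs_mult intro!: mult_mono)
  qed measurable
  have coef: "(\<integral>x. h x * trig j x \<partial>lebesgue01) = \<theta> j - log_coef n j X" if j: "j \<in> J" for j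
  proof -
    have "(\<integral>x. h x * trig j x \<partial>lebesgue01)
        = (\<integral>x. ln (dens \<theta> x) * trig j x \<partial>lebesgue01) - (\<integral>x. ln (?r x) * trig j x \<partial>lebesgue01)"
      unfolding h_def left_diff_distrib
      using d r by (intro Bochner_Integration.integral_diff il dm rm) auto
    also have "(\<integral>x. ln (dens \<theta> x) * trig j x \<partial>lebesgue01) = \<theta> j"
    proof (rule log_dens_coefficient[OF J, where B = "Q + 3"])
      show "j \<noteq> 0" using J(2) j by metis
    qed (use \<theta>(2) ellipsoid_abs_summable(2)[OF p \<theta>(1)] in auto)
    finally show ?thesis by (simp add: log_coef_def)
  qed
  have "(\<Sum>j\<in>J. (\<theta> j - log_coef n j X)\<^sup>2) = (\<Sum>j\<in>J. (\<integral>x. h x * trig j x \<partial>lebesgue01)\<^sup>2)"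
    using coef by simp
  also have "\<dots> \<le> (\<integral>x. (h x)\<^sup>2 \<partial>lebesgue01)" by (rule bessel_trig[OF hm hb J(1)])
  also have "\<dots> \<le> (\<integral>x. 4 / lower * (sqrt (dens \<theta> x) - sqrt (?r x))\<^sup>2 \<partial>lebesgue01)"
  proof (rule integral_mono)
    show "integrable lebesgue01 (\<lambda>x. (h x)\<^sup>2)"
    proof (rule U.integrable_const_bound[where B = "(4 * (Q + 3))\<^sup>2"])
      show "AE x in lebesgue01. norm ((h x)\<^sup>2) \<le> (4 * (Q + 3))\<^sup>2"
      proof (rule AE_I2)
        fix x assume "x \<in> space lebesgue01"
        then have "\<bar>h x\<bar> \<le> 4 * (Q + 3)" by (intro hb) (simp add: space_lebesgue01)
        from power_mono[OF this abs_ge_zero, of 2] show "norm ((h x)\<^sup>2) \<le> (4 * (Q + 3))\<^sup>2" by simp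
      qed
    qed (use hm in measurable)
    have "integrable lebesgue01 (\<lambda>x. (sqrt (dens \<theta> x) - sqrt (?r x))\<^sup>2)"
    proof (rule U.integrable_const_bound[where B = "upper\<^sup>2 / (4 * lower)"])
      show "AE x in lebesgue01. norm ((sqrt (dens \<theta> x) - sqrt (?r x))\<^sup>2) \<le> upper\<^sup>2 / (4 * lower)"
      proof (rule AE_I2)
        fix x assume x: "x \<in> space lebesgue01"
        have "(sqrt (dens \<theta> x) - sqrt (?r x))\<^sup>2 \<le> (dens \<theta> x - ?r x)\<^sup>2 / (4 * lower)"
          by (rule sqrt_diff_sq_le[OF d(1) r(1)[OF x]])
        also have "\<dots> \<le> upper\<^sup>2 / (4 * lower)"
        proof (intro divide_right_mono)
          have "\<bar>dens \<theta> x - ?r x\<bar> \<le> upper" using d[of x] r[OF x] m_pos by linarith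
          from power_mono[OF this abs_ge_zero, of 2] show "(dens \<theta> x - ?r x)\<^sup>2 \<le> upper\<^sup>2" by simp
        qed simp
        finally show "norm ((sqrt (dens \<theta> x) - sqrt (?r x))\<^sup>2) \<le> upper\<^sup>2 / (4 * lower)" by simp
      qed
    qed measurable
    then show "integrable lebesgue01 (\<lambda>x. 4 / lower * (sqrt (dens \<theta> x) - sqrt (?r x))\<^sup>2)" by (rule integrable_mult_right)
    show "x \<in> space lebesgue01 \<Longrightarrow> (h x)\<^sup>2 \<le> 4 / lower * (sqrt (dens \<theta> x) - sqrt (?r x))\<^sup>2" for x
      unfolding h_def by (intro ln_diff_sq_le d r)
  qed
  also have "\<dots> = 4 / lower * loss \<theta> n X" by (simp add: loss_def)
  finally show ?thesis .
qed

text \<open>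
  The condition \<open>4 ^ p * \<kappa> < R\<close> places the cube in the ellipsoid, and \<open>\<kappa> * lipschitz \<le> lower * ln 2\<close>
  bounds the second moment of the likelihood ratio between neighbouring vertices by \<open>2\<close>.
\<close>

lemma risk_lower_bound_at_resolution:
  assumes k: "1 \<le> k" "real n \<le> real k ^ (2 * p + 1)"
    and R: "R \<le> Q" and \<kappa>: "0 < \<kappa>" "4 ^ p * \<kappa> < R" "\<kappa> * lipschitz \<le> lower * ln 2"
  shows "ennreal (lower * \<kappa> / 32 / real k ^ (2 * p)) \<le> (SUP \<theta>\<in>ellipsoid p R. risk prior_measure n \<theta>)"
proof -
  define h where "h = sqrt (\<kappa> / real k ^ (2 * p + 1))"
  have kk: "0 < real k" using k(1) by simp
  have h2: "h\<^sup>2 = \<kappa> / real k ^ (2 * p + 1)" unfolding h_def using \<kappa>(1) kk by (intro real_sqrt_pow2) auto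
  let ?J = "{1..k}"
  define vertex where "vertex S j = (if j \<in> S then h else 0)" for S :: "nat set" and j
  let ?sup = "SUP \<theta>\<in>ellipsoid p R. risk prior_measure n \<theta>"
  have vR: "vertex S \<in> ellipsoid p R" if S: "S \<subseteq> ?J" for S
  proof -
    have "(\<Sum>j\<in>?J. vseq j ^ (2 * p) * (vertex S j)\<^sup>2) \<le> (\<Sum>j\<in>?J. 4 ^ p * real k ^ (2 * p) * h\<^sup>2)"
    proof (intro sum_mono mult_mono)
      show "j \<in> ?J \<Longrightarrow> vseq j ^ (2 * p) \<le> 4 ^ p * real k ^ (2 * p)" for j by (rule vseq_power_le)
    qed (auto simp: vertex_def)
    also have "\<dots> = 4 ^ p * \<kappa>" using kk by (simp add: h2)
    also have "\<dots> < R" by (rule \<kappa>(2))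
    finally show ?thesis
      using S by (subst ellipsoid_finite_support[OF p, of k]) (auto simp: vertex_def)
  qed
  have vQ: "vertex S \<in> ellipsoid p Q" if "S \<subseteq> ?J" for S
    using vR[OF that] R by (auto simp: ellipsoid_def)
  define a where "a j S = (\<integral>\<^sup>+X. ennreal ((vertex S j - log_coef n j X)\<^sup>2) \<partial>iid {1..n} lebesgue01 (dens (vertex S)))" for j S
  have pair: "ennreal (h\<^sup>2 / 4) \<le> a j S + a j (insert j S)" if j: "j \<in> ?J" and S: "S \<subseteq> ?J - {j}" for j S
  proof -
    have S': "S \<subseteq> ?J" "insert j S \<subseteq> ?J" "j \<notin> S" using j S by auto
    have cn: "coef_norm (\<lambda>i. vertex (insert j S) i - vertex S i) = h\<^sup>2"
    proof -
      have "(\<lambda>i. (vertex (insert j S) (Suc i) - vertex S (Suc i))\<^sup>2) = (\<lambda>i. if i = j - 1 then h\<^sup>2 else 0)"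
        using S'(3) j by (auto simp: vertex_def fun_eq_iff)
      then show ?thesis using sums_single[of "j - 1" "\<lambda>_. h\<^sup>2"] by (simp add: coef_norm_def sums_iff)
    qed
    have "real (card {1..n}) * sqdist lebesgue01 (dens (vertex (insert j S))) (dens (vertex S)) / lower
        \<le> real n * (lipschitz * h\<^sup>2) / lower"
      using sqdist_dens_ellipsoid[OF vQ[OF S'(2)] vQ[OF S'(1)]] unfolding cn
      by (intro divide_right_mono mult_mono) (auto simp: sqdist_nonneg)
    also have "real n * (lipschitz * h\<^sup>2) / lower \<le> real k ^ (2 * p + 1) * (lipschitz * h\<^sup>2) / lower"
      using k(2) lipschitz_pos by (intro divide_right_mono mult_right_mono) auto
    also have "real k ^ (2 * p + 1) * (lipschitz * h\<^sup>2) = \<kappa> * lipschitz"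
      using kk by (simp add: h2)
    also have "\<kappa> * lipschitz / lower \<le> ln 2"
      using \<kappa>(3) by (subst pos_divide_le_eq) (auto simp: mult.commute)
    finally have "exp (real (card {1..n}) * sqdist lebesgue01 (dens (vertex (insert j S))) (dens (vertex S)) / lower) \<le> exp (ln 2)"
      by (simp only: exp_le_cancel_iff)
    then have close: "exp (real (card {1..n}) * sqdist lebesgue01 (dens (vertex (insert j S))) (dens (vertex S)) / lower) \<le> 2"
      by simp
    have "ennreal (h\<^sup>2 / 4) \<le> (\<integral>\<^sup>+X. ennreal ((log_coef n j X)\<^sup>2) \<partial>iid {1..n} lebesgue01 (dens (vertex S)))
        + (\<integral>\<^sup>+X. ennreal ((h - log_coef n j X)\<^sup>2) \<partial>iid {1..n} lebesgue01 (dens (vertex (insert j S))))"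
      by (rule two_point_lower_bound[OF bdens_dens[OF vQ[OF S'(1)]] bdens_dens[OF vQ[OF S'(2)]] _ log_coef_measurable close])
        simp
    then show ?thesis using S'(3) by (simp add: a_def vertex_def)
  qed
  have up: "(\<Sum>j\<in>?J. a j S) \<le> ennreal (4 / lower) * ?sup" if S: "S \<subseteq> ?J" for S
  proof -
    let ?P = "iid {1..n} lebesgue01 (dens (vertex S))"
    have m: "(\<lambda>X. ennreal ((vertex S j - log_coef n j X)\<^sup>2)) \<in> borel_measurable ?P" for j
    proof -
      note [measurable] = log_coef_measurable
      have "(\<lambda>X. ennreal ((vertex S j - log_coef n j X)\<^sup>2)) \<in> borel_measurable (\<Pi>\<^sub>M i\<in>{1..n}. lebesgue01)"
        by measurable
      then show ?thesis by (simp only: measurable_cong_sets[OF sets_iid refl])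
    qed
    have "(\<Sum>j\<in>?J. a j S) = (\<integral>\<^sup>+X. (\<Sum>j\<in>?J. ennreal ((vertex S j - log_coef n j X)\<^sup>2)) \<partial>?P)"
      unfolding a_def using m by (intro nn_integral_sum[symmetric])
    also have "\<dots> \<le> (\<integral>\<^sup>+X. ennreal (4 / lower * loss (vertex S) n X) \<partial>?P)"
    proof (rule nn_integral_mono)
      fix X assume X: "X \<in> space ?P"
      have "(\<Sum>j\<in>?J. (vertex S j - log_coef n j X)\<^sup>2) \<le> 4 / lower * loss (vertex S) n X"
        using X S by (intro loss_lower_bound vQ) (auto simp only: space_iid vertex_def, auto)
      then show "(\<Sum>j\<in>?J. ennreal ((vertex S j - log_coef n j X)\<^sup>2)) \<le> ennreal (4 / lower * loss (vertex S) n X)"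
        by (subst sum_ennreal) (auto intro: ennreal_leI)
    qed
    also have "\<dots> = ennreal (4 / lower) * risk prior_measure n (vertex S)"
    proof -
      have "(\<lambda>(X, x). (sqrt (dens (vertex S) x) - sqrt (posterior_mean {1..n} X x))\<^sup>2)
          \<in> borel_measurable ((\<Pi>\<^sub>M i\<in>{1..n}. lebesgue01) \<Otimes>\<^sub>M lebesgue01)"
      proof -
        have d: "(\<lambda>z. dens (vertex S) (snd z)) \<in> borel_measurable ((\<Pi>\<^sub>M i\<in>{1..n}. lebesgue01) \<Otimes>\<^sub>M lebesgue01)"
          using measurable_compose[OF measurable_snd borel_measurable_lebesgue01[OF dens_measurable]] .
        have sq: "sqrt \<in> borel_measurable borel" by measurable
        show ?thesis
          using borel_measurable_power[OF borel_measurable_diff[OF measurable_compose[OF d sq]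
              measurable_compose[OF posterior_mean_measurable[of "{1..n}"] sq]], of 2]
          by (simp add: split_beta')
      qed
      from U.borel_measurable_lebesgue_integral[OF this]
      have "loss (vertex S) n \<in> borel_measurable (\<Pi>\<^sub>M i\<in>{1..n}. lebesgue01)"
        by (simp add: loss_def[abs_def])
      then have lm: "(\<lambda>X. ennreal (loss (vertex S) n X)) \<in> borel_measurable ?P"
        by (simp only: measurable_cong_sets[OF sets_iid refl] measurable_compose[OF _ measurable_ennreal])
      have "ennreal (4 / lower * loss (vertex S) n X) = ennreal (4 / lower) * ennreal (loss (vertex S) n X)" for X
        by (rule ennreal_mult) (auto simp: loss_def)
      then show ?thesis unfolding risk_eq by (simp only: nn_integral_cmult[OF lm])
    qed
    also have "\<dots> \<le> ennreal (4 / lower) * ?sup"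
      using vR[OF S] by (intro mult_left_mono SUP_upper) auto
    finally show ?thesis .
  qed
  have "ennreal (real (card ?J) * (h\<^sup>2 / 4) / 2) \<le> ennreal (4 / lower) * ?sup"
    by (rule hypercube_lower_bound[of ?J _ a]) (use pair up in auto)
  then have "ennreal (lower / 4) * ennreal (real (card ?J) * (h\<^sup>2 / 4) / 2)
      \<le> ennreal (lower / 4) * (ennreal (4 / lower) * ?sup)"
    by (intro mult_left_mono) auto
  also have "\<dots> = ?sup"
  proof -
    have "ennreal (lower / 4) * ennreal (4 / lower) = 1" by (subst ennreal_mult[symmetric]) auto
    then show ?thesis by (simp add: mult.assoc[symmetric])
  qed
  also have "ennreal (lower / 4) * ennreal (real (card ?J) * (h\<^sup>2 / 4) / 2) = ennreal (lower * \<kappa> / 32 / real k ^ (2 * p))"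
    using kk \<kappa>(1) by (subst ennreal_mult[symmetric]) (auto simp: h2)
  finally show ?thesis .
qed

end


section \<open>The rate\<close>

text \<open>
  The resolution \<open>k\<close> is \<open>y = n powr (1 / (2 * p + 1))\<close> rounded up; as \<open>y \<ge> 1\<close>, it is between
  \<open>y\<close> and \<open>2 * y\<close>.
\<close>

lemma resolution_exists:
  fixes n p :: nat
  assumes n: "1 \<le> n"
  defines "r \<equiv> - 2 * real p / (2 * real p + 1)"
  shows "\<exists>k\<ge>1. real n \<le> real k ^ (2 * p + 1) \<and> real k ^ (2 * p + 1) \<le> 2 ^ (2 * p + 1) * real n
    \<and> 1 / real k ^ (2 * p) \<le> real n powr r \<and> real n powr r / 4 ^ p \<le> 1 / real k ^ (2 * p)"
proof -
  define y where "y = real n powr (1 / real (2 * p + 1))"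
  define k where "k = nat \<lceil>y\<rceil>"
  have y1: "1 \<le> y" unfolding y_def using n by (intro ge_one_powr_ge_zero) auto
  have k: "y \<le> real k" "real k \<le> 2 * y" "1 \<le> k" unfolding k_def using y1 by linarith+
  have yn: "y ^ (2 * p + 1) = real n"
  proof -
    have "y ^ (2 * p + 1) = y powr real (2 * p + 1)" using y1 by (subst powr_realpow) auto
    also have "\<dots> = real n powr 1" unfolding y_def powr_powr by simp
    finally show ?thesis using n by simp
  qed
  have yr: "real n powr r = 1 / y ^ (2 * p)"
  proof -
    have "y ^ (2 * p) = y powr real (2 * p)" using y1 by (subst powr_realpow) auto
    also have "\<dots> = real n powr (- r)" unfolding y_def powr_powr r_def by (simp add: field_simps)
    finally show ?thesis by (simp add: powr_minus_divide)
  qed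
  have "y ^ (2 * p + 1) \<le> real k ^ (2 * p + 1)" "y ^ (2 * p) \<le> real k ^ (2 * p)"
    using k(1) y1 by (intro power_mono; simp)+
  moreover have "real k ^ (2 * p + 1) \<le> 2 ^ (2 * p + 1) * real n"
    unfolding yn[symmetric] power_mult_distrib[symmetric] using k(2) by (intro power_mono) auto
  moreover have "real k ^ (2 * p) \<le> 4 ^ p * y ^ (2 * p)"
  proof -
    have "real k ^ (2 * p) \<le> (2 * y) ^ (2 * p)" using k(2) by (intro power_mono) auto
    also have "\<dots> = 4 ^ p * y ^ (2 * p)" by (simp add: power_mult_distrib power_mult)
    finally show ?thesis .
  qed
  moreover have "0 < y ^ (2 * p)" "0 < real k ^ (2 * p)" using y1 k(3) by auto
  ultimately have "real n \<le> real k ^ (2 * p + 1)" "real k ^ (2 * p + 1) \<le> 2 ^ (2 * p + 1) * real n"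
    "1 / real k ^ (2 * p) \<le> real n powr r" "real n powr r / 4 ^ p \<le> 1 / real k ^ (2 * p)"
    unfolding yn yr by (auto simp: field_simps)
  then show ?thesis using k(3) by blast
qed

lemma sieve_prior_ge:
  assumes "S \<in> sets (\<Pi>\<^sub>M j\<in>UNIV. borel)"
  shows "ennreal (pmf lam k) * emeasure (gauss_prior p k) S \<le> emeasure (sieve_prior p lam) S"
proof -
  have "(\<Sum>i\<in>{k}. ennreal (pmf lam i) * emeasure (gauss_prior p i) S)
      \<le> (\<Sum>i. ennreal (pmf lam i) * emeasure (gauss_prior p i) S)"
    by (intro sum_le_suminf summableI) auto
  then show ?thesis by (simp add: emeasure_sieve_prior[OF assms])
qed

theorem corollary2:
  fixes p :: nat and Q Q' a \<gamma> :: real and lam :: "nat pmf"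
  assumes "p \<ge> 1" and "Q > 0"
    and "pmf lam 0 = 0"
    and "a > 0" and "\<gamma> > 0"
    and "\<And>k. k \<ge> 1 \<Longrightarrow> pmf lam k \<ge> a * exp (- \<gamma> * real k)"
    and "0 < Q'" and "Q' < Q"
  shows "\<exists>c C :: real. 0 < c \<and> c \<le> C \<and>
    (\<forall>\<^sub>F n in sequentially.
       ennreal (c * real n powr (- 2 * real p / (2 * real p + 1)))
         \<le> (SUP \<theta>\<^sub>0\<in>ellipsoid p Q'. risk (restricted_prior p lam Q) n \<theta>\<^sub>0) \<and>
       (SUP \<theta>\<^sub>0\<in>ellipsoid p Q'. risk (restricted_prior p lam Q) n \<theta>\<^sub>0)
         \<le> ennreal (C * real n powr (- 2 * real p / (2 * real p + 1))))"
proof -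
  note lam = assms(6)
  obtain A0 D where D: "0 \<le> D" and gauss: "\<And>k \<theta>\<^sub>0. 1 \<le> k \<Longrightarrow> \<theta>\<^sub>0 \<in> ellipsoid p Q' \<Longrightarrow>
     \<exists>S\<in>sets (\<Pi>\<^sub>M j\<in>UNIV. borel).
       S \<subseteq> coef_ball p Q \<theta>\<^sub>0 (D / real k ^ (2 * p)) \<and>
       ennreal (exp (- (A0 * real k))) \<le> emeasure (gauss_prior p k) S"
    using gauss_prior_mass[OF \<open>p \<ge> 1\<close> \<open>0 < Q'\<close> \<open>Q' < Q\<close>] by blast
  \<comment> \<open>Absorbs the weight \<open>a * exp (- \<gamma> * k)\<close> of the component \<open>k\<close>, using \<open>k \<ge> 1\<close> for the constant \<open>a\<close>.\<close>
  define A where "A = \<bar>ln a\<bar> + \<gamma> + \<bar>A0\<bar>"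
  have A: "0 \<le> A" using \<open>\<gamma> > 0\<close> by (simp add: A_def)
  have sieve: "\<exists>S\<in>sets (\<Pi>\<^sub>M j\<in>UNIV. borel).
       S \<subseteq> coef_ball p Q \<theta>\<^sub>0 (D / real k ^ (2 * p)) \<and>
       ennreal (exp (- (A * real k))) \<le> emeasure (sieve_prior p lam) S"
    if k: "1 \<le> k" and \<theta>\<^sub>0: "\<theta>\<^sub>0 \<in> ellipsoid p Q'" for k \<theta>\<^sub>0
  proof -
    obtain S where S: "S \<in> sets (\<Pi>\<^sub>M j\<in>UNIV. borel)"
      "S \<subseteq> coef_ball p Q \<theta>\<^sub>0 (D / real k ^ (2 * p))"
      "ennreal (exp (- (A0 * real k))) \<le> emeasure (gauss_prior p k) S"
      using gauss[OF k \<theta>\<^sub>0] by blast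
    have "exp (- (A * real k)) \<le> a * exp (- \<gamma> * real k) * exp (- (A0 * real k))"
    proof -
      have "a * exp (- \<gamma> * real k) * exp (- (A0 * real k)) = exp (ln a - \<gamma> * real k - A0 * real k)"
        using \<open>a > 0\<close> by (simp add: exp_diff exp_minus exp_add field_simps)
      moreover have "- (A * real k) \<le> ln a - \<gamma> * real k - A0 * real k"
      proof -
        have "\<bar>ln a\<bar> * 1 \<le> \<bar>ln a\<bar> * real k" "A0 * real k \<le> \<bar>A0\<bar> * real k"
          using k by (intro mult_left_mono mult_right_mono; simp)+
        then show ?thesis unfolding A_def by (simp add: algebra_simps)
      qed
      ultimately show ?thesis by simp
    qed
    also have "\<dots> \<le> pmf lam k * exp (- (A0 * real k))"
      using lam[OF k] by (intro mult_right_mono) auto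
    finally have "ennreal (exp (- (A * real k))) \<le> ennreal (pmf lam k) * ennreal (exp (- (A0 * real k)))"
      by (subst ennreal_mult[symmetric]) (auto intro: ennreal_leI)
    also have "\<dots> \<le> ennreal (pmf lam k) * emeasure (gauss_prior p k) S"
      by (intro mult_left_mono S(3)) auto
    also have "\<dots> \<le> emeasure (sieve_prior p lam) S" by (rule sieve_prior_ge[OF S(1)])
    finally show ?thesis using S by blast
  qed
  interpret sieve: prob_space "sieve_prior p lam" by (rule prob_space_sieve_prior)
  have E: "ellipsoid p Q \<in> sets (sieve_prior p lam)"
    by (simp add: sets_sieve_prior ellipsoid_measurable)
  have zero: "(\<lambda>_. 0) \<in> ellipsoid p Q'" using \<open>0 < Q'\<close> by (simp add: ellipsoid_def)
  have mass_pos: "emeasure (sieve_prior p lam) (ellipsoid p Q) \<noteq> 0"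
  proof -
    obtain S where S: "S \<subseteq> ellipsoid p Q" "ennreal (exp (- (A * real 1))) \<le> emeasure (sieve_prior p lam) S"
      using sieve[OF order_refl zero] by blast
    have "0 < ennreal (exp (- (A * real 1)))" by simp
    also have "\<dots> \<le> emeasure (sieve_prior p lam) (ellipsoid p Q)"
      using S(2) emeasure_mono[OF S(1) E] by (rule order_trans)
    finally show ?thesis by simp
  qed
  interpret ellipsoid_prior p lam Q
    using \<open>p \<ge> 1\<close> \<open>Q > 0\<close> mass_pos by (rule ellipsoid_prior.intro)
  have restricted: "\<exists>S\<in>sets coef_space.
       S \<subseteq> coef_ball p Q \<theta>\<^sub>0 (D / real k ^ (2 * p)) \<and>
       exp (- (A * real k)) \<le> measure prior_measure S"
    if k: "1 \<le> k" and \<theta>\<^sub>0: "\<theta>\<^sub>0 \<in> ellipsoid p Q'" for k \<theta>\<^sub>0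
  proof -
    obtain S where S: "S \<in> sets coef_space"
      "S \<subseteq> coef_ball p Q \<theta>\<^sub>0 (D / real k ^ (2 * p))"
      "ennreal (exp (- (A * real k))) \<le> emeasure (sieve_prior p lam) S"
      using sieve[OF k \<theta>\<^sub>0] by blast
    have SE: "S \<inter> ellipsoid p Q = S" using S(2) by auto
    have pos: "0 < sieve.prob (ellipsoid p Q)"
      using mass_pos by (simp add: sieve.emeasure_eq_measure measure_le_0_iff flip: not_le)
    have s: "exp (- (A * real k)) \<le> sieve.prob S"
      using S(3) by (simp add: sieve.emeasure_eq_measure)
    have "emeasure prior_measure S = ennreal (sieve.prob S / sieve.prob (ellipsoid p Q))"
      unfolding emeasure_restricted_prior[OF S(1)] SE sieve.emeasure_eq_measure
      using pos by (intro divide_ennreal) auto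
    then have m: "measure prior_measure S = sieve.prob S / sieve.prob (ellipsoid p Q)"
      using pos by (simp add: measure_def)
    have "sieve.prob S \<le> sieve.prob S / sieve.prob (ellipsoid p Q)"
      using pos sieve.prob_le_1[of "ellipsoid p Q"]
      by (simp add: le_divide_eq mult_left_le)
    then have "exp (- (A * real k)) \<le> measure prior_measure S" using s m by linarith
    then show ?thesis using S by blast
  qed
  define \<kappa> where "\<kappa> = min (Q' / (2 * 4 ^ p)) (lower * ln 2 / lipschitz)"
  have \<kappa>: "0 < \<kappa>" "4 ^ p * \<kappa> < Q'" "\<kappa> * lipschitz \<le> lower * ln 2"
  proof -
    show "0 < \<kappa>" using \<open>0 < Q'\<close> lipschitz_pos by (simp add: \<kappa>_def)
    have "4 ^ p * \<kappa> \<le> 4 ^ p * (Q' / (2 * 4 ^ p))" by (intro mult_left_mono) (auto simp: \<kappa>_def)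
    also have "\<dots> = Q' / 2" by simp
    finally show "4 ^ p * \<kappa> < Q'" using \<open>0 < Q'\<close> by linarith
    have "\<kappa> \<le> lower * ln 2 / lipschitz" by (simp add: \<kappa>_def)
    then show "\<kappa> * lipschitz \<le> lower * ln 2" using lipschitz_pos by (simp add: le_divide_eq)
  qed
  define c where "c = lower * \<kappa> / 32 / 4 ^ p"
  define A1 where "A1 = Q + 1 + ln (2 ^ p + 1) + real p"
  define A3 where "A3 = lipschitz * D / lower"
  define T where "T = 2 * (lipschitz * (1 + Q) + 16 * upper * (2 ^ (2 * p + 1) * (A1 + A + A3 + 2)
        + upper / lower\<^sup>2 * (lipschitz * (1 + Q))))"
  define C0 where "C0 = (T + upper\<^sup>2 * (3 * fact (2 * p))) / (4 * lower)"
  define C where "C = max c \<bar>C0\<bar>"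
  let ?rate = "\<lambda>n::nat. real n powr (- 2 * real p / (2 * real p + 1))"
  let ?sup = "\<lambda>n. SUP \<theta>\<^sub>0\<in>ellipsoid p Q'. risk prior_measure n \<theta>\<^sub>0"
  have "ennreal (c * ?rate n) \<le> ?sup n \<and> ?sup n \<le> ennreal (C * ?rate n)" if n: "1 \<le> n" for n
  proof
    obtain k where k: "1 \<le> k" "real n \<le> real k ^ (2 * p + 1)" "real k ^ (2 * p + 1) \<le> 2 ^ (2 * p + 1) * real n"
      "1 / real k ^ (2 * p) \<le> ?rate n" "?rate n / 4 ^ p \<le> 1 / real k ^ (2 * p)"
      using resolution_exists[OF n, of p] by blast
    have "c * ?rate n = lower * \<kappa> / 32 * (?rate n / 4 ^ p)" by (simp add: c_def)
    also have "\<dots> \<le> lower * \<kappa> / 32 * (1 / real k ^ (2 * p))"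
      using k(5) \<kappa>(1) by (intro mult_left_mono) auto
    finally have "ennreal (c * ?rate n) \<le> ennreal (lower * \<kappa> / 32 / real k ^ (2 * p))"
      by (intro ennreal_leI) simp
    also have "\<dots> \<le> ?sup n"
      using \<open>Q' < Q\<close> by (intro risk_lower_bound_at_resolution k \<kappa>) auto
    finally show "ennreal (c * ?rate n) \<le> ?sup n" .
    show "?sup n \<le> ennreal (C * ?rate n)"
    proof (rule SUP_least)
      fix \<theta>\<^sub>0 assume \<theta>\<^sub>0: "\<theta>\<^sub>0 \<in> ellipsoid p Q'"
      then have \<theta>\<^sub>0Q: "\<theta>\<^sub>0 \<in> ellipsoid p Q" using \<open>Q' < Q\<close> by (auto simp: ellipsoid_def)
      obtain S where S: "S \<in> sets coef_space"
        "S \<subseteq> coef_ball p Q \<theta>\<^sub>0 (D / real k ^ (2 * p))"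
        "exp (- (A * real k)) \<le> measure prior_measure S"
        using restricted[OF k(1) \<theta>\<^sub>0] by blast
      have "risk prior_measure n \<theta>\<^sub>0 \<le> ennreal (C0 / real k ^ (2 * p))"
        unfolding C0_def
        by (rule risk_upper_bound_at_resolution[OF k(1-3) \<theta>\<^sub>0Q S A D A1_def A3_def T_def])
      also have "ennreal (C0 / real k ^ (2 * p)) \<le> ennreal (C * ?rate n)"
      proof (rule ennreal_leI)
        have "C0 / real k ^ (2 * p) \<le> C * (1 / real k ^ (2 * p))"
          unfolding times_divide_eq_right mult_1_right by (intro divide_right_mono) (auto simp: C_def)
        also have "\<dots> \<le> C * ?rate n" by (intro mult_left_mono k(4)) (simp add: C_def le_max_iff_disj)
        finally show "C0 / real k ^ (2 * p) \<le> C * ?rate n" .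
      qed
      finally show "risk prior_measure n \<theta>\<^sub>0 \<le> ennreal (C * ?rate n)" .
    qed
  qed
  then have "\<forall>\<^sub>F n in sequentially. ennreal (c * ?rate n) \<le> ?sup n \<and> ?sup n \<le> ennreal (C * ?rate n)"
    by (rule eventually_sequentiallyI)
  moreover have "0 < c" "c \<le> C" using \<kappa>(1) by (auto simp: c_def C_def)
  ultimately show ?thesis by blast
qed

end
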